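(* There exist at least $44$ pairwise inequivalent extremal Type II binary self-dual codes of length $80$, i.e. at least $44$ pairwise inequivalent Type II binary self-dual codes with parameters $[80,40,16]$.
   Context: A binary linear code of length $m$ is a linear subspace $C$ of $\mathbb{F}_2^{m}$; it has parameters $[m,k,d]$ if it has dimension $k$ and minimum Hamming distance $d$. It is self-dual if $C=C^{\perp}$ with respect to the standard inner product $\langle\mathbf{u},\mathbf{v}\rangle=\sum_i u_iv_i$. A binary self-dual code is Type II if the Hamming weight of every codeword is a multiple of $4$. A binary self-dual code of length $m$ has minimum distance $d\le 4\lfloor m/24\rfloor+6$ if $m\equiv 22\pmod{24}$ and $d\le 4\lfloor m/24\rfloor+4$ otherwise; it is extremal if it meets this bound, which for $m=80$ means $d=16$. Two binary codes of the same length are equivalent if one is obtained from the other by a permutation of the coordinates. *)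

theory Defs
  imports "HOL-Analysis.Cartesian_Space" "HOL-Library.Numeral_Type" "HOL-Library.Z2"
begin

text \<open>
  The field with two elements is the type \<^typ>\<open>bit\<close>, and the coordinates of a code are indexed
  by a finite type, so that the length of a code in \<^typ>\<open>bit ^ 'n\<close> is \<open>CARD('n)\<close>; length 80 is
  obtained from the numeral type \<^typ>\<open>80\<close>, for which \<open>CARD(80) = 80\<close>.
\<close>

type_synonym 'n binary_vec = "bit ^ 'n"

definition hamming_distance :: "'n::finite binary_vec \<Rightarrow> 'n binary_vec \<Rightarrow> nat" where
  "hamming_distance u v = card {i. u $ i \<noteq> v $ i}"

definition hamming_weight :: "'n::finite binary_vec \<Rightarrow> nat" where
  "hamming_weight u = card {i. u $ i \<noteq> 0}"

definition binary_linear_code :: "'n::finite binary_vec set \<Rightarrow> bool" where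
  "binary_linear_code C \<longleftrightarrow> vec.subspace C"

text \<open>Only meaningful for codes with at least two codewords (\<^const>\<open>Min\<close> of the empty set is
  unspecified).\<close>

definition min_distance :: "'n::finite binary_vec set \<Rightarrow> nat" where
  "min_distance C = Min {hamming_distance u v | u v. u \<in> C \<and> v \<in> C \<and> u \<noteq> v}"

definition has_parameters :: "'n::finite binary_vec set \<Rightarrow> nat \<Rightarrow> nat \<Rightarrow> nat \<Rightarrow> bool" where
  "has_parameters C m k d \<longleftrightarrow>
     binary_linear_code C \<and> CARD('n) = m \<and> vec.dim C = k \<and> min_distance C = d"

definition dual_code :: "'n::finite binary_vec set \<Rightarrow> 'n binary_vec set" where
  "dual_code C = {v. \<forall>u\<in>C. scalar_product u v = 0}"

definition self_dual :: "'n::finite binary_vec set \<Rightarrow> bool" where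
  "self_dual C \<longleftrightarrow> binary_linear_code C \<and> C = dual_code C"

definition type_II :: "'n::finite binary_vec set \<Rightarrow> bool" where
  "type_II C \<longleftrightarrow> self_dual C \<and> (\<forall>c\<in>C. 4 dvd hamming_weight c)"

definition self_dual_bound :: "nat \<Rightarrow> nat" where
  "self_dual_bound m =
     (if m mod 24 = 22 then 4 * (m div 24) + 6 else 4 * (m div 24) + 4)"

definition extremal :: "'n::finite binary_vec set \<Rightarrow> bool" where
  "extremal C \<longleftrightarrow> self_dual C \<and> min_distance C = self_dual_bound CARD('n)"

definition permute_coords :: "('n \<Rightarrow> 'n) \<Rightarrow> 'n::finite binary_vec \<Rightarrow> 'n binary_vec" where
  "permute_coords p v = (\<chi> i. v $ p i)"

definition equivalent_codes :: "'n::finite binary_vec set \<Rightarrow> 'n binary_vec set \<Rightarrow> bool" where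
  "equivalent_codes C D \<longleftrightarrow> (\<exists>p. bij p \<and> D = permute_coords p ` C)"

end

theory Submission imports Defs "HOL-Library.FuncSet" "HOL-Library.Multiset" begin

text \<open>
  All 44 codes have an automorphism \<open>\<sigma>\<close> of order 5 that permutes the 80 coordinates in sixteen cycles
  of length 5. As a module over the group algebra of the group generated by \<open>\<sigma>\<close>, such a code is the direct
  sum of its words constant on the cycles and of its words of even weight on every cycle. The first summand is taken to be
  two copies of the extended Hamming code of length 8, one on the first eight cycles and one on the
  last eight, the second one is a code over the field with 16 elements, generated by
  \<open>(I | A)\<close> for a unitary matrix \<open>A\<close> of size 8. The elements of this field are the even subsets of a
  cycle, called symbols below. The theorem is proved by exhibiting 44 such matrices.

  If \<open>A\<close> is unitary and preserves weights modulo 4 then the code is doubly even, hence self-orthogonal, and has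
  \<open>2 ^ 40\<close> words; so it is a self-dual Type II code. Both properties are bilinear or
  quadratic and are checked on a basis. Every word has even weight on each of the two blocks of eight cycles, so a word of
  weight less than 16 (that is, at most 12) has weight at most 6 on one of them, and all such restrictions are enumerated;
  unitarity turns the enumeration for the second block into one for the conjugate transpose
  (lemma \<open>min_cost\<close>). The enumeration is carried out by rewriting, up to rotation, with pruning by the
  smallest cost that a vector of symbols can have.

  Inequivalence rests on the fact that the group generated by \<open>\<sigma>\<close> plays the role of a Sylow subgroup. An
  automorphism of order 5 with at least 20 fixed points is trivial by a Plotkin-type bound
  (lemma \<open>automorphism_fixing_20\<close>). It follows that only the powers of \<open>\<sigma>\<close> are automorphisms
  of order 5 commuting with \<open>\<sigma>\<close> (lemma \<open>centraliser\<close>), and then a conjugation argument shows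
  that equivalent codes are equivalent under a permutation normalising the group generated by \<open>\<sigma>\<close>. Such a permutation
  respects the cycles and the two blocks. Therefore the set of block profiles of the codewords, which records the
  weights on the cycles of each block, is an invariant (theorem \<open>equivalent_block_profiles\<close>).
  Seven particular profiles separate the 44 codes.
\<close>

section \<open>Linear families of sets\<close>

definition sdiff :: "'a set \<Rightarrow> 'a set \<Rightarrow> 'a set" (infixl "\<triangle>" 65) where
  "X \<triangle> Y = {x. (x \<in> X) \<noteq> (x \<in> Y)}"

text \<open>Vectors over the two-element field are represented by their supports, so that addition is symmetric difference and a linear code is a family of sets closed under it.\<close>
definition linear :: "'a set set \<Rightarrow> bool" where
  "linear \<C> \<longleftrightarrow> {} \<in> \<C> \<and> (\<forall>X\<in>\<C>. \<forall>Y\<in>\<C>. X \<triangle> Y \<in> \<C>)"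

lemma in_sdiff [simp]: "x \<in> X \<triangle> Y \<longleftrightarrow> (x \<in> X) \<noteq> (x \<in> Y)"
  by (simp add: sdiff_def)

lemma sdiff_simps [simp]: "X \<triangle> X = {}" "X \<triangle> {} = X" "{} \<triangle> X = X" "X \<triangle> (X \<triangle> Y) = Y"
  "X \<triangle> Y \<triangle> Y = X"
  by auto

lemma sdiff_eq_empty: "X \<triangle> Y = {} \<longleftrightarrow> X = Y" by auto
lemma sdiff_Int: "(X \<triangle> Y) \<inter> Z = (X \<inter> Z) \<triangle> (Y \<inter> Z)" by auto
lemma sdiff_subset: "X \<subseteq> Z \<Longrightarrow> Y \<subseteq> Z \<Longrightarrow> X \<triangle> Y \<subseteq> Z" by auto

lemma image_sdiff: "inj p \<Longrightarrow> p ` (X \<triangle> Y) = p ` X \<triangle> p ` Y"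
  unfolding sdiff_def inj_on_def by blast

lemma finite_sdiff [simp]: "finite X \<Longrightarrow> finite Y \<Longrightarrow> finite (X \<triangle> Y)"
  by (rule finite_subset[of _ "X \<union> Y"]) auto

lemma card_sdiff: "finite X \<Longrightarrow> finite Y \<Longrightarrow> card (X \<triangle> Y) + 2 * card (X \<inter> Y) = card X + card Y"
proof -
  assume f: "finite X" "finite Y"
  have "card (X \<triangle> Y) = card ((X \<union> Y) - (X \<inter> Y))" by (rule arg_cong[of _ _ card]) auto
  moreover have "card ((X \<union> Y) - (X \<inter> Y)) = card (X \<union> Y) - card (X \<inter> Y)"
    using f by (intro card_Diff_subset) auto
  moreover have "card (X \<union> Y) + card (X \<inter> Y) = card X + card Y"
    using f by (metis card_Un_Int)
  moreover have "card (X \<inter> Y) \<le> card (X \<union> Y)" using f by (intro card_mono) auto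
  ultimately show ?thesis by linarith
qed

lemma even_card_sdiff: "finite X \<Longrightarrow> finite Y \<Longrightarrow> even (card (X \<triangle> Y)) = (even (card X) = even (card Y))"
  using card_sdiff[of X Y] by presburger

lemma linear_sdiff: "linear \<C> \<Longrightarrow> X \<in> \<C> \<Longrightarrow> Y \<in> \<C> \<Longrightarrow> X \<triangle> Y \<in> \<C>" by (simp add: linear_def)
lemma linear_empty: "linear \<C> \<Longrightarrow> {} \<in> \<C>" by (simp add: linear_def)

lemma bij_betw_translate: "linear \<C> \<Longrightarrow> Y \<in> \<C> \<Longrightarrow> bij_betw (\<lambda>X. X \<triangle> Y) \<C> \<C>"
  by (rule bij_betw_byWitness[where f' = "\<lambda>X. X \<triangle> Y"]) (auto simp: linear_sdiff)

definition orth :: "'a set \<Rightarrow> 'a set set \<Rightarrow> 'a set set" where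
  "orth S \<A> = {X. X \<subseteq> S \<and> (\<forall>A\<in>\<A>. even (card (A \<inter> X)))}"

definition parity_sign :: "'a set \<Rightarrow> int" where "parity_sign X = (if even (card X) then 1 else - 1)"

lemma parity_sign_sdiff: "finite X \<Longrightarrow> finite Y \<Longrightarrow> parity_sign (X \<triangle> Y) = parity_sign X * parity_sign Y"
  by (simp add: parity_sign_def even_card_sdiff)

lemma linear_Pow: "linear (Pow S)" by (auto simp: linear_def)

lemma sum_signs:
  assumes "finite S" "linear \<A>" "\<A> \<subseteq> Pow S" "finite T"
  shows "(\<Sum>A\<in>\<A>. parity_sign (A \<inter> T)) = (if \<forall>A\<in>\<A>. even (card (A \<inter> T)) then int (card \<A>) else 0)"
proof (cases "\<forall>A\<in>\<A>. even (card (A \<inter> T))")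
  case True
  then show ?thesis by (simp add: parity_sign_def)
next
  case False
  then obtain B where B: "B \<in> \<A>" "odd (card (B \<inter> T))" by auto
  have fin: "finite A" if "A \<in> \<A>" for A using that assms finite_subset by blast
  have "(\<Sum>A\<in>\<A>. parity_sign (A \<inter> T)) = (\<Sum>A\<in>\<A>. parity_sign ((A \<triangle> B) \<inter> T))"
    using sum.reindex_bij_betw[OF bij_betw_translate[OF assms(2) B(1)], of "\<lambda>A. parity_sign (A \<inter> T)"] by simp
  also have "\<dots> = (\<Sum>A\<in>\<A>. - parity_sign (A \<inter> T))"
    using B assms(4) by (intro sum.cong) (auto simp: sdiff_Int parity_sign_sdiff parity_sign_def even_card_sdiff)
  finally show ?thesis using False by (auto simp: sum_negf)
qed

text \<open>Double counting of the signs of all intersections: a sum of signs over a linear family vanishes unless all signs are positive. This is the dimension formula for the orthogonal space in counting form.\<close>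
lemma card_orth:
  assumes "finite S" "linear \<A>" "\<A> \<subseteq> Pow S"
  shows "card \<A> * card (orth S \<A>) = 2 ^ card S"
proof -
  have finA: "finite \<A>" using assms finite_subset by blast
  have "(\<Sum>X\<in>Pow S. \<Sum>A\<in>\<A>. parity_sign (A \<inter> X)) = (\<Sum>X\<in>Pow S. if X \<in> orth S \<A> then int (card \<A>) else 0)"
    using assms finite_subset by (intro sum.cong refl) (subst sum_signs[of S], auto simp: orth_def)
  also have "\<dots> = (\<Sum>X\<in>orth S \<A>. int (card \<A>))"
  proof -
    have "Pow S \<inter> {X. X \<in> orth S \<A>} = orth S \<A>" by (auto simp: orth_def)
    then show ?thesis using assms(1) by (subst sum.inter_restrict[symmetric]) (auto simp: Int_def)
  qed
  finally have 1: "(\<Sum>X\<in>Pow S. \<Sum>A\<in>\<A>. parity_sign (A \<inter> X)) = int (card \<A> * card (orth S \<A>))"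
    by simp
  have *: "(\<Sum>X\<in>Pow S. parity_sign (A \<inter> X)) = (if A = {} then 2 ^ card S else 0)" if "A \<in> \<A>" for A
  proof -
    have AS: "A \<subseteq> S" using that assms by auto
    then have fA: "finite A" using assms(1) finite_subset by blast
    have "(\<Sum>X\<in>Pow S. parity_sign (X \<inter> A)) = (if \<forall>X\<in>Pow S. even (card (X \<inter> A)) then int (card (Pow S)) else 0)"
      by (rule sum_signs[OF assms(1) linear_Pow subset_refl fA])
    moreover have "(\<forall>X\<in>Pow S. even (card (X \<inter> A))) = (A = {})"
    proof
      assume h: "\<forall>X\<in>Pow S. even (card (X \<inter> A))"
      show "A = {}"
      proof (rule ccontr)
        assume "A \<noteq> {}" then obtain a where "a \<in> A" by auto
        then show False using h[rule_format, of "{a}"] AS by auto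
      qed
    qed auto
    ultimately show ?thesis using assms(1) by (simp add: Int_commute card_Pow)
  qed
  have "(\<Sum>X\<in>Pow S. \<Sum>A\<in>\<A>. parity_sign (A \<inter> X)) = (\<Sum>A\<in>\<A>. \<Sum>X\<in>Pow S. parity_sign (A \<inter> X))"
    by (rule sum.swap)
  also have "\<dots> = (\<Sum>A\<in>\<A>. if A = {} then 2 ^ card S else 0)"
    using * by (intro sum.cong) auto
  also have "\<dots> = 2 ^ card S" using finA linear_empty[OF assms(2)] by simp
  finally have "int (card \<A> * card (orth S \<A>)) = int (2 ^ card S)" using 1 by simp
  then show ?thesis by (simp only: of_nat_eq_iff)
qed

lemma card_orthogonal_le:
  assumes "finite S" "linear \<A>" "\<A> \<subseteq> Pow S" "\<B> \<subseteq> Pow S"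
    and "\<And>A B. A \<in> \<A> \<Longrightarrow> B \<in> \<B> \<Longrightarrow> even (card (A \<inter> B))"
  shows "card \<A> * card \<B> \<le> 2 ^ card S"
proof -
  have "\<B> \<subseteq> orth S \<A>" using assms by (auto simp: orth_def)
  moreover have "finite (orth S \<A>)" using assms(1) by (auto simp: orth_def)
  ultimately have "card \<B> \<le> card (orth S \<A>)" by (simp add: card_mono)
  then show ?thesis using card_orth[OF assms(1-3)] by (metis mult_le_mono2)
qed

text \<open>The rank-nullity theorem in counting form; all fibres of an additive map are translates of its kernel.\<close>
lemma card_kernel_image:
  assumes "finite \<C>" "linear \<C>" and f: "\<And>X Y. X \<in> \<C> \<Longrightarrow> Y \<in> \<C> \<Longrightarrow> f (X \<triangle> Y) = f X \<triangle> f Y"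
  shows "card \<C> = card (f ` \<C>) * card {X \<in> \<C>. f X = {}}"
proof -
  have fib: "card {X \<in> \<C>. f X = Z} = card {X \<in> \<C>. f X = {}}" if "Z \<in> f ` \<C>" for Z
  proof -
    obtain X0 where X0: "X0 \<in> \<C>" "Z = f X0" using \<open>Z \<in> f ` \<C>\<close> by auto
    have "bij_betw (\<lambda>X. X \<triangle> X0) {X \<in> \<C>. f X = Z} {X \<in> \<C>. f X = {}}"
      using X0 assms(2) by (intro bij_betw_byWitness[where f' = "\<lambda>X. X \<triangle> X0"]) (auto simp: f linear_sdiff)
    then show ?thesis by (rule bij_betw_same_card)
  qed
  have "card \<C> = (\<Sum>Z\<in>f ` \<C>. card {X \<in> \<C>. f X = Z})"
    using sum.image_gen[OF assms(1), of "\<lambda>_. 1::nat" f] by simp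
  also have "\<dots> = (\<Sum>Z\<in>f ` \<C>. card {X \<in> \<C>. f X = {}})" using fib by (intro sum.cong) auto
  finally show ?thesis by simp
qed

lemma double_count_le:
  assumes "card \<Y> = 8" and "x \<in> S"
  shows "(\<Sum>X\<in>\<Y>. \<Sum>Y\<in>\<Y>. if x \<in> X \<triangle> Y then 1 else 0) \<le> (32::nat)"
proof -
  have fin: "finite \<Y>" using assms(1) card.infinite[of \<Y>] by fastforce
  define k where "k = card {X\<in>\<Y>. x \<in> X}"
  have c: "card {X\<in>\<Y>. x \<notin> X} = 8 - k" 
  proof -
    have "{X\<in>\<Y>. x \<notin> X} = \<Y> - {X\<in>\<Y>. x \<in> X}" by auto
    then show ?thesis using fin assms(1) by (simp add: card_Diff_subset k_def)
  qed
  have k8: "k \<le> 8" unfolding k_def using fin assms(1) by (metis (no_types, lifting) card_mono mem_Collect_eq subsetI)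
  have 1: "(\<Sum>Y\<in>\<Y>. if x \<in> X \<triangle> Y then 1 else 0) = (if x \<in> X then 8 - k else k)" for X :: "'a set"
  proof -
    have "(\<Sum>Y\<in>\<Y>. if x \<in> X \<triangle> Y then 1 else (0::nat)) = card {Y \<in> \<Y>. x \<in> X \<triangle> Y}"
      using fin by (subst sum.inter_filter[symmetric]) auto
    also have "\<dots> = (if x \<in> X then 8 - k else k)" using c by (auto simp: k_def)
    finally show ?thesis .
  qed
  have "(\<Sum>X\<in>\<Y>. if x \<in> X then 8 - k else k) = k * (8 - k) + (8 - k) * k"
  proof -
    have "(\<Sum>X\<in>\<Y>. if x \<in> X then 8 - k else k) = (\<Sum>X\<in>{X\<in>\<Y>. x \<in> X}. 8 - k) + (\<Sum>X\<in>{X\<in>\<Y>. x \<notin> X}. k)"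
      using fin by (subst sum.If_cases) (auto simp: Int_def intro!: arg_cong2[where f="(+)"] sum.cong)
    then show ?thesis using c by (simp add: k_def)
  qed
  moreover have "k * (8 - k) + (8 - k) * k \<le> 32"
  proof -
    have "k \<in> {0,1,2,3,4,5,6,7,8}" using k8 by auto
    then show ?thesis by auto
  qed
  ultimately show ?thesis using 1 by simp
qed

text \<open>If a family had more members, the pigeonhole principle would give eight of them agreeing on a set of \<open>s\<close> points. Their pairwise differences live on the remaining at most 27 points, and averaging the 56 ordered distances over these points (each point contributes at most 32) contradicts the distance 16.\<close>
lemma plotkin_bound:
  assumes finM: "finite M" and XM: "\<X> \<subseteq> Pow M"
    and dist: "\<And>X Y. X \<in> \<X> \<Longrightarrow> Y \<in> \<X> \<Longrightarrow> X \<noteq> Y \<Longrightarrow> 16 \<le> card (X \<triangle> Y)"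
    and s: "card M \<le> s + 27" "s \<le> card M"
  shows "card \<X> \<le> 7 * 2 ^ s"
proof (rule ccontr)
  assume neg: "\<not> card \<X> \<le> 7 * 2 ^ s"
  obtain S where S: "S \<subseteq> M" "card S = s" by (rule obtain_subset_with_card_n[OF s(2)])
  have finS: "finite S" using S finM finite_subset by blast
  have finX: "finite \<X>" using XM finM finite_subset by blast
  have "\<exists>Z\<in>Pow S. 8 \<le> card {X \<in> \<X>. X \<inter> S = Z}"
  proof (rule ccontr)
    assume "\<not> ?thesis"
    then have big: "\<not> 8 \<le> card {X \<in> \<X>. X \<inter> S = Z}" if "Z \<in> Pow S" for Z using that by blast
    have small: "card {X \<in> \<X>. X \<inter> S = Z} \<le> 7" if "Z \<in> Pow S" for Z
    proof -
      have "\<not> 8 \<le> n \<Longrightarrow> n \<le> 7" for n :: nat by linarith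
      then show ?thesis using big that by blast
    qed
    have "card \<X> = (\<Sum>X\<in>\<X>. 1)" by simp
    also have "\<dots> = (\<Sum>Z\<in>Pow S. \<Sum>X\<in>{X \<in> \<X>. X \<inter> S = Z}. 1)"
      by (rule sum.group[symmetric]) (use finX finS in auto)
    also have "\<dots> \<le> (\<Sum>Z\<in>Pow S. 7)" by (rule sum_mono) (use small in simp)
    finally have "card \<X> \<le> (\<Sum>Z\<in>Pow S. 7)" .
    then show False using neg S(2) finS by (simp add: card_Pow mult.commute)
  qed
  then obtain Z where Z: "8 \<le> card {X \<in> \<X>. X \<inter> S = Z}" by (rule bexE)
  obtain \<Y> where Y: "\<Y> \<subseteq> {X \<in> \<X>. X \<inter> S = Z}" "card \<Y> = 8"
    by (rule obtain_subset_with_card_n[OF Z])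
  have finY: "finite \<Y>" using Y(2) card.infinite[of \<Y>] by fastforce
  have cd: "card (X \<triangle> Y) = (\<Sum>x\<in>M - S. if x \<in> X \<triangle> Y then 1 else 0)" if XY: "X \<in> \<Y>" "Y \<in> \<Y>" for X Y
  proof -
    have "X \<in> \<X>" "Y \<in> \<X>" and eq: "X \<inter> S = Y \<inter> S" using XY Y(1) by auto
    then have sub: "X \<subseteq> M" "Y \<subseteq> M" using XM by auto
    have "X \<triangle> Y = (M - S) \<inter> {x. x \<in> X \<triangle> Y}"
    proof (rule set_eqI)
      fix x
      have "x \<in> X \<and> x \<in> S \<longleftrightarrow> x \<in> Y \<and> x \<in> S" using eq by (metis IntD1 IntD2 IntI)
      then show "x \<in> X \<triangle> Y \<longleftrightarrow> x \<in> (M - S) \<inter> {x. x \<in> X \<triangle> Y}" using sub by auto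
    qed
    then have "card (X \<triangle> Y) = (\<Sum>x\<in>(M - S) \<inter> {x. x \<in> X \<triangle> Y}. 1)" by (simp del: in_sdiff)
    also have "\<dots> = (\<Sum>x\<in>M - S. if x \<in> {x. x \<in> X \<triangle> Y} then 1 else 0)"
      using finM by (intro sum.inter_restrict) auto
    finally show ?thesis by (simp only: mem_Collect_eq)
  qed
  have "(\<Sum>X\<in>\<Y>. \<Sum>Y\<in>\<Y>. card (X \<triangle> Y)) = (\<Sum>X\<in>\<Y>. \<Sum>Y\<in>\<Y>. \<Sum>x\<in>M - S. if x \<in> X \<triangle> Y then 1 else 0)"
    using cd by (intro sum.cong) auto
  also have "\<dots> = (\<Sum>X\<in>\<Y>. \<Sum>x\<in>M - S. \<Sum>Y\<in>\<Y>. if x \<in> X \<triangle> Y then 1 else 0)"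
    by (intro sum.cong refl sum.swap)
  also have "\<dots> = (\<Sum>x\<in>M - S. \<Sum>X\<in>\<Y>. \<Sum>Y\<in>\<Y>. if x \<in> X \<triangle> Y then 1 else 0)"
    by (rule sum.swap)
  also have "\<dots> \<le> (\<Sum>x\<in>M - S. 32)"
    using double_count_le[OF Y(2)] by (intro sum_mono) blast
  also have "\<dots> \<le> 27 * 32" using S s finM finS by (simp add: card_Diff_subset)
  finally have le: "(\<Sum>X\<in>\<Y>. \<Sum>Y\<in>\<Y>. card (X \<triangle> Y)) \<le> 864" by simp
  have "(\<Sum>X\<in>\<Y>. 7 * 16) \<le> (\<Sum>X\<in>\<Y>. \<Sum>Y\<in>\<Y>. card (X \<triangle> Y))"
  proof (rule sum_mono)
    fix X assume X: "X \<in> \<Y>"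
    have "7 * 16 = (\<Sum>Y\<in>\<Y> - {X}. 16::nat)" using Y(2) X finY by simp
    also have "\<dots> \<le> (\<Sum>Y\<in>\<Y> - {X}. card (X \<triangle> Y))"
      using X Y(1) by (intro sum_mono dist) auto
    also have "\<dots> \<le> (\<Sum>Y\<in>\<Y>. card (X \<triangle> Y))" using finY by (intro sum_mono2) auto
    finally show "7 * 16 \<le> (\<Sum>Y\<in>\<Y>. card (X \<triangle> Y))" .
  qed
  then show False using le Y(2) by simp
qed

lemma funpow5: "(h ^^ 5) x = h (h (h (h (h x))))" for h :: "'a \<Rightarrow> 'a"
  by (simp add: numeral_eq_Suc)

text \<open>Choosing one point from each orbit of a permutation of order 5 detects invariant sets: since orbits have odd length 1 or 5, the parity of an invariant set is the parity of its intersection with the transversal.\<close>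
lemma transversal:
  assumes "finite X" and "\<And>x. x \<in> X \<Longrightarrow> h x \<in> X" and "\<And>x. x \<in> X \<Longrightarrow> (h ^^ 5) x = x"
  shows "\<exists>R\<subseteq>X. 5 * card R = card X + 4 * card {x\<in>X. h x = x} \<and>
    (\<forall>Y\<subseteq>X. h ` Y \<subseteq> Y \<longrightarrow> even (card Y) = even (card (Y \<inter> R)) \<and> (Y \<inter> R = {} \<longrightarrow> Y = {}))"
  using assms
proof (induction X rule: finite_psubset_induct)
  case (psubset X)
  note hX = psubset.prems(1) and h5 = psubset.prems(2)[unfolded funpow5]
  show ?case
  proof (cases "\<forall>x\<in>X. h x = x")
    case True
    then have e: "{x\<in>X. h x = x} = X" by auto
    show ?thesis by (rule exI[of _ X]) (auto simp: e Int_absorb1 Int_absorb2)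
  next
    case False
    then obtain x where x: "x \<in> X" "h x \<noteq> x" by auto
    define O5 where "O5 = {x, h x, h (h x), h (h (h x)), h (h (h (h x)))}"
    have in5: "h x \<in> X" "h (h x) \<in> X" "h (h (h x)) \<in> X" "h (h (h (h x))) \<in> X" using x hX by auto
    have O5X: "O5 \<subseteq> X" using x in5 by (auto simp: O5_def)
    have c5: "h (h (h (h (h x)))) = x" using h5 x by auto
    have bk: "x \<in> {y, h y, h (h y), h (h (h y)), h (h (h (h y)))}" if "y \<in> O5" for y
      using that c5 unfolding O5_def by auto
    have n1: "h y \<noteq> y" if "y \<in> O5" for y
    proof
      assume "h y = y"
      then have "x = y" using bk[OF that] by simp
      then show False using x \<open>h y = y\<close> by simp
    qed
    have n2: "h (h y) \<noteq> y" if "y \<in> O5" for y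
    proof
      assume e: "h (h y) = y"
      have "h (h (h (h (h y)))) = y" using h5 that O5X by blast
      then have "h y = y" using e by simp
      then show False using n1[OF that] by simp
    qed
    have n3: "h (h (h y)) \<noteq> y" if "y \<in> O5" for y
    proof
      assume e: "h (h (h y)) = y"
      have "h (h (h (h (h y)))) = y" using h5 that O5X by blast
      then have "h (h y) = y" using e by simp
      then show False using n2[OF that] by simp
    qed
    have n4: "h (h (h (h y))) \<noteq> y" if "y \<in> O5" for y
    proof
      assume e: "h (h (h (h y))) = y"
      have "h (h (h (h (h y)))) = y" using h5 that O5X by blast
      then have "h y = y" using e by simp
      then show False using n1[OF that] by simp
    qed
    have mem: "x \<in> O5" "h x \<in> O5" "h (h x) \<in> O5" "h (h (h x)) \<in> O5" "h (h (h (h x))) \<in> O5"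
      by (auto simp: O5_def)
    have "distinct [x, h x, h (h x), h (h (h x)), h (h (h (h x)))]"
      using n1[OF mem(1)] n2[OF mem(1)] n3[OF mem(1)] n4[OF mem(1)]
        n1[OF mem(2)] n2[OF mem(2)] n3[OF mem(2)] n1[OF mem(3)] n2[OF mem(3)] n1[OF mem(4)]
      by (auto simp del: funpow_simps_right dest: sym)
    from distinct_card[OF this] have cardO: "card O5 = 5" unfolding O5_def by simp
    have hO: "h y \<in> O5" if "y \<in> O5" for y using that c5 by (auto simp: O5_def)
    have hO': "y \<in> O5" if "h y \<in> O5" "y \<in> X" for y
      using hO[OF hO[OF hO[OF hO[OF that(1)]]]] h5[OF that(2)] by simp
    have ps: "X - O5 \<subset> X" using x mem by auto
    have clos: "\<And>y. y \<in> X - O5 \<Longrightarrow> h y \<in> X - O5" using hX hO' by auto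
    have "\<exists>R\<subseteq>X - O5. 5 * card R = card (X - O5) + 4 * card {x\<in>X - O5. h x = x} \<and>
      (\<forall>Y\<subseteq>X - O5. h ` Y \<subseteq> Y \<longrightarrow> even (card Y) = even (card (Y \<inter> R)) \<and> (Y \<inter> R = {} \<longrightarrow> Y = {}))"
      using clos psubset.prems(2) by (intro psubset.IH[OF ps]) auto
    then obtain R where R: "R \<subseteq> X - O5" "5 * card R = card (X - O5) + 4 * card {x\<in>X - O5. h x = x}"
      "\<And>Y. Y \<subseteq> X - O5 \<Longrightarrow> h ` Y \<subseteq> Y \<Longrightarrow> even (card Y) = even (card (Y \<inter> R)) \<and> (Y \<inter> R = {} \<longrightarrow> Y = {})"
      by blast
    have finR: "finite R" using R(1) psubset.hyps finite_subset by blast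
    have fx: "{y\<in>X - O5. h y = y} = {y\<in>X. h y = y}" using n1 by auto
    have xR: "x \<notin> R" using R(1) mem by auto
    have cX: "card X = card (X - O5) + 5"
      using cardO O5X psubset.hyps by (metis card_Diff_subset card_mono finite_subset le_add_diff_inverse2)
    have main: "even (card Y) = even (card (Y \<inter> insert x R)) \<and> (Y \<inter> insert x R = {} \<longrightarrow> Y = {})"
      if Y: "Y \<subseteq> X" "h ` Y \<subseteq> Y" for Y
    proof -
      have finY: "finite Y" using Y psubset.hyps finite_subset by blast
      have inv: "h ` (Y - O5) \<subseteq> Y - O5" using Y hO' by blast
      have IH: "even (card (Y - O5)) = even (card ((Y - O5) \<inter> R)) \<and> ((Y - O5) \<inter> R = {} \<longrightarrow> Y - O5 = {})"
        using R(3)[of "Y - O5"] inv Y by blast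
      have YR: "(Y - O5) \<inter> R = Y \<inter> R" using R(1) by auto
      show ?thesis
      proof (cases "x \<in> Y")
        case True
        then have "O5 \<subseteq> Y" using Y(2) by (auto simp: O5_def)
        then have "card Y = card (Y - O5) + 5"
          using cardO finY by (metis card_Diff_subset card_mono finite_subset le_add_diff_inverse2)
        moreover have "card (Y \<inter> insert x R) = Suc (card (Y \<inter> R))" using True xR finR by simp
        ultimately show ?thesis using IH YR True by simp
      next
        case False
        have step: "y \<notin> Y" if "y \<in> O5" for y
        proof
          assume y: "y \<in> Y"
          have im: "h z \<in> Y" if "z \<in> Y" for z using that Y(2) by auto
          have "h y \<in> Y" "h (h y) \<in> Y" "h (h (h y)) \<in> Y" "h (h (h (h y))) \<in> Y" using y im by auto
          then show False using bk[OF that] y False by blast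
        qed
        then have "Y - O5 = Y" by auto
        then show ?thesis using IH YR False by simp
      qed
    qed
    show ?thesis
      using R(1,2) main x(1) xR finR cX fx by (intro exI[of _ "insert x R"]) auto
  qed
qed

lemma fixed_points_mod5:
  assumes "finite X" and "\<And>x. x \<in> X \<Longrightarrow> h x \<in> X" and "\<And>x. x \<in> X \<Longrightarrow> (h ^^ 5) x = x"
  shows "card X mod 5 = card {x\<in>X. h x = x} mod 5"
proof -
  have "\<exists>R\<subseteq>X. 5 * card R = card X + 4 * card {x\<in>X. h x = x} \<and>
    (\<forall>Y\<subseteq>X. h ` Y \<subseteq> Y \<longrightarrow> even (card Y) = even (card (Y \<inter> R)) \<and> (Y \<inter> R = {} \<longrightarrow> Y = {}))"
    by (rule transversal) (use assms in auto)
  then have "\<exists>R :: 'a set. 5 * card R = card X + 4 * card {x\<in>X. h x = x}"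
    by (elim exE) (intro exI, elim conjE, assumption)
  then obtain R :: "'a set" where R: "5 * card R = card X + 4 * card {x\<in>X. h x = x}" by (elim exE)
  have "a mod 5 = b mod 5" if "5 * r = a + 4 * b" for r a b :: nat
  proof -
    have "a + 5 * b = b + 5 * r" using that by simp
    then have "(a + 5 * b) mod 5 = (b + 5 * r) mod 5" by (rule arg_cong)
    then show ?thesis by simp
  qed
  from this[OF R] show ?thesis .
qed

section \<open>Automorphisms of order 5\<close>

text \<open>The part of being an extremal doubly-even self-dual code of length 80 that the symmetry arguments use.\<close>
definition is_code :: "'a set set \<Rightarrow> bool" where
  "is_code \<C> \<longleftrightarrow> linear \<C> \<and> card \<C> = 2 ^ 40 \<and> (\<forall>X\<in>\<C>. \<forall>Y\<in>\<C>. even (card (X \<inter> Y))) \<and>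
     (\<forall>X\<in>\<C>. X \<noteq> {} \<longrightarrow> 16 \<le> card X)"

definition Aut :: "'a set set \<Rightarrow> ('a \<Rightarrow> 'a) set" where
  "Aut \<C> = {g. bij g \<and> (`) g ` \<C> = \<C>}"

lemma Aut_image: "g \<in> Aut \<C> \<Longrightarrow> X \<in> \<C> \<Longrightarrow> g ` X \<in> \<C>"
  unfolding Aut_def by blast

lemma Aut_comp: "g \<in> Aut \<C> \<Longrightarrow> h \<in> Aut \<C> \<Longrightarrow> g \<circ> h \<in> Aut \<C>"
  unfolding Aut_def by (auto simp: bij_comp image_comp[symmetric] image_image[symmetric])

lemma Aut_id: "id \<in> Aut \<C>" by (simp add: Aut_def)

lemma Aut_inv:
  assumes "g \<in> Aut \<C>" shows "inv g \<in> Aut \<C>"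
proof -
  have g: "bij g" "(`) g ` \<C> = \<C>" using assms by (auto simp: Aut_def)
  have "(`) (inv g) ` ((`) g ` \<C>) = \<C>"
    using g(1) by (simp add: image_image image_inv_f_f bij_is_inj)
  then show ?thesis using g by (simp add: Aut_def bij_imp_bij_inv)
qed

lemma Aut_funpow: "g \<in> Aut \<C> \<Longrightarrow> g ^^ n \<in> Aut \<C>"
  by (induction n) (auto simp: Aut_id Aut_comp id_def[symmetric])

lemma inter_image_inj: "inj g \<Longrightarrow> g ` X = X \<Longrightarrow> g ` Y = Y \<Longrightarrow> g ` (X \<inter> Y) = X \<inter> Y"
  by (simp add: image_Int)

context
  fixes \<C> :: "'a::finite set set" and y :: "'a \<Rightarrow> 'a" and c :: nat
  assumes code: "is_code \<C>" and size: "CARD('a) = 80"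
    and aut: "y \<in> Aut \<C>" and y5: "\<And>x. (y ^^ 5) x = x"
    and c: "card {x. y x = x} + 5 * c = 80"
begin

lemma lin: "linear \<C>" and card_code: "card \<C> = 2 ^ 40"
  and orthC: "X \<in> \<C> \<Longrightarrow> Y \<in> \<C> \<Longrightarrow> even (card (X \<inter> Y))"
  and minC: "X \<in> \<C> \<Longrightarrow> X \<noteq> {} \<Longrightarrow> 16 \<le> card X"
  using code by (auto simp: is_code_def)

lemma inj_y: "inj y" using aut by (auto simp: Aut_def bij_is_inj)

lemma card_moved: "card {x. y x \<noteq> x} = 5 * c"
proof -
  have "{x. y x \<noteq> x} = UNIV - {x. y x = x}" by auto
  then have "card {x. y x \<noteq> x} = CARD('a) - card {x. y x = x}" by (simp add: card_Diff_subset)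
  then show ?thesis using size c by simp
qed

text \<open>Words fixed by the automorphism are determined by their restriction to a transversal of the orbits, and these restrictions are pairwise orthogonal; so there are at most as many as in a self-orthogonal code on the transversal.\<close>
lemma card_fixed_words: "card {X \<in> \<C>. y ` X = X} \<le> 2 ^ (40 - 2 * c)"
proof -
  have "\<exists>R\<subseteq>UNIV. 5 * card R = card (UNIV::'a set) + 4 * card {x\<in>UNIV. y x = x} \<and>
    (\<forall>Y\<subseteq>UNIV. y ` Y \<subseteq> Y \<longrightarrow> even (card Y) = even (card (Y \<inter> R)) \<and> (Y \<inter> R = {} \<longrightarrow> Y = {}))"
    by (rule transversal) (use y5 in auto)
  then obtain R where R: "5 * card R = card (UNIV::'a set) + 4 * card {x. y x = x}"
    and RY: "\<And>Y. y ` Y \<subseteq> Y \<Longrightarrow> even (card Y) = even (card (Y \<inter> R)) \<and> (Y \<inter> R = {} \<longrightarrow> Y = {})"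
    by auto
  have cR: "card R = 80 - 4 * c" using R size c by linarith
  let ?F = "{X \<in> \<C>. y ` X = X}"
  have linF: "linear ?F"
    using lin by (auto simp: linear_def image_sdiff[OF inj_y])
  let ?A = "(\<lambda>X. X \<inter> R) ` ?F"
  have linA: "linear ?A"
    unfolding linear_def
  proof (intro conjI ballI)
    show "{} \<in> ?A" using linear_empty[OF linF] by (intro image_eqI[of _ _ "{}"]) auto
  next
    fix X Y assume "X \<in> ?A" "Y \<in> ?A"
    then obtain X' Y' where XY: "X' \<in> ?F" "Y' \<in> ?F" "X = X' \<inter> R" "Y = Y' \<inter> R" by blast
    then show "X \<triangle> Y \<in> ?A"
      using linear_sdiff[OF linF, of X' Y'] by (intro image_eqI[of _ _ "X' \<triangle> Y'"]) (auto simp: sdiff_Int)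
  qed
  have sub: "?A \<subseteq> Pow R" by blast
  have "card ?A * card ?A \<le> 2 ^ card R"
  proof (rule card_orthogonal_le[OF finite linA sub sub])
    fix A B assume "A \<in> ?A" "B \<in> ?A"
    then obtain X Y where XY: "X \<in> ?F" "Y \<in> ?F" "A = X \<inter> R" "B = Y \<inter> R" by blast
    have "y ` (X \<inter> Y) = X \<inter> Y" using XY by (intro inter_image_inj[OF inj_y]) auto
    then have "even (card (X \<inter> Y)) = even (card ((X \<inter> Y) \<inter> R))" using RY[of "X \<inter> Y"] by simp
    moreover have "A \<inter> B = (X \<inter> Y) \<inter> R" using XY(3,4) by blast
    moreover have "X \<in> \<C>" "Y \<in> \<C>" using XY(1,2) by blast+
    then have "even (card (X \<inter> Y))" by (rule orthC)
    ultimately show "even (card (A \<inter> B))" by simp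
  qed
  moreover have "inj_on (\<lambda>X. X \<inter> R) ?F"
  proof (rule inj_onI)
    fix X Y assume XY: "X \<in> ?F" "Y \<in> ?F" "X \<inter> R = Y \<inter> R"
    have "X \<triangle> Y \<in> ?F" by (rule linear_sdiff[OF linF XY(1,2)])
    then have "y ` (X \<triangle> Y) = X \<triangle> Y" by blast
    moreover have "(X \<triangle> Y) \<inter> R = {}" unfolding sdiff_Int XY(3) by simp
    ultimately have "X \<triangle> Y = {}" using RY[of "X \<triangle> Y"] by simp
    then show "X = Y" by (simp add: sdiff_eq_empty)
  qed
  then have "card ?A = card ?F" by (rule card_image)
  ultimately have "card ?F * card ?F \<le> 2 ^ (80 - 4 * c)" using cR by simp
  also have "\<dots> = (2 ^ (40 - 2 * c)) ^ 2" using c by (simp add: power_mult[symmetric] diff_mult_distrib2 mult.commute)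
  finally have "(card ?F) ^ 2 \<le> (2 ^ (40 - 2 * c)) ^ 2" by (simp add: power2_eq_square)
  then show ?thesis by (rule power2_le_imp_le) simp
qed

lemma card_moved_words: "2 ^ (2 * c) \<le> card {X \<in> \<C>. X \<subseteq> {x. y x \<noteq> x}}"
proof -
  let ?f = "\<lambda>X. X \<triangle> y ` X" and ?D = "{X \<in> \<C>. X \<subseteq> {x. y x \<noteq> x}}"
  have prod: "card \<C> = card (?f ` \<C>) * card {X \<in> \<C>. ?f X = {}}"
  proof (rule card_kernel_image[OF _ lin])
    show "finite \<C>" by simp
    show "(X \<triangle> Y) \<triangle> y ` (X \<triangle> Y) = (X \<triangle> y ` X) \<triangle> (Y \<triangle> y ` Y)" for X Y
      unfolding image_sdiff[OF inj_y] by auto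
  qed
  have "{X \<in> \<C>. ?f X = {}} = {X \<in> \<C>. y ` X = X}" by (auto simp: sdiff_eq_empty)
  then have ker: "card {X \<in> \<C>. ?f X = {}} \<le> 2 ^ (40 - 2 * c)" using card_fixed_words by simp
  have im: "card (?f ` \<C>) \<le> card ?D"
  proof (rule card_mono)
    show "?f ` \<C> \<subseteq> ?D"
    proof clarify
      fix X assume X: "X \<in> \<C>"
      have "X \<triangle> y ` X \<in> \<C>" using X Aut_image[OF aut X] linear_sdiff[OF lin] by blast
      moreover have "X \<triangle> y ` X \<subseteq> {x. y x \<noteq> x}"
      proof
        fix x assume "x \<in> X \<triangle> y ` X"
        then show "x \<in> {x. y x \<noteq> x}" using inj_image_mem_iff[OF inj_y, of x X] by auto
      qed
      ultimately show "X \<triangle> y ` X \<in> \<C> \<and> X \<triangle> y ` X \<subseteq> {x. y x \<noteq> x}" by blast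
    qed
  qed simp
  have "2 ^ 40 \<le> card ?D * 2 ^ (40 - 2 * c)"
    using mult_le_mono[OF im ker] unfolding prod[symmetric] card_code .
  moreover have "(2::nat) ^ 40 = 2 ^ (2 * c) * 2 ^ (40 - 2 * c)"
    using c by (subst power_add[symmetric]) simp
  ultimately have "2 ^ (2 * c) * 2 ^ (40 - 2 * c) \<le> card ?D * (2::nat) ^ (40 - 2 * c)" by simp
  then show ?thesis by (subst (asm) mult_le_cancel2) simp
qed

lemma card_fixed_support_words: "2 ^ (40 - 3 * c) \<le> card {X \<in> \<C>. X \<subseteq> {x. y x = x}}"
proof -
  let ?M = "{x. y x \<noteq> x}"
  let ?K = "{X \<in> \<C>. X \<subseteq> {x. y x = x}}" and ?D = "{X \<in> \<C>. X \<subseteq> ?M}"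
  have cM: "card ?M = 5 * c" by (rule card_moved)
  have prod: "card \<C> = card ((\<lambda>X. X \<inter> ?M) ` \<C>) * card {X \<in> \<C>. X \<inter> ?M = {}}"
    by (rule card_kernel_image[OF _ lin]) (auto simp: sdiff_Int)
  have ker: "{X \<in> \<C>. X \<inter> ?M = {}} = ?K" by auto
  have linD: "linear ?D" using lin by (auto simp: linear_def)
  have subD: "?D \<subseteq> Pow ?M" and subM: "(\<lambda>X. X \<inter> ?M) ` \<C> \<subseteq> Pow ?M" by blast+
  have "card ?D * card ((\<lambda>X. X \<inter> ?M) ` \<C>) \<le> 2 ^ (5 * c)"
    unfolding cM[symmetric]
  proof (rule card_orthogonal_le[OF finite linD subD subM])
    fix A B assume "A \<in> ?D" "B \<in> (\<lambda>X. X \<inter> ?M) ` \<C>"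
    then obtain X where "X \<in> \<C>" "B = X \<inter> ?M" "A \<in> \<C>" "A \<subseteq> ?M" by blast
    moreover from this have "A \<inter> B = A \<inter> X" by blast
    ultimately show "even (card (A \<inter> B))" using orthC by metis
  qed
  then have "2 ^ (2 * c) * card ((\<lambda>X. X \<inter> ?M) ` \<C>) \<le> 2 ^ (5 * c)"
    using card_moved_words by (meson le_trans mult_le_mono1)
  also have "(2::nat) ^ (5 * c) = 2 ^ (2 * c) * 2 ^ (3 * c)" by (simp add: power_add[symmetric])
  finally have "card ((\<lambda>X. X \<inter> ?M) ` \<C>) \<le> 2 ^ (3 * c)" by (subst (asm) mult_le_cancel1) simp
  then have "card ((\<lambda>X. X \<inter> ?M) ` \<C>) * card ?K \<le> 2 ^ (3 * c) * card ?K" by (rule mult_le_mono1)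
  moreover have "2 ^ 40 = card ((\<lambda>X. X \<inter> ?M) ` \<C>) * card ?K"
    using prod unfolding ker card_code .
  ultimately have le40: "2 ^ 40 \<le> 2 ^ (3 * c) * card ?K" by (simp only:)
  show ?thesis
  proof (cases "3 * c \<le> 40")
    case True
    then have "(2::nat) ^ 40 = 2 ^ (3 * c) * 2 ^ (40 - 3 * c)" by (subst power_add[symmetric]) simp
    then have "2 ^ (3 * c) * 2 ^ (40 - 3 * c) \<le> 2 ^ (3 * c) * card ?K" using le40 by simp
    then show ?thesis by (subst (asm) mult_le_cancel1) simp
  next
    case False
    have "{} \<in> ?K" using linear_empty[OF lin] by simp
    then have "0 < card ?K" by (subst card_gt_0_iff) auto
    moreover have "40 - 3 * c = 0" using False by simp
    ultimately show ?thesis by (simp only: power_0 One_nat_def Suc_le_eq)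
  qed
qed

text \<open>A code of minimum distance 16 supported on few points is small, by the Plotkin-type bound.\<close>
lemma few_words:
  assumes "card M \<le> s + 27" "s \<le> card M"
  shows "card {X \<in> \<C>. X \<subseteq> M} \<le> 7 * 2 ^ s"
proof (rule plotkin_bound[OF _ _ _ assms])
  fix X Y assume "X \<in> {X \<in> \<C>. X \<subseteq> M}" "Y \<in> {X \<in> \<C>. X \<subseteq> M}" "X \<noteq> Y"
  then show "16 \<le> card (X \<triangle> Y)" using lin by (intro minC) (auto simp: linear_sdiff sdiff_eq_empty)
qed auto

lemma no_short_cycle_type:
  assumes "c \<noteq> 0" "c \<le> 12" shows False
proof -
  let ?M = "{x. y x \<noteq> x}" and ?N = "{x. y x = x}"
  have N: "card ?N = 80 - 5 * c" using c by simp
  have M: "card ?M = 5 * c" by (rule card_moved)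
  have DM: "7 * 2 ^ s < (2::nat) ^ (2 * c) \<Longrightarrow> card ?M \<le> s + 27 \<Longrightarrow> s \<le> card ?M \<Longrightarrow> False" for s
    using few_words[of ?M s] card_moved_words by (meson leD le_trans)
  have DN: "7 * 2 ^ s < (2::nat) ^ (40 - 3 * c) \<Longrightarrow> card ?N \<le> s + 27 \<Longrightarrow> s \<le> card ?N \<Longrightarrow> False" for s
    using few_words[of ?N s] card_fixed_support_words by (meson leD le_trans)
  have "c = 1 \<or> (c = 2 \<or> c = 3 \<or> c = 4 \<or> c = 5) \<or> c = 6 \<or> c = 7 \<or> c = 8 \<or> c = 9 \<or> c = 10 \<or> (c = 11 \<or> c = 12)"
    using assms by presburger
  then consider "c = 1" | "c = 2 \<or> c = 3 \<or> c = 4 \<or> c = 5" | "c = 6" | "c = 7" | "c = 8" | "c = 9" | "c = 10" | "c = 11 \<or> c = 12"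
    by (elim disjE) simp_all
  then show False
  proof cases
    case 1
    have "4 \<le> card {X \<in> \<C>. X \<subseteq> ?M}" using card_moved_words 1 by simp
    then have "\<not> {X \<in> \<C>. X \<subseteq> ?M} \<subseteq> {{}}" using card_mono[of "{{}}" "{X \<in> \<C>. X \<subseteq> ?M}"] by auto
    then obtain X where "X \<in> \<C>" "X \<subseteq> ?M" "X \<noteq> {}" by blast
    then have "16 \<le> card X" "card X \<le> card ?M" using minC card_mono[of ?M X] by auto
    then show False using M 1 by simp
  next
    case 2 then show False using DM[of 0] M by auto
  next
    case 3 then show False using DM[of 3] M by simp
  next
    case 4 then show False using DM[of 8] M by simp
  next
    case 5 then show False using DM[of 13] M by simp
  next
    case 6 then show False using DN[of 8] N by simp
  next
    case 7 then show False using DN[of 3] N by simp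
  next
    case 8 then show False using DN[of 0] N by auto
  qed
qed

end

text \<open>If a nontrivial automorphism of order 5 had \<open>c\<close> cycles and at least 20 fixed points, then by orthogonality many codewords would be supported on its moved points, or on its fixed points. Both numbers grow with the code dimension 40 and contradict the bound for short codes of distance 16.\<close>
lemma automorphism_fixing_20:
  fixes \<C> :: "'a::finite set set"
  assumes "is_code \<C>" "CARD('a) = 80" "y \<in> Aut \<C>" "\<And>x. (y ^^ 5) x = x" and f: "20 \<le> card {x. y x = x}"
  shows "y = id"
proof -
  have "card (UNIV::'a set) mod 5 = card {x\<in>UNIV. y x = x} mod 5"
    by (rule fixed_points_mod5) (use assms(4) in auto)
  then have "card {x. y x = x} mod 5 = 0" using assms(2) by simp
  moreover have "card {x. y x = x} \<le> 80" using assms(2) card_mono[of UNIV "{x. y x = x}"] by simp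
  moreover have "n mod 5 = 0 \<Longrightarrow> n \<le> 80 \<Longrightarrow> \<exists>c. n + 5 * c = 80" for n :: nat by presburger
  ultimately have "\<exists>c. card {x. y x = x} + 5 * c = 80" by simp
  then obtain c where c: "card {x. y x = x} + 5 * c = 80" by (elim exE)
  have "c = 0"
  proof (rule ccontr)
    assume "c \<noteq> 0"
    moreover have "c \<le> 12" using c f by linarith
    ultimately show False using no_short_cycle_type[OF assms(1-4) c] by blast
  qed
  then have "card {x. y x = x} = CARD('a)" using c assms(2) by simp
  then have "{x. y x = x} = UNIV" by (metis card_subset_eq finite_UNIV subset_UNIV finite)
  then show ?thesis by (simp add: fun_eq_iff set_eq_iff)
qed

text \<open>The counting argument of Sylow theory. The group generated by \<open>\<sigma>\<close> acts by conjugation on the conjugacy class of \<open>\<tau>\<close>, and fixed points commute with \<open>\<sigma>\<close>, hence are powers of \<open>\<sigma>\<close>. Without fixed points the size of the class would be divisible by 5. For the group generated by \<open>\<tau>\<close>, however, the fixed points in the class are powers of \<open>\<tau>\<close> other than the identity, between one and four in number, so that the size is not divisible by 5.\<close>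
lemma conjugate_into_powers:
  fixes G :: "('a::finite \<Rightarrow> 'a) set"
  assumes G: "\<And>g h. g \<in> G \<Longrightarrow> h \<in> G \<Longrightarrow> g \<circ> h \<in> G" "\<And>g. g \<in> G \<Longrightarrow> inv g \<in> G" "\<And>g. g \<in> G \<Longrightarrow> bij g"
    and id: "id \<in> G"
    and \<sigma>: "\<sigma> \<in> G" "\<sigma> ^^ 5 = id" and \<tau>: "\<tau> \<in> G" "\<tau> ^^ 5 = id" "\<tau> \<noteq> id"
    and c\<sigma>: "\<And>x. x \<in> G \<Longrightarrow> x ^^ 5 = id \<Longrightarrow> x \<circ> \<sigma> = \<sigma> \<circ> x \<Longrightarrow> \<exists>k<5. x = \<sigma> ^^ k"
    and c\<tau>: "\<And>x. x \<in> G \<Longrightarrow> x ^^ 5 = id \<Longrightarrow> x \<circ> \<tau> = \<tau> \<circ> x \<Longrightarrow> \<exists>k<5. x = \<tau> ^^ k"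
  shows "\<exists>g\<in>G. \<exists>k. g \<circ> \<tau> \<circ> inv g = \<sigma> ^^ k"
proof -
  define K where "K = {g \<circ> \<tau> \<circ> inv g | g. g \<in> G}"
  have conj_pow: "(g \<circ> x \<circ> inv g) ^^ n = g \<circ> x ^^ n \<circ> inv g" if "bij g" for g x :: "'a \<Rightarrow> 'a" and n
    using that by (induction n) (auto simp: fun_eq_iff bij_is_surj surj_f_inv_f bij_is_inj)
  have KG: "x \<in> G" "x ^^ 5 = id" "x \<noteq> id" if x: "x \<in> K" for x
  proof -
    obtain g where g: "g \<in> G" "x = g \<circ> \<tau> \<circ> inv g" using x by (auto simp: K_def)
    show "x \<in> G" using g G \<tau> by auto
    have b: "bij g" using g G by auto
    show "x ^^ 5 = id" unfolding g(2) conj_pow[OF b] \<tau>(2) using b by (simp add: fun_eq_iff bij_is_surj surj_f_inv_f)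
    show "x \<noteq> id"
    proof
      assume "x = id"
      then have "inv g \<circ> x \<circ> g = id" using b by (simp add: bij_is_inj)
      moreover have "inv g \<circ> x \<circ> g = \<tau>" using b g(2) by (auto simp: fun_eq_iff bij_is_inj)
      ultimately show False using \<tau>(3) by simp
    qed
  qed
  have count: "card K mod 5 = card {x\<in>K. x \<circ> \<rho> = \<rho> \<circ> x} mod 5" if \<rho>: "\<rho> \<in> G" "\<rho> ^^ 5 = id" for \<rho>
  proof -
    have b: "bij \<rho>" using \<rho> G by auto
    let ?h = "\<lambda>x. \<rho> \<circ> x \<circ> inv \<rho>"
    have "card K mod 5 = card {x\<in>K. ?h x = x} mod 5"
    proof (rule fixed_points_mod5)
      show "finite K" by simp
      fix x assume "x \<in> K"
      then obtain g where g: "g \<in> G" "x = g \<circ> \<tau> \<circ> inv g" by (auto simp: K_def)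
      have "inv (\<rho> \<circ> g) = inv g \<circ> inv \<rho>" using b G(3)[OF g(1)] by (simp add: o_inv_distrib)
      then have "?h x = (\<rho> \<circ> g) \<circ> \<tau> \<circ> inv (\<rho> \<circ> g)" using g by (simp add: o_assoc)
      then show "?h x \<in> K" using g \<rho> G(1) by (auto simp: K_def)
      have "(?h ^^ n) x = \<rho> ^^ n \<circ> x \<circ> inv \<rho> ^^ n" for n
        by (induction n) (auto simp: fun_eq_iff funpow_swap1)
      then have "(?h ^^ 5) x = \<rho> ^^ 5 \<circ> x \<circ> inv \<rho> ^^ 5" by blast
      moreover have "inv \<rho> ^^ 5 = id" using \<rho>(2) inv_fn[OF b, of 5] by simp
      ultimately show "(?h ^^ 5) x = x" using \<rho>(2) by simp
    qed
    moreover have "(?h x = x) = (x \<circ> \<rho> = \<rho> \<circ> x)" for x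
    proof
      assume "?h x = x"
      then have "?h x \<circ> \<rho> = x \<circ> \<rho>" by simp
      then show "x \<circ> \<rho> = \<rho> \<circ> x" using b by (simp add: o_assoc[symmetric] bij_is_inj)
    next
      assume "x \<circ> \<rho> = \<rho> \<circ> x"
      then have "?h x = x \<circ> \<rho> \<circ> inv \<rho>" by simp
      then show "?h x = x" using b by (simp add: o_assoc[symmetric] surj_iff[THEN iffD1, OF bij_is_surj])
    qed
    ultimately show ?thesis by simp
  qed
  have "card {x\<in>K. x \<circ> \<tau> = \<tau> \<circ> x} \<le> 4 \<and> card {x\<in>K. x \<circ> \<tau> = \<tau> \<circ> x} \<noteq> 0"
  proof
    have "{x\<in>K. x \<circ> \<tau> = \<tau> \<circ> x} \<subseteq> (\<lambda>k. \<tau> ^^ k) ` {1,2,3,4}"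
    proof
      fix x assume x: "x \<in> {x\<in>K. x \<circ> \<tau> = \<tau> \<circ> x}"
      then obtain k where k: "k < 5" "x = \<tau> ^^ k" using c\<tau> KG by blast
      moreover have "k \<noteq> 0" using KG(3)[of x] x k by (auto simp: id_def)
      ultimately have "k = 1 \<or> k = 2 \<or> k = 3 \<or> k = 4" by linarith
      then show "x \<in> (\<lambda>k. \<tau> ^^ k) ` {1,2,3,4}" using k(2) by (intro image_eqI[of _ _ k]) auto
    qed
    then have "card {x\<in>K. x \<circ> \<tau> = \<tau> \<circ> x} \<le> card ((\<lambda>k. \<tau> ^^ k) ` {1,2,3,4::nat})" by (intro card_mono) auto
    also have "\<dots> \<le> card {1,2,3,4::nat}" by (rule card_image_le) simp
    finally show "card {x\<in>K. x \<circ> \<tau> = \<tau> \<circ> x} \<le> 4" by simp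
    have "\<tau> \<in> K" unfolding K_def using id by (intro CollectI exI[of _ id]) auto
    then show "card {x\<in>K. x \<circ> \<tau> = \<tau> \<circ> x} \<noteq> 0" by (subst card_0_eq) auto
  qed
  then have "card K mod 5 \<noteq> 0" using count[OF \<tau>(1,2)] by simp
  then have "card {x\<in>K. x \<circ> \<sigma> = \<sigma> \<circ> x} \<noteq> 0" using count[OF \<sigma>] by (metis mod_0)
  then have "{x\<in>K. x \<circ> \<sigma> = \<sigma> \<circ> x} \<noteq> {}" by (metis card.empty)
  then obtain x where x: "x \<in> K" "x \<circ> \<sigma> = \<sigma> \<circ> x" by blast
  then obtain k where "x = \<sigma> ^^ k" using c\<sigma> KG by blast
  with x(1) show ?thesis unfolding K_def by blast
qed

section \<open>Codes with an automorphism with sixteen cycles\<close>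

text \<open>The sixteen cycles are divided into two blocks of eight.\<close>
definition block :: "nat \<Rightarrow> nat set" where "block b = {8 * b..<8 * b + 8}"

locale coordinates =
  fixes pt :: "nat \<Rightarrow> nat \<Rightarrow> 'a::finite" and \<sigma> :: "'a \<Rightarrow> 'a" and \<E> :: "nat set set"
  assumes bij_pt: "bij_betw (\<lambda>(k, a). pt k a) ({..<16} \<times> {..<5}) UNIV"
    and \<sigma>_pt: "\<And>k a. k < 16 \<Longrightarrow> a < 5 \<Longrightarrow> \<sigma> (pt k a) = pt k ((a + 1) mod 5)"
    and empty_\<E>: "{} \<in> \<E>"
    and triple_\<E>: "\<And>p q r. p < 8 \<Longrightarrow> q < 8 \<Longrightarrow> r < 8 \<Longrightarrow> \<exists>T\<in>\<E>. T \<subseteq> {..<8} \<and> card T = 4 \<and> {p, q, r} \<subseteq> T"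
begin

definition cycle :: "nat \<Rightarrow> 'a set" where "cycle k = pt k ` {..<5}"
definition cycles :: "nat set \<Rightarrow> 'a set" where "cycles U = (\<Union>k\<in>U. cycle k)"

text \<open>An extremal code with the automorphism \<open>\<sigma>\<close> whose fixed words are, in terms of the cycles, the direct sum of two copies of the family \<open>\<E>\<close>, one for each block; in the application this is the extended Hamming code of length 8.\<close>
definition cyclic :: "'a set set \<Rightarrow> bool" where
  "cyclic \<C> \<longleftrightarrow> is_code \<C> \<and> \<sigma> \<in> Aut \<C> \<and>
     (\<forall>U\<subseteq>{..<16}. cycles U \<in> \<C> \<longleftrightarrow> U \<inter> {..<8} \<in> \<E> \<and> (\<lambda>k. k - 8) ` (U \<inter> {8..<16}) \<in> \<E>)"

text \<open>The unordered pair of multisets of weights on the cycles of each block. It does not change under permutations that map cycles to cycles and blocks to blocks.\<close>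
definition block_profile :: "'a set \<Rightarrow> nat multiset multiset" where
  "block_profile X = image_mset (\<lambda>b. image_mset (\<lambda>k. card (X \<inter> cycle k)) (mset_set (block b))) (mset_set {0, 1})"

lemma pt_inj: "k < 16 \<Longrightarrow> a < 5 \<Longrightarrow> l < 16 \<Longrightarrow> b < 5 \<Longrightarrow> pt k a = pt l b \<longleftrightarrow> k = l \<and> a = b"
  using bij_pt unfolding bij_betw_def inj_on_def by fastforce

lemma pt_surj: obtains k a where "x = pt k a" "k < 16" "a < 5"
proof -
  have "x \<in> (\<lambda>(k, a). pt k a) ` ({..<16} \<times> {..<5})" using bij_pt by (simp add: bij_betw_def)
  then show thesis using that by auto
qed

lemma card_type: "CARD('a) = 80"
  using bij_betw_same_card[OF bij_pt] by (simp add: card_cartesian_product)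

lemma \<sigma>_pow: "k < 16 \<Longrightarrow> a < 5 \<Longrightarrow> (\<sigma> ^^ n) (pt k a) = pt k ((a + n) mod 5)"
proof (induction n)
  case (Suc n)
  then have "(\<sigma> ^^ Suc n) (pt k a) = \<sigma> (pt k ((a + n) mod 5))" by simp
  also have "\<dots> = pt k (((a + n) mod 5 + 1) mod 5)" using Suc.prems by (intro \<sigma>_pt) auto
  finally show ?case by (simp add: mod_Suc_eq)
qed simp

lemma \<sigma>5: "\<sigma> ^^ 5 = id"
proof
  fix x obtain k a where "x = pt k a" "k < 16" "a < 5" by (rule pt_surj)
  then show "(\<sigma> ^^ 5) x = id x" by (simp add: \<sigma>_pow)
qed

lemma \<sigma>_ne_id: "\<sigma> \<noteq> id"
proof
  assume "\<sigma> = id"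
  then have "pt 0 1 = pt 0 0" using \<sigma>_pt[of 0 0] by simp
  then show False by (simp add: pt_inj)
qed

lemma card_cycle: "k < 16 \<Longrightarrow> card (cycle k) = 5"
  unfolding cycle_def by (subst card_image) (auto simp: inj_on_def pt_inj)

lemma cycle_disjoint: "k < 16 \<Longrightarrow> l < 16 \<Longrightarrow> k \<noteq> l \<Longrightarrow> cycle k \<inter> cycle l = {}"
  unfolding cycle_def by (auto simp: pt_inj)

lemma card_cycles: "U \<subseteq> {..<16} \<Longrightarrow> card (cycles U) = 5 * card U"
proof -
  assume U: "U \<subseteq> {..<16}"
  then have fin: "finite U" using finite_subset by blast
  have "card (cycles U) = (\<Sum>k\<in>U. card (cycle k))"
    unfolding cycles_def
  proof (rule card_UN_disjoint[OF fin])
    show "\<forall>i\<in>U. \<forall>j\<in>U. i \<noteq> j \<longrightarrow> cycle i \<inter> cycle j = {}"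
      using U cycle_disjoint by blast
  qed auto
  also have "\<dots> = (\<Sum>k\<in>U. 5)" using U card_cycle by (intro sum.cong) auto
  finally show ?thesis by simp
qed

lemma mem_cycles: "U \<subseteq> {..<16} \<Longrightarrow> k < 16 \<Longrightarrow> a < 5 \<Longrightarrow> pt k a \<in> cycles U \<longleftrightarrow> k \<in> U"
  unfolding cycles_def cycle_def by (fastforce simp: pt_inj)

lemma cycles_sdiff:
  assumes "U \<subseteq> {..<16}" "V \<subseteq> {..<16}" shows "cycles (U \<triangle> V) = cycles U \<triangle> cycles V"
proof (rule set_eqI)
  fix x obtain k a where x: "x = pt k a" "k < 16" "a < 5" by (rule pt_surj)
  have "U \<triangle> V \<subseteq> {..<16}" using assms by auto
  then show "x \<in> cycles (U \<triangle> V) \<longleftrightarrow> x \<in> cycles U \<triangle> cycles V"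
    using assms x by (simp add: mem_cycles)
qed

definition tetrad :: "'a set set \<Rightarrow> nat set \<Rightarrow> bool" where
  "tetrad \<C> U \<longleftrightarrow> U \<subseteq> {..<16} \<and> card U = 4 \<and> cycles U \<in> \<C>"

lemma cyclic_min: "cyclic \<C> \<Longrightarrow> U \<subseteq> {..<16} \<Longrightarrow> cycles U \<in> \<C> \<Longrightarrow> card U \<le> 3 \<Longrightarrow> U = {}"
proof (rule ccontr)
  assume h: "cyclic \<C>" "U \<subseteq> {..<16}" "cycles U \<in> \<C>" "card U \<le> 3" "U \<noteq> {}"
  have "card U \<noteq> 0" using h finite_subset[of U "{..<16}"] by auto
  then have "cycles U \<noteq> {}" using card_cycles[OF h(2)] by auto
  then have "16 \<le> card (cycles U)" using h by (auto simp: cyclic_def is_code_def)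
  then show False using card_cycles[OF h(2)] h(4) by simp
qed

text \<open>A union of four cycles that belongs to the code cannot be split between the blocks: its part in one block would itself be a codeword consisting of at most three cycles, of weight less than 16.\<close>
lemma tetrad_in_block:
  assumes "cyclic \<C>" "tetrad \<C> U" "k \<in> U" "l \<in> U" shows "k < 8 \<longleftrightarrow> l < 8"
proof (rule ccontr)
  assume ne: "\<not> ?thesis"
  have U: "U \<subseteq> {..<16}" "card U = 4" "cycles U \<in> \<C>" using assms by (auto simp: tetrad_def)
  have fin: "finite U" using U(1) finite_subset by blast
  let ?V = "U \<inter> {..<8}"
  have V: "?V \<subset> U" "?V \<noteq> {}" using ne assms(3,4) by auto
  have "?V \<subseteq> {..<16}" by auto
  moreover have "?V \<inter> {..<8} \<in> \<E>" "(\<lambda>k. k - 8) ` (?V \<inter> {8..<16}) \<in> \<E>"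
  proof -
    show "?V \<inter> {..<8} \<in> \<E>" using assms(1) U by (auto simp: cyclic_def)
    have "?V \<inter> {8..<16} = {}" by auto
    then show "(\<lambda>k. k - 8) ` (?V \<inter> {8..<16}) \<in> \<E>" using empty_\<E> by simp
  qed
  ultimately have "cycles ?V \<in> \<C>" using assms(1) unfolding cyclic_def by blast
  moreover have "card ?V < card U" using V fin by (intro psubset_card_mono) auto
  ultimately show False using cyclic_min[OF assms(1), of ?V] V U by auto
qed

lemma tetrad_exists:
  assumes "cyclic \<C>" "p < 16" "q < 16" "r < 16" "q < 8 \<longleftrightarrow> p < 8" "r < 8 \<longleftrightarrow> p < 8"
  shows "\<exists>U. tetrad \<C> U \<and> {p, q, r} \<subseteq> U"
proof (cases "p < 8")
  case True
  then obtain T where T: "T \<in> \<E>" "T \<subseteq> {..<8}" "card T = 4" "{p, q, r} \<subseteq> T" using triple_\<E>[of p q r] assms by auto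
  have e: "T \<inter> {..<8} = T" "T \<inter> {8..<16} = {}" using T(2) by auto
  have s: "T \<subseteq> {..<16}" using T(2) by auto
  then have "cycles T \<in> \<C>" using assms(1) T(1) e empty_\<E> unfolding cyclic_def by auto
  then show ?thesis using T s by (auto simp: tetrad_def)
next
  case False
  then have "p - 8 < 8" "q - 8 < 8" "r - 8 < 8" using assms by auto
  then obtain T where T: "T \<in> \<E>" "T \<subseteq> {..<8}" "card T = 4" "{p - 8, q - 8, r - 8} \<subseteq> T" using triple_\<E> by blast
  let ?U = "(\<lambda>k. k + 8) ` T"
  have e: "?U \<inter> {..<8} = {}" "?U \<inter> {8..<16} = ?U" using T(2) by auto
  have s: "?U \<subseteq> {..<16}" using T(2) by auto
  have i: "(\<lambda>k. k - 8) ` ?U = T" by (simp add: image_image)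
  have "cycles ?U \<in> \<C>" using assms(1) T(1) e i s empty_\<E> unfolding cyclic_def by auto
  moreover have "card ?U = 4" using T(3) by (subst card_image) auto
  moreover have "{p, q, r} \<subseteq> ?U"
  proof -
    have "p = p - 8 + 8" "q = q - 8 + 8" "r = r - 8 + 8" using False assms by auto
    then show ?thesis using T(4) by (metis empty_subsetI imageI insert_subset)
  qed
  ultimately show ?thesis using s by (auto simp: tetrad_def)
qed

text \<open>A permutation normalising the group generated by \<open>\<sigma>\<close> permutes the orbits of \<open>\<sigma>\<close>.\<close>
lemma induced_cycle_map:
  assumes x: "inj x" and comm: "x \<circ> \<sigma> = \<sigma> ^^ j \<circ> x"
  shows "\<exists>y. (\<forall>k<16. y k < 16) \<and> inj_on y {..<16} \<and> (\<forall>k<16. x ` cycle k = cycle (y k))"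
proof -
  have "\<exists>l<16. x ` cycle k = cycle l" if k: "k < 16" for k
  proof -
    obtain l b where l: "x (pt k 0) = pt l b" "l < 16" "b < 5" by (rule pt_surj)
    have pow: "x ((\<sigma> ^^ n) u) = (\<sigma> ^^ (j * n)) (x u)" for n u
    proof (induction n)
      case (Suc n)
      have "x ((\<sigma> ^^ Suc n) u) = (\<sigma> ^^ j) (x ((\<sigma> ^^ n) u))" using fun_cong[OF comm] by simp
      also have "\<dots> = (\<sigma> ^^ (j + j * n)) (x u)" by (simp only: Suc funpow_add o_apply)
      finally show ?case by simp
    qed simp
    have "x (pt k a) = pt l ((b + j * a) mod 5)" if a: "a < 5" for a
    proof -
      have "x (pt k a) = x ((\<sigma> ^^ a) (pt k 0))" using k a by (simp add: \<sigma>_pow)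
      also have "\<dots> = (\<sigma> ^^ (j * a)) (pt l b)" unfolding pow using l by simp
      finally show ?thesis using l by (simp add: \<sigma>_pow)
    qed
    then have "x ` cycle k \<subseteq> cycle l" unfolding cycle_def by auto
    moreover have "card (x ` cycle k) = card (cycle l)"
      using k l card_cycle card_image[OF inj_on_subset[OF x subset_UNIV]] by simp
    ultimately have "x ` cycle k = cycle l" by (intro card_subset_eq) auto
    then show ?thesis using l by blast
  qed
  then obtain y where y: "\<And>k. k < 16 \<Longrightarrow> y k < 16 \<and> x ` cycle k = cycle (y k)" by metis
  have "inj_on y {..<16}"
  proof (rule inj_onI)
    fix k l assume kl: "k \<in> {..<16}" "l \<in> {..<16}" "y k = y l"
    then have "x ` cycle k = x ` cycle l" using y by auto
    then have "cycle k = cycle l" using x by (simp add: inj_image_eq_iff)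
    moreover have "cycle k \<noteq> {}" using card_cycle[of k] kl by auto
    ultimately show "k = l" using cycle_disjoint[of k l] kl by auto
  qed
  with y show ?thesis by (intro exI[of _ y]) simp
qed

lemma image_cycles:
  assumes "\<And>k. k < 16 \<Longrightarrow> x ` cycle k = cycle (y k)" "U \<subseteq> {..<16}"
  shows "x ` cycles U = cycles (y ` U)"
proof -
  have "x ` cycles U = (\<Union>k\<in>U. x ` cycle k)" by (simp add: cycles_def image_UN)
  also have "\<dots> = (\<Union>k\<in>U. cycle (y k))" using assms by (intro SUP_cong) auto
  also have "\<dots> = cycles (y ` U)" by (simp add: cycles_def)
  finally show ?thesis .
qed

lemma blocks_preserved:
  assumes "cyclic \<C>" "cyclic \<D>" and x: "inj x" "(`) x ` \<C> = \<D>"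
    and y: "\<And>k. k < 16 \<Longrightarrow> y k < 16" "inj_on y {..<16}" "\<And>k. k < 16 \<Longrightarrow> x ` cycle k = cycle (y k)"
    and kl: "k < 16" "l < 16" "k < 8 \<longleftrightarrow> l < 8"
  shows "y k < 8 \<longleftrightarrow> y l < 8"
proof -
  have "\<exists>U. tetrad \<C> U \<and> {k, l, l} \<subseteq> U"
    by (rule tetrad_exists[OF assms(1) kl(1,2,2)]) (rule kl(3)[symmetric])+
  then obtain U where U: "tetrad \<C> U" "{k, l, l} \<subseteq> U" by (elim exE conjE)
  then have U16: "U \<subseteq> {..<16}" "card U = 4" "cycles U \<in> \<C>" by (auto simp: tetrad_def)
  have "cycles (y ` U) = x ` cycles U" using image_cycles[OF y(3) U16(1)] by simp
  then have "cycles (y ` U) \<in> \<D>" using x(2) U16(3) by auto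
  moreover have "card (y ` U) = 4" using U16 y(2) by (metis card_image inj_on_subset)
  moreover have "y ` U \<subseteq> {..<16}" using U16 y(1) by auto
  ultimately have "tetrad \<D> (y ` U)" by (simp add: tetrad_def)
  then show ?thesis by (rule tetrad_in_block[OF assms(2)]) (use U(2) in simp_all)
qed

text \<open>The cycle permutation induced on a block of eight has order dividing 5, so it fixes three or eight cycles. If it fixed exactly three, the tetrad through these would be mapped to a tetrad with the same three cycles, hence to itself, and its fourth cycle would be fixed as well.\<close>
lemma y_fixes_block:
  assumes cyc: "cyclic \<C>" and B: "B = {..<8} \<or> B = {8..<16}"
    and y: "\<And>k. k < 16 \<Longrightarrow> y k < 16" "inj_on y {..<16}"
    and tet: "\<And>U. tetrad \<C> U \<Longrightarrow> tetrad \<C> (y ` U)"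
    and yB: "\<And>k. k \<in> B \<Longrightarrow> y k \<in> B" and y5: "\<And>k. k \<in> B \<Longrightarrow> (y ^^ 5) k = k" and k: "k \<in> B"
  shows "y k = k"
proof -
  have B16: "B \<subseteq> {..<16}" "finite B" "card B = 8" using B by auto
  let ?F = "{k \<in> B. y k = k}"
  have finF: "finite ?F" using B16 by auto
  have mod: "card B mod 5 = card ?F mod 5"
    by (rule fixed_points_mod5) (use B16 yB y5 in auto)
  have cle: "card ?F \<le> 8" using B16 card_mono[of B ?F] by auto
  then have "card ?F = 3 \<or> card ?F = 8" using mod B16(3) by presburger
  moreover have "card ?F \<noteq> 3"
  proof
    assume "card ?F = 3"
    then obtain p q r where pqr: "?F = {p, q, r}" "p \<noteq> q" "q \<noteq> r" "p \<noteq> r"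
      by (metis card_3_iff)
    then have pB: "p \<in> B" "q \<in> B" "r \<in> B" "y p = p" "y q = q" "y r = r" by blast+
    have "\<exists>U. tetrad \<C> U \<and> {p, q, r} \<subseteq> U"
      by (rule tetrad_exists[OF cyc]) (use pB B in auto)
    then obtain U where U: "tetrad \<C> U" "{p, q, r} \<subseteq> U" by blast
    have U4: "U \<subseteq> {..<16}" "card U = 4" "cycles U \<in> \<C>" using U(1) by (auto simp: tetrad_def)
    have finU: "finite U" using U4(1) finite_subset by blast
    have "card (U - {p, q, r}) = 1" using U4(2) U(2) pqr(2-4) finU by (simp add: card_Diff_subset)
    then obtain s where s: "U - {p, q, r} = {s}" by (metis card_1_singletonE)
    then have Us: "U = {p, q, r, s}" "s \<notin> {p, q, r}" using U(2) by blast+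
    have yU: "tetrad \<C> (y ` U)" by (rule tet[OF U(1)])
    then have yU4: "y ` U \<subseteq> {..<16}" "cycles (y ` U) \<in> \<C>" by (auto simp: tetrad_def)
    have "cycles (U \<triangle> y ` U) \<in> \<C>"
      unfolding cycles_sdiff[OF U4(1) yU4(1)] using U4(3) yU4(2) cyc by (auto simp: cyclic_def is_code_def linear_sdiff)
    moreover have sub: "U \<triangle> y ` U \<subseteq> {s, y s}" using pB(4-6) unfolding Us(1) by auto
    moreover have "card (U \<triangle> y ` U) \<le> 3"
      using card_mono[OF _ sub] card_insert_le_m1[of 2 "{y s}" s] by fastforce
    moreover have "U \<triangle> y ` U \<subseteq> {..<16}" by (rule sdiff_subset[OF U4(1) yU4(1)])
    ultimately have "U \<triangle> y ` U = {}" using cyclic_min[OF cyc] by blast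
    then have "U = y ` U" by (simp add: sdiff_eq_empty)
    then have "y s \<in> U" using Us by blast
    moreover have "y s \<notin> {p, q, r}"
    proof
      assume "y s \<in> {p, q, r}"
      then have "y s = y p \<or> y s = y q \<or> y s = y r" using pB by auto
      then have "s \<in> {p, q, r}" using y(2) U4(1) Us(1) unfolding inj_on_def by blast
      then show False using Us(2) by simp
    qed
    ultimately have "y s = s" using Us(1) by blast
    moreover have "s \<in> B" using tetrad_in_block[OF cyc U(1), of s p] Us(1) pB(1) B U4(1) by auto
    ultimately have "s \<in> ?F" by simp
    then show False using pqr(1) Us(2) by simp
  qed
  ultimately have "card ?F = card B" using B16(3) by simp
  then have "?F = B" using B16(2) by (intro card_subset_eq) auto
  then show ?thesis using k by blast
qed

text \<open>An automorphism of order 5 commuting with \<open>\<sigma>\<close> fixes every cycle, and acts on each of the sixteen cycles as one of the five powers of \<open>\<sigma>\<close>. By the pigeonhole principle some power occurs on four cycles. After division by that power the automorphism has at least 20 fixed points, and hence is trivial.\<close>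
lemma centraliser:
  assumes cyc: "cyclic \<C>" and x: "x \<in> Aut \<C>" "x ^^ 5 = id" and comm: "x \<circ> \<sigma> = \<sigma> \<circ> x"
  shows "\<exists>k<5. x = \<sigma> ^^ k"
proof -
  have inj: "inj x" and im: "(`) x ` \<C> = \<C>" using x by (auto simp: Aut_def bij_is_inj)
  have comm1: "x \<circ> \<sigma> = \<sigma> ^^ 1 \<circ> x" using comm by simp
  from induced_cycle_map[OF inj comm1]
  obtain y where y': "\<forall>k<16. y k < 16" "inj_on y {..<16}" "\<forall>k<16. x ` cycle k = cycle (y k)"
    by (elim exE conjE)
  have y: "\<And>k. k < 16 \<Longrightarrow> y k < 16" "inj_on y {..<16}" "\<And>k. k < 16 \<Longrightarrow> x ` cycle k = cycle (y k)"
    using y' by simp_all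
  have same: "y k < 8 \<longleftrightarrow> y l < 8" if "k < 16" "l < 16" "k < 8 \<longleftrightarrow> l < 8" for k l
    by (rule blocks_preserved[OF cyc cyc inj im y that])
  have y5: "(y ^^ 5) k = k" if k: "k < 16" for k
  proof -
    have "(x ^^ n) ` cycle k = cycle ((y ^^ n) k) \<and> (y ^^ n) k < 16" for n
    proof (induction n)
      case (Suc n)
      have "(x ^^ Suc n) ` cycle k = x ` ((x ^^ n) ` cycle k)" by (simp add: image_comp)
      also have "\<dots> = cycle (y ((y ^^ n) k))" using Suc y(3) by simp
      finally show ?case using Suc y(1) by simp
    qed (use k in simp)
    from this[of 5] have e: "cycle k = cycle ((y ^^ 5) k)" "(y ^^ 5) k < 16" using x(2) by auto
    moreover have "cycle k \<noteq> {}" using card_cycle[OF k] by auto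
    ultimately show ?thesis using cycle_disjoint[of k "(y ^^ 5) k"] k by auto
  qed
  have tet: "tetrad \<C> (y ` U)" if U: "tetrad \<C> U" for U
  proof -
    have U4: "U \<subseteq> {..<16}" "card U = 4" "cycles U \<in> \<C>" using U by (auto simp: tetrad_def)
    have "cycles (y ` U) \<in> \<C>" using image_cycles[OF y(3) U4(1)] Aut_image[OF x(1) U4(3)] by simp
    moreover have "card (y ` U) = 4" using U4 y(2) by (metis card_image inj_on_subset)
    moreover have "y ` U \<subseteq> {..<16}" using U4 y(1) by auto
    ultimately show ?thesis by (simp add: tetrad_def)
  qed
  have low: "y k < 8" if k: "k < 8" for k
  proof (rule ccontr)
    assume "\<not> y k < 8"
    then have up: "\<not> y l < 8" if "l < 8" for l using same[of k l] k that by simp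
    have down: "y l < 8" if l: "\<not> l < 8" "l < 16" for l
    proof (rule ccontr)
      assume "\<not> y l < 8"
      then have "\<not> y m < 8" if "m < 16" for m using same[of l m] up l that by (cases "m < 8") auto
      then have "y ` {..<16} \<subseteq> {8..<16}" using y(1) by (auto simp: not_less)
      then have "card (y ` {..<16}) \<le> card {8..<16::nat}" by (intro card_mono) auto
      then show False using card_image[OF y(2)] by simp
    qed
    have "y k < 16" "\<not> y k < 8" using y(1) up k by auto
    moreover have "y (y k) < 8" using down calculation by blast
    moreover have "y (y (y k)) < 16" "\<not> y (y (y k)) < 8" using y(1) up calculation by auto
    moreover have "y (y (y (y k))) < 8" using down calculation by blast
    moreover have "\<not> y (y (y (y (y k)))) < 8" using up calculation by blast
    ultimately show False using y5[of k] k by (simp add: funpow5)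
  qed
  have high: "\<not> y l < 8" if l: "\<not> l < 8" "l < 16" for l
  proof
    assume "y l < 8"
    then have "y m < 8" if "m < 16" for m using same[of l m] low l that by (cases "m < 8") auto
    then have "y ` {..<16} \<subseteq> {..<8}" by auto
    then have "card (y ` {..<16}) \<le> card {..<8::nat}" by (intro card_mono) auto
    then show False using card_image[OF y(2)] by simp
  qed
  have yid: "y k = k" if k: "k < 16" for k
  proof (cases "k < 8")
    case True
    show ?thesis by (rule y_fixes_block[OF cyc _ y(1,2) tet, of "{..<8}"]) (use low y5 True in auto)
  next
    case False
    show ?thesis by (rule y_fixes_block[OF cyc _ y(1,2) tet, of "{8..<16}"]) (use high y(1) y5 False k in \<open>auto simp: not_less\<close>)
  qed
  have "\<exists>d<5. x (pt k 0) = pt k d" if k: "k < 16" for k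
  proof -
    have "x (pt k 0) \<in> x ` cycle k" by (auto simp: cycle_def)
    then show ?thesis using y(3)[OF k] yid[OF k] by (auto simp: cycle_def)
  qed
  then obtain d where d: "\<And>k. k < 16 \<Longrightarrow> d k < 5 \<and> x (pt k 0) = pt k (d k)" by metis
  have xpt: "x (pt k a) = pt k ((a + d k) mod 5)" if k: "k < 16" and a: "a < 5" for k a
  proof -
    have cpow: "x ((\<sigma> ^^ n) u) = (\<sigma> ^^ n) (x u)" for n u
      using fun_cong[OF comm] by (induction n) simp_all
    have "x (pt k a) = x ((\<sigma> ^^ a) (pt k 0))" using k a by (simp add: \<sigma>_pow)
    also have "\<dots> = (\<sigma> ^^ a) (pt k (d k))" unfolding cpow using d[OF k] by simp
    finally show ?thesis using d[OF k] k by (simp add: \<sigma>_pow add.commute)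
  qed
  have "\<exists>d0<5. 4 \<le> card {k \<in> {..<16}. d k = d0}"
  proof (rule ccontr)
    assume "\<not> ?thesis"
    then have small: "card {k \<in> {..<16}. d k = d0} \<le> 3" if "d0 < 5" for d0 using that by fastforce
    have "16 = (\<Sum>k\<in>{..<16::nat}. 1::nat)" by simp
    also have "\<dots> = (\<Sum>d0\<in>{..<5}. \<Sum>k\<in>{k \<in> {..<16}. d k = d0}. 1)"
      by (rule sum.group[symmetric]) (use d in auto)
    also have "\<dots> \<le> (\<Sum>d0\<in>{..<5::nat}. 3)" by (rule sum_mono) (use small in simp)
    finally show False by simp
  qed
  then obtain d0 where d0: "d0 < 5" "4 \<le> card {k \<in> {..<16}. d k = d0}" by blast
  define z where "z = \<sigma> ^^ (5 - d0) \<circ> x"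
  have \<sigma>Aut: "\<sigma> \<in> Aut \<C>" using cyc by (simp add: cyclic_def)
  have zpt: "z (pt k a) = pt k ((a + d k + (5 - d0)) mod 5)" if "k < 16" "a < 5" for k a
  proof -
    have "z (pt k a) = (\<sigma> ^^ (5 - d0)) (pt k ((a + d k) mod 5))" using that by (simp add: z_def xpt)
    also have "\<dots> = pt k (((a + d k) mod 5 + (5 - d0)) mod 5)" using that by (intro \<sigma>_pow) auto
    finally show ?thesis by (simp only: mod_add_left_eq)
  qed
  have "z = id"
  proof (rule automorphism_fixing_20[OF _ card_type])
    show "is_code \<C>" using cyc by (simp add: cyclic_def)
    show "z \<in> Aut \<C>" unfolding z_def using Aut_comp Aut_funpow \<sigma>Aut x(1) by blast
    show "(z ^^ 5) u = u" for u
    proof -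
      obtain k a where u: "u = pt k a" "k < 16" "a < 5" by (rule pt_surj)
      define M where "M = d k + (5 - d0)"
      have zM: "z (pt k b) = pt k ((b + M) mod 5)" if "b < 5" for b using zpt[OF u(2) that] by (simp add: M_def add.assoc)
      have "(z ^^ n) (pt k a) = pt k ((a + n * M) mod 5)" for n
      proof (induction n)
        case (Suc n)
        have "(z ^^ Suc n) (pt k a) = z (pt k ((a + n * M) mod 5))" using Suc by simp
        also have "\<dots> = pt k (((a + n * M) mod 5 + M) mod 5)" by (rule zM) simp
        also have "\<dots> = pt k ((a + n * M + M) mod 5)" by (simp only: mod_add_left_eq)
        finally show ?case by (simp add: algebra_simps)
      qed (use u(3) in simp)
      note e = this[of 5]
      show ?thesis unfolding u(1) e using u(3) by (simp only: mod_mult_self2 mod_less)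
    qed
    let ?K = "{k \<in> {..<16}. d k = d0}"
    have "card (cycles ?K) = 5 * card ?K" by (rule card_cycles) auto
    moreover have "cycles ?K \<subseteq> {u. z u = u}"
    proof
      fix u assume "u \<in> cycles ?K"
      then obtain k a where "u = pt k a" "k < 16" "d k = d0" "a < 5" by (auto simp: cycles_def cycle_def)
      then show "u \<in> {u. z u = u}" using d0(1) by (simp add: zpt)
    qed
    then have "card (cycles ?K) \<le> card {u. z u = u}" by (intro card_mono) auto
    ultimately show "20 \<le> card {u. z u = u}" using d0(2) by linarith
  qed
  then have "\<sigma> ^^ d0 \<circ> z = \<sigma> ^^ d0" by simp
  moreover have "\<sigma> ^^ d0 \<circ> z = \<sigma> ^^ (d0 + (5 - d0)) \<circ> x" unfolding z_def by (simp add: funpow_add o_assoc)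
  ultimately have "x = \<sigma> ^^ d0" using \<sigma>5 d0(1) by simp
  then show ?thesis using d0(1) by blast
qed

lemma block_profile_image:
  assumes "cyclic \<C>" "cyclic \<D>" and x: "bij x" "(`) x ` \<C> = \<D>" "x \<circ> \<sigma> = \<sigma> ^^ j \<circ> x"
  shows "block_profile (x ` X) = block_profile X"
proof -
  have inj: "inj x" using x by (simp add: bij_is_inj)
  from induced_cycle_map[OF inj x(3)]
  obtain y where y': "\<forall>k<16. y k < 16" "inj_on y {..<16}" "\<forall>k<16. x ` cycle k = cycle (y k)"
    by (elim exE conjE)
  have y: "\<And>k. k < 16 \<Longrightarrow> y k < 16" "inj_on y {..<16}" "\<And>k. k < 16 \<Longrightarrow> x ` cycle k = cycle (y k)"
    using y' by simp_all
  have same: "y k < 8 \<longleftrightarrow> y l < 8" if "k < 16" "l < 16" "k < 8 \<longleftrightarrow> l < 8" for k l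
    by (rule blocks_preserved[OF assms(1,2) inj x(2) y that])
  have B: "block 0 = {..<8}" "block (Suc 0) = {8..<16}" by (auto simp: block_def)
  have prof: "image_mset (\<lambda>k. card (x ` X \<inter> cycle k)) (mset_set (y ` S)) = image_mset (\<lambda>k. card (X \<inter> cycle k)) (mset_set S)"
    if S: "S \<subseteq> {..<16}" for S
  proof -
    have "mset_set (y ` S) = image_mset y (mset_set S)"
      using inj_on_subset[OF y(2) S] by (simp add: image_mset_mset_set)
    moreover have "card (x ` X \<inter> cycle (y k)) = card (X \<inter> cycle k)" if "k \<in> S" for k
    proof -
      have "x ` X \<inter> cycle (y k) = x ` (X \<inter> cycle k)" using y(3)[of k] that S inj by (auto simp: image_Int)
      then show ?thesis using inj by (simp add: card_image inj_on_subset)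
    qed
    moreover have "finite S" using S finite_subset by blast
    ultimately show ?thesis by (auto simp: image_mset.compositionality o_def intro!: image_mset_cong)
  qed
  have onto: "y ` S = T" if "S \<subseteq> {..<16}" "y ` S \<subseteq> T" "card S = card T" "finite T" for S T
  proof (rule card_subset_eq[OF that(4,2)])
    show "card (y ` S) = card T" using that(1,3) y(2) by (metis card_image inj_on_subset)
  qed
  have im16: "y ` {..<16} = {..<16}" by (rule onto) (use y(1) in auto)
  have "(y ` {..<8} = {..<8} \<and> y ` {8..<16} = {8..<16}) \<or> (y ` {..<8} = {8..<16} \<and> y ` {8..<16} = {..<8})"
  proof (cases "y 0 < 8")
    case True
    have "y k < 8" if "k < 8" for k using same[of k 0] True that by simp
    then have 1: "y ` {..<8} = {..<8}" by (intro onto) auto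
    have "y ` {8..<16} \<subseteq> {8..<16}"
    proof
      fix m assume "m \<in> y ` {8..<16}"
      then obtain k where k: "m = y k" "8 \<le> k" "k < 16" by auto
      have "m \<notin> {..<8}"
      proof
        assume "m \<in> {..<8}"
        then obtain l where "l < 8" "y k = y l" using 1 k by (metis imageE lessThan_iff)
        then have "k = l" using y(2) k by (simp add: inj_on_def)
        then show False using k \<open>l < 8\<close> by simp
      qed
      then show "m \<in> {8..<16}" using y(1)[of k] k by auto
    qed
    then have "y ` {8..<16} = {8..<16}" by (intro onto) auto
    with 1 show ?thesis by blast
  next
    case False
    have "\<not> y k < 8" if "k < 8" for k using same[of k 0] False that by simp
    moreover have "y k < 16" if "k < 8" for k using y(1) that by simp
    ultimately have "y ` {..<8} \<subseteq> {8..<16}" by (auto simp: not_less)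
    then have 1: "y ` {..<8} = {8..<16}" by (intro onto) auto
    have "y ` {8..<16} \<subseteq> {..<8}"
    proof
      fix m assume "m \<in> y ` {8..<16}"
      then obtain k where k: "m = y k" "8 \<le> k" "k < 16" by auto
      have "m \<notin> {8..<16}"
      proof
        assume "m \<in> {8..<16}"
        then obtain l where "l < 8" "y k = y l" using 1 k by (metis imageE lessThan_iff)
        then have "k = l" using y(2) k by (simp add: inj_on_def)
        then show False using k \<open>l < 8\<close> by simp
      qed
      then show "m \<in> {..<8}" using y(1)[of k] k by auto
    qed
    then have "y ` {8..<16} = {..<8}" by (intro onto) auto
    with 1 show ?thesis by blast
  qed
  moreover have "{..<8} \<subseteq> {..<16::nat}" "{8..<16} \<subseteq> {..<16::nat}" by auto
  ultimately show ?thesis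
    using prof[of "{..<8}"] prof[of "{8..<16}"] unfolding block_profile_def B by (auto simp: B add_mset_commute)
qed

text \<open>An equivalence of two such codes transports \<open>\<sigma>\<close> to an automorphism of order 5 of the second code. By the Sylow-type argument it can be corrected by an automorphism of the second code so that it normalises the group generated by \<open>\<sigma>\<close>. It then respects cycles and blocks, and therefore block profiles.\<close>
theorem equivalent_block_profiles:
  assumes "cyclic \<C>" "cyclic \<D>" and p: "bij p" "(`) p ` \<C> = \<D>"
  shows "block_profile ` \<C> = block_profile ` \<D>"
proof -
  define \<tau> where "\<tau> = p \<circ> \<sigma> \<circ> inv p"
  have \<sigma>C: "\<sigma> \<in> Aut \<C>" and \<sigma>D: "\<sigma> \<in> Aut \<D>" using assms by (auto simp: cyclic_def)
  have ip: "inv p \<circ> p = id" "p \<circ> inv p = id" using p(1) by (auto simp: bij_is_inj surj_iff[symmetric] bij_is_surj)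
  have invim: "(`) (inv p) ` \<D> = \<C>" unfolding p(2)[symmetric] by (simp add: image_image bij_is_inj[OF p(1)])
  have push: "p \<circ> g \<circ> inv p \<in> Aut \<D>" if g: "g \<in> Aut \<C>" for g
  proof -
    have "(`) (p \<circ> g \<circ> inv p) ` \<D> = (`) p ` (`) g ` (`) (inv p) ` \<D>" by (simp add: image_comp image_image)
    also have "\<dots> = \<D>" using g p(2) by (simp add: invim Aut_def)
    finally show ?thesis using g p(1) by (simp add: Aut_def bij_comp bij_imp_bij_inv)
  qed
  have pull: "inv p \<circ> g \<circ> p \<in> Aut \<C>" if g: "g \<in> Aut \<D>" for g
  proof -
    have "(`) (inv p \<circ> g \<circ> p) ` \<C> = (`) (inv p) ` (`) g ` (`) p ` \<C>" by (simp add: image_comp image_image)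
    also have "\<dots> = \<C>" using g p(2) by (simp add: invim Aut_def)
    finally show ?thesis using g p(1) by (simp add: Aut_def bij_comp bij_imp_bij_inv)
  qed
  have pc: "p \<circ> (inv p \<circ> g) = g" "inv p \<circ> (p \<circ> g) = g" for g :: "'a \<Rightarrow> 'a" using ip by (simp_all add: o_assoc)
  have pw: "(p \<circ> g \<circ> inv p) ^^ n = p \<circ> g ^^ n \<circ> inv p" for g n
    by (induction n) (auto simp: ip fun_eq_iff bij_is_inj[OF p(1)] surj_f_inv_f[OF bij_is_surj[OF p(1)]])
  have "\<exists>g\<in>Aut \<D>. \<exists>k. g \<circ> \<tau> \<circ> inv g = \<sigma> ^^ k"
  proof (rule conjugate_into_powers)
    show "\<And>g h. g \<in> Aut \<D> \<Longrightarrow> h \<in> Aut \<D> \<Longrightarrow> g \<circ> h \<in> Aut \<D>" by (rule Aut_comp)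
    show "\<And>g. g \<in> Aut \<D> \<Longrightarrow> inv g \<in> Aut \<D>" by (rule Aut_inv)
    show "\<And>g. g \<in> Aut \<D> \<Longrightarrow> bij g" by (simp add: Aut_def)
    show "id \<in> Aut \<D>" by (rule Aut_id)
    show "\<sigma> \<in> Aut \<D>" "\<sigma> ^^ 5 = id" by (rule \<sigma>D \<sigma>5)+
    show "\<tau> \<in> Aut \<D>" unfolding \<tau>_def by (rule push[OF \<sigma>C])
    show "\<tau> ^^ 5 = id" unfolding \<tau>_def pw \<sigma>5 using ip by simp
    show "\<tau> \<noteq> id"
    proof
      assume "\<tau> = id"
      then have "inv p \<circ> \<tau> \<circ> p = id" using ip by simp
      moreover have "inv p \<circ> \<tau> \<circ> p = \<sigma>" unfolding \<tau>_def by (simp add: o_assoc[symmetric] pc ip)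
      ultimately show False using \<sigma>_ne_id by simp
    qed
    show "\<And>x. x \<in> Aut \<D> \<Longrightarrow> x ^^ 5 = id \<Longrightarrow> x \<circ> \<sigma> = \<sigma> \<circ> x \<Longrightarrow> \<exists>k<5. x = \<sigma> ^^ k"
      by (rule centraliser[OF assms(2)])
    fix x assume x: "x \<in> Aut \<D>" "x ^^ 5 = id" "x \<circ> \<tau> = \<tau> \<circ> x"
    let ?w = "inv p \<circ> x \<circ> p"
    have back_x: "x = p \<circ> ?w \<circ> inv p" by (simp add: o_assoc[symmetric] pc ip)
    have "p \<circ> ?w ^^ 5 \<circ> inv p = id" using x(2) back_x pw[where g = ?w and n = 5] by simp
    then have "inv p \<circ> (p \<circ> ?w ^^ 5 \<circ> inv p) \<circ> p = id" using ip by simp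
    then have "?w ^^ 5 = id" by (simp add: o_assoc[symmetric] pc ip)
    moreover have "?w \<circ> \<sigma> = \<sigma> \<circ> ?w"
    proof -
      have "inv p \<circ> (x \<circ> \<tau>) \<circ> p = inv p \<circ> (\<tau> \<circ> x) \<circ> p" using x(3) by simp
      then show ?thesis unfolding \<tau>_def by (simp add: o_assoc[symmetric] pc ip)
    qed
    ultimately obtain k where "k < 5" "?w = \<sigma> ^^ k" using centraliser[OF assms(1) pull[OF x(1)]] by blast
    moreover from this have "x = \<tau> ^^ k" unfolding \<tau>_def pw using back_x by simp
    ultimately show "\<exists>k<5. x = \<tau> ^^ k" by blast
  qed
  then obtain g k where g: "g \<in> Aut \<D>" "g \<circ> \<tau> \<circ> inv g = \<sigma> ^^ k" by blast
  have bg: "bij g" "(`) g ` \<D> = \<D>" using g by (auto simp: Aut_def)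
  let ?x = "g \<circ> p"
  have ig: "inv g \<circ> g = id" using bg by (simp add: bij_is_inj)
  have "?x \<circ> \<sigma> = g \<circ> \<tau> \<circ> p" unfolding \<tau>_def by (simp add: o_assoc[symmetric] ip)
  also have "\<dots> = (g \<circ> \<tau> \<circ> inv g) \<circ> (g \<circ> p)" using ig by (metis comp_assoc comp_id)
  finally have comm: "?x \<circ> \<sigma> = \<sigma> ^^ k \<circ> ?x" unfolding g(2) .
  have bx: "bij ?x" using bg p by (simp add: bij_comp)
  have imx: "(`) ?x ` \<C> = \<D>" using p(2) bg(2) by (simp add: image_comp[symmetric] image_image[symmetric])
  have "block_profile ` \<D> = block_profile ` (`) ?x ` \<C>" using imx by simp
  also have "\<dots> = block_profile ` \<C>"
    using block_profile_image[OF assms(1,2) bx imx comm] by (simp add: image_image)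
  finally show ?thesis by simp
qed

end

section \<open>Symbols and enumeration procedures\<close>

datatype sym = s0 | s1 | s2 | s3 | s4 | s5 | s6 | s7 | s8 | s9 | sa | sb | sc | sd | se | sf

text \<open>A symbol is an even subset of the five points of a cycle, which is the same as an element of the field with 16 elements realised as the even-weight ideal in the group algebra of the cyclic group of order 5. Bits 0 to 3 are given by the mask and bit 4 is their parity.\<close>
primrec mask :: "sym \<Rightarrow> nat" where
  "mask s0 = 0" | "mask s1 = 1" | "mask s2 = 2" | "mask s3 = 3" | "mask s4 = 4" | "mask s5 = 5" | "mask s6 = 6" | "mask s7 = 7"
| "mask s8 = 8" | "mask s9 = 9" | "mask sa = 10" | "mask sb = 11" | "mask sc = 12" | "mask sd = 13" | "mask se = 14" | "mask sf = 15"

text \<open>Addition in the field with 16 elements.\<close>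
definition xr :: "sym \<Rightarrow> sym \<Rightarrow> sym" where
  "xr x y = [s0,s1,s2,s3,s4,s5,s6,s7,s8,s9,sa,sb,sc,sd,se,sf] ! (xor (mask x) (mask y))"

lemma xr_table:
  "xr s0 s0 = s0" "xr s0 s1 = s1" "xr s0 s2 = s2" "xr s0 s3 = s3" "xr s0 s4 = s4" "xr s0 s5 = s5" "xr s0 s6 = s6" "xr s0 s7 = s7" "xr s0 s8 = s8" "xr s0 s9 = s9" "xr s0 sa = sa" "xr s0 sb = sb" "xr s0 sc = sc" "xr s0 sd = sd" "xr s0 se = se" "xr s0 sf = sf"
  "xr s1 s0 = s1" "xr s1 s1 = s0" "xr s1 s2 = s3" "xr s1 s3 = s2" "xr s1 s4 = s5" "xr s1 s5 = s4" "xr s1 s6 = s7" "xr s1 s7 = s6" "xr s1 s8 = s9" "xr s1 s9 = s8" "xr s1 sa = sb" "xr s1 sb = sa" "xr s1 sc = sd" "xr s1 sd = sc" "xr s1 se = sf" "xr s1 sf = se"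
  "xr s2 s0 = s2" "xr s2 s1 = s3" "xr s2 s2 = s0" "xr s2 s3 = s1" "xr s2 s4 = s6" "xr s2 s5 = s7" "xr s2 s6 = s4" "xr s2 s7 = s5" "xr s2 s8 = sa" "xr s2 s9 = sb" "xr s2 sa = s8" "xr s2 sb = s9" "xr s2 sc = se" "xr s2 sd = sf" "xr s2 se = sc" "xr s2 sf = sd"
  "xr s3 s0 = s3" "xr s3 s1 = s2" "xr s3 s2 = s1" "xr s3 s3 = s0" "xr s3 s4 = s7" "xr s3 s5 = s6" "xr s3 s6 = s5" "xr s3 s7 = s4" "xr s3 s8 = sb" "xr s3 s9 = sa" "xr s3 sa = s9" "xr s3 sb = s8" "xr s3 sc = sf" "xr s3 sd = se" "xr s3 se = sd" "xr s3 sf = sc"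
  "xr s4 s0 = s4" "xr s4 s1 = s5" "xr s4 s2 = s6" "xr s4 s3 = s7" "xr s4 s4 = s0" "xr s4 s5 = s1" "xr s4 s6 = s2" "xr s4 s7 = s3" "xr s4 s8 = sc" "xr s4 s9 = sd" "xr s4 sa = se" "xr s4 sb = sf" "xr s4 sc = s8" "xr s4 sd = s9" "xr s4 se = sa" "xr s4 sf = sb"
  "xr s5 s0 = s5" "xr s5 s1 = s4" "xr s5 s2 = s7" "xr s5 s3 = s6" "xr s5 s4 = s1" "xr s5 s5 = s0" "xr s5 s6 = s3" "xr s5 s7 = s2" "xr s5 s8 = sd" "xr s5 s9 = sc" "xr s5 sa = sf" "xr s5 sb = se" "xr s5 sc = s9" "xr s5 sd = s8" "xr s5 se = sb" "xr s5 sf = sa"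
  "xr s6 s0 = s6" "xr s6 s1 = s7" "xr s6 s2 = s4" "xr s6 s3 = s5" "xr s6 s4 = s2" "xr s6 s5 = s3" "xr s6 s6 = s0" "xr s6 s7 = s1" "xr s6 s8 = se" "xr s6 s9 = sf" "xr s6 sa = sc" "xr s6 sb = sd" "xr s6 sc = sa" "xr s6 sd = sb" "xr s6 se = s8" "xr s6 sf = s9"
  "xr s7 s0 = s7" "xr s7 s1 = s6" "xr s7 s2 = s5" "xr s7 s3 = s4" "xr s7 s4 = s3" "xr s7 s5 = s2" "xr s7 s6 = s1" "xr s7 s7 = s0" "xr s7 s8 = sf" "xr s7 s9 = se" "xr s7 sa = sd" "xr s7 sb = sc" "xr s7 sc = sb" "xr s7 sd = sa" "xr s7 se = s9" "xr s7 sf = s8"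
  "xr s8 s0 = s8" "xr s8 s1 = s9" "xr s8 s2 = sa" "xr s8 s3 = sb" "xr s8 s4 = sc" "xr s8 s5 = sd" "xr s8 s6 = se" "xr s8 s7 = sf" "xr s8 s8 = s0" "xr s8 s9 = s1" "xr s8 sa = s2" "xr s8 sb = s3" "xr s8 sc = s4" "xr s8 sd = s5" "xr s8 se = s6" "xr s8 sf = s7"
  "xr s9 s0 = s9" "xr s9 s1 = s8" "xr s9 s2 = sb" "xr s9 s3 = sa" "xr s9 s4 = sd" "xr s9 s5 = sc" "xr s9 s6 = sf" "xr s9 s7 = se" "xr s9 s8 = s1" "xr s9 s9 = s0" "xr s9 sa = s3" "xr s9 sb = s2" "xr s9 sc = s5" "xr s9 sd = s4" "xr s9 se = s7" "xr s9 sf = s6"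
  "xr sa s0 = sa" "xr sa s1 = sb" "xr sa s2 = s8" "xr sa s3 = s9" "xr sa s4 = se" "xr sa s5 = sf" "xr sa s6 = sc" "xr sa s7 = sd" "xr sa s8 = s2" "xr sa s9 = s3" "xr sa sa = s0" "xr sa sb = s1" "xr sa sc = s6" "xr sa sd = s7" "xr sa se = s4" "xr sa sf = s5"
  "xr sb s0 = sb" "xr sb s1 = sa" "xr sb s2 = s9" "xr sb s3 = s8" "xr sb s4 = sf" "xr sb s5 = se" "xr sb s6 = sd" "xr sb s7 = sc" "xr sb s8 = s3" "xr sb s9 = s2" "xr sb sa = s1" "xr sb sb = s0" "xr sb sc = s7" "xr sb sd = s6" "xr sb se = s5" "xr sb sf = s4"
  "xr sc s0 = sc" "xr sc s1 = sd" "xr sc s2 = se" "xr sc s3 = sf" "xr sc s4 = s8" "xr sc s5 = s9" "xr sc s6 = sa" "xr sc s7 = sb" "xr sc s8 = s4" "xr sc s9 = s5" "xr sc sa = s6" "xr sc sb = s7" "xr sc sc = s0" "xr sc sd = s1" "xr sc se = s2" "xr sc sf = s3"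
  "xr sd s0 = sd" "xr sd s1 = sc" "xr sd s2 = sf" "xr sd s3 = se" "xr sd s4 = s9" "xr sd s5 = s8" "xr sd s6 = sb" "xr sd s7 = sa" "xr sd s8 = s5" "xr sd s9 = s4" "xr sd sa = s7" "xr sd sb = s6" "xr sd sc = s1" "xr sd sd = s0" "xr sd se = s3" "xr sd sf = s2"
  "xr se s0 = se" "xr se s1 = sf" "xr se s2 = sc" "xr se s3 = sd" "xr se s4 = sa" "xr se s5 = sb" "xr se s6 = s8" "xr se s7 = s9" "xr se s8 = s6" "xr se s9 = s7" "xr se sa = s4" "xr se sb = s5" "xr se sc = s2" "xr se sd = s3" "xr se se = s0" "xr se sf = s1"
  "xr sf s0 = sf" "xr sf s1 = se" "xr sf s2 = sd" "xr sf s3 = sc" "xr sf s4 = sb" "xr sf s5 = sa" "xr sf s6 = s9" "xr sf s7 = s8" "xr sf s8 = s7" "xr sf s9 = s6" "xr sf sa = s5" "xr sf sb = s4" "xr sf sc = s3" "xr sf sd = s2" "xr sf se = s1" "xr sf sf = s0"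
  by (simp_all add: xr_def)

primrec cyc :: "sym \<Rightarrow> bool list" where
  "cyc s0 = [False,False,False,False,False]" | "cyc s1 = [True,False,False,False,True]" | "cyc s2 = [False,True,False,False,True]" | "cyc s3 = [True,True,False,False,False]" | "cyc s4 = [False,False,True,False,True]" | "cyc s5 = [True,False,True,False,False]" | "cyc s6 = [False,True,True,False,False]" | "cyc s7 = [True,True,True,False,True]"
| "cyc s8 = [False,False,False,True,True]" | "cyc s9 = [True,False,False,True,False]" | "cyc sa = [False,True,False,True,False]" | "cyc sb = [True,True,False,True,True]" | "cyc sc = [False,False,True,True,False]" | "cyc sd = [True,False,True,True,True]" | "cyc se = [False,True,True,True,True]" | "cyc sf = [True,True,True,True,False]"

text \<open>The action of the rotation of a cycle on symbols; it is multiplication by a primitive fifth root of unity.\<close>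
primrec rot :: "sym \<Rightarrow> sym" where
  "rot s0 = s0" | "rot s1 = s3" | "rot s2 = s5" | "rot s3 = s6" | "rot s4 = s9" | "rot s5 = sa" | "rot s6 = sc" | "rot s7 = sf"
| "rot s8 = s1" | "rot s9 = s2" | "rot sa = s4" | "rot sb = s7" | "rot sc = s8" | "rot sd = sb" | "rot se = sd" | "rot sf = se"

text \<open>Reversal of a cycle: the field automorphism \<open>x \<mapsto> x ^ 4\<close> over the field with 4 elements.\<close>
primrec conj :: "sym \<Rightarrow> sym" where
  "conj s0 = s0" | "conj s1 = s3" | "conj s2 = s2" | "conj s3 = s1" | "conj s4 = sa" | "conj s5 = s9" | "conj s6 = s8" | "conj s7 = sb"
| "conj s8 = s6" | "conj s9 = s5" | "conj sa = s4" | "conj sb = s7" | "conj sc = sc" | "conj sd = sf" | "conj se = se" | "conj sf = sd"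

primrec wt :: "sym \<Rightarrow> nat" where
  "wt s0 = 0" | "wt s1 = (Suc (Suc 0))" | "wt s2 = (Suc (Suc 0))" | "wt s3 = (Suc (Suc 0))" | "wt s4 = (Suc (Suc 0))" | "wt s5 = (Suc (Suc 0))" | "wt s6 = (Suc (Suc 0))" | "wt s7 = (Suc (Suc (Suc (Suc 0))))"
| "wt s8 = (Suc (Suc 0))" | "wt s9 = (Suc (Suc 0))" | "wt sa = (Suc (Suc 0))" | "wt sb = (Suc (Suc (Suc (Suc 0))))" | "wt sc = (Suc (Suc 0))" | "wt sd = (Suc (Suc (Suc (Suc 0))))" | "wt se = (Suc (Suc (Suc (Suc 0))))" | "wt sf = (Suc (Suc (Suc (Suc 0))))"


definition has :: "sym \<Rightarrow> nat \<Rightarrow> bool" where "has x a = cyc x ! a"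

text \<open>Weight of a symbol on a cycle after complementation (when the flag is set).\<close>
fun cost :: "bool \<Rightarrow> sym \<Rightarrow> nat" where
  "cost False x = wt x" | "cost True x = 5 - wt x"

fun vx :: "sym list \<Rightarrow> sym list \<Rightarrow> sym list" where
  "vx (x # xs) (y # ys) = xr x y # vx xs ys" | "vx [] ys = []" | "vx (x # xs) [] = []"

definition rv :: "sym list \<Rightarrow> sym list" where "rv = map rot"

definition zv :: "sym list" where "zv = [s0,s0,s0,s0,s0,s0,s0,s0]"

text \<open>The extended Hamming code of length 8.\<close>
definition e8 :: "bool list list" where "e8 = [
  [False,False,False,False,False,False,False,False],
  [True,False,False,False,False,True,True,True],
  [False,True,False,False,True,False,True,True],
  [True,True,False,False,True,True,False,False],
  [False,False,True,False,True,True,False,True],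
  [True,False,True,False,True,False,True,False],
  [False,True,True,False,False,True,True,False],
  [True,True,True,False,False,False,False,True],
  [False,False,False,True,True,True,True,False],
  [True,False,False,True,True,False,False,True],
  [False,True,False,True,False,True,False,True],
  [True,True,False,True,False,False,True,False],
  [False,False,True,True,False,False,True,True],
  [True,False,True,True,False,True,False,False],
  [False,True,True,True,True,False,False,False],
  [True,True,True,True,True,True,True,True]]"

text \<open>The words of weight 4 of the extended Hamming code.\<close>
definition tetrads :: "bool list list" where "tetrads = [
  [True,False,False,False,False,True,True,True],
  [False,True,False,False,True,False,True,True],
  [True,True,False,False,True,True,False,False],
  [False,False,True,False,True,True,False,True],
  [True,False,True,False,True,False,True,False],
  [False,True,True,False,False,True,True,False],
  [True,True,True,False,False,False,False,True],
  [False,False,False,True,True,True,True,False],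
  [True,False,False,True,True,False,False,True],
  [False,True,False,True,False,True,False,True],
  [True,True,False,True,False,False,True,False],
  [False,False,True,True,False,False,True,True],
  [True,False,True,True,False,True,False,False],
  [False,True,True,True,True,False,False,False]]"

text \<open>Weight on a block of the word given by eight symbols and eight complementation flags.\<close>
fun vcost :: "bool list \<Rightarrow> sym list \<Rightarrow> nat" where
  "vcost (f # fs) (x # xs) = cost f x + vcost fs xs" | "vcost _ _ = 0"

text \<open>Tests whether the cheapest choice of flags gives cost at most the bound. The recursion consumes the bound, so that it stops early on almost all vectors; the sum of two vectors is never built.\<close>
function low :: "nat \<Rightarrow> sym list \<Rightarrow> sym list \<Rightarrow> bool"
  and low_step :: "sym \<Rightarrow> nat \<Rightarrow> sym list \<Rightarrow> sym list \<Rightarrow> bool" where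
  "low R (x # xs) (y # ys) = low_step (xr x y) R xs ys"
| "low R [] ys = True"
| "low R (x # xs) [] = True"
| "low_step x R xs ys = (min (wt x) (5 - wt x) \<le> R \<and> low (R - min (wt x) (5 - wt x)) xs ys)"
  by pat_completeness auto
termination
  by (relation "measure (\<lambda>x. case x of Inl (R, xs, ys) \<Rightarrow> 2 * length xs
    | Inr (x, R, xs, ys) \<Rightarrow> Suc (2 * length xs))") auto

declare low_step.simps [simp del]
lemma low_step_table:
  "low_step s0 R xs ys = low R xs ys"
  "low_step s1 0 xs ys = False"
  "low_step s1 (Suc 0) xs ys = False"
  "low_step s1 (Suc (Suc R)) xs ys = low R xs ys"
  "low_step s2 0 xs ys = False"
  "low_step s2 (Suc 0) xs ys = False"
  "low_step s2 (Suc (Suc R)) xs ys = low R xs ys"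
  "low_step s3 0 xs ys = False"
  "low_step s3 (Suc 0) xs ys = False"
  "low_step s3 (Suc (Suc R)) xs ys = low R xs ys"
  "low_step s4 0 xs ys = False"
  "low_step s4 (Suc 0) xs ys = False"
  "low_step s4 (Suc (Suc R)) xs ys = low R xs ys"
  "low_step s5 0 xs ys = False"
  "low_step s5 (Suc 0) xs ys = False"
  "low_step s5 (Suc (Suc R)) xs ys = low R xs ys"
  "low_step s6 0 xs ys = False"
  "low_step s6 (Suc 0) xs ys = False"
  "low_step s6 (Suc (Suc R)) xs ys = low R xs ys"
  "low_step s7 0 xs ys = False"
  "low_step s7 (Suc R) xs ys = low R xs ys"
  "low_step s8 0 xs ys = False"
  "low_step s8 (Suc 0) xs ys = False"
  "low_step s8 (Suc (Suc R)) xs ys = low R xs ys"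
  "low_step s9 0 xs ys = False"
  "low_step s9 (Suc 0) xs ys = False"
  "low_step s9 (Suc (Suc R)) xs ys = low R xs ys"
  "low_step sa 0 xs ys = False"
  "low_step sa (Suc 0) xs ys = False"
  "low_step sa (Suc (Suc R)) xs ys = low R xs ys"
  "low_step sb 0 xs ys = False"
  "low_step sb (Suc R) xs ys = low R xs ys"
  "low_step sc 0 xs ys = False"
  "low_step sc (Suc 0) xs ys = False"
  "low_step sc (Suc (Suc R)) xs ys = low R xs ys"
  "low_step sd 0 xs ys = False"
  "low_step sd (Suc R) xs ys = low R xs ys"
  "low_step se 0 xs ys = False"
  "low_step se (Suc R) xs ys = low R xs ys"
  "low_step sf 0 xs ys = False"
  "low_step sf (Suc R) xs ys = low R xs ys"
  by (simp_all add: low_step.simps)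

text \<open>Tests whether the sum of two vectors has at most one symbol of weight 2.\<close>
function twoA :: "sym list \<Rightarrow> sym list \<Rightarrow> bool" and twoA_step :: "sym \<Rightarrow> sym list \<Rightarrow> sym list \<Rightarrow> bool"
  and twoB :: "sym list \<Rightarrow> sym list \<Rightarrow> bool" and twoB_step :: "sym \<Rightarrow> sym list \<Rightarrow> sym list \<Rightarrow> bool" where
  "twoA (x # xs) (y # ys) = twoA_step (xr x y) xs ys"
| "twoA [] ys = True"
| "twoA (x # xs) [] = True"
| "twoA_step x xs ys = (if wt x = 2 then twoB xs ys else twoA xs ys)"
| "twoB (x # xs) (y # ys) = twoB_step (xr x y) xs ys"
| "twoB [] ys = True"
| "twoB (x # xs) [] = True"
| "twoB_step x xs ys = (wt x \<noteq> 2 \<and> twoB xs ys)"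
  by pat_completeness auto
termination
  by (relation "measure (\<lambda>x. case x of Inl (Inl (xs, ys)) \<Rightarrow> 2 * length xs | Inl (Inr (x, xs, ys)) \<Rightarrow> Suc (2 * length xs)
     | Inr (Inl (xs, ys)) \<Rightarrow> 2 * length xs | Inr (Inr (x, xs, ys)) \<Rightarrow> Suc (2 * length xs))") auto
declare twoA_step.simps [simp del] twoB_step.simps [simp del]
lemma two_step_table:
  "twoA_step s0 xs ys = twoA xs ys"
  "twoA_step s1 xs ys = twoB xs ys"
  "twoA_step s2 xs ys = twoB xs ys"
  "twoA_step s3 xs ys = twoB xs ys"
  "twoA_step s4 xs ys = twoB xs ys"
  "twoA_step s5 xs ys = twoB xs ys"
  "twoA_step s6 xs ys = twoB xs ys"
  "twoA_step s7 xs ys = twoA xs ys"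
  "twoA_step s8 xs ys = twoB xs ys"
  "twoA_step s9 xs ys = twoB xs ys"
  "twoA_step sa xs ys = twoB xs ys"
  "twoA_step sb xs ys = twoA xs ys"
  "twoA_step sc xs ys = twoB xs ys"
  "twoA_step sd xs ys = twoA xs ys"
  "twoA_step se xs ys = twoA xs ys"
  "twoA_step sf xs ys = twoA xs ys"
  "twoB_step s0 xs ys = twoB xs ys"
  "twoB_step s1 xs ys = False"
  "twoB_step s2 xs ys = False"
  "twoB_step s3 xs ys = False"
  "twoB_step s4 xs ys = False"
  "twoB_step s5 xs ys = False"
  "twoB_step s6 xs ys = False"
  "twoB_step s7 xs ys = twoB xs ys"
  "twoB_step s8 xs ys = False"
  "twoB_step s9 xs ys = False"
  "twoB_step sa xs ys = False"
  "twoB_step sb xs ys = twoB xs ys"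
  "twoB_step sc xs ys = False"
  "twoB_step sd xs ys = twoB xs ys"
  "twoB_step se xs ys = twoB xs ys"
  "twoB_step sf xs ys = twoB xs ys"
  by (simp_all add: twoA_step.simps twoB_step.simps)

text \<open>The comparison is evaluated in unary so that it fails as soon as the bound is exhausted.\<close>
fun cost_le :: "nat \<Rightarrow> bool list \<Rightarrow> sym list \<Rightarrow> bool" where
  "cost_le R fs xs = (vcost fs xs \<le> R)"

fun sub_le :: "nat \<Rightarrow> nat \<Rightarrow> bool list \<Rightarrow> sym list \<Rightarrow> bool" where
  "sub_le c R fs xs = (c + vcost fs xs \<le> R)"

lemma cost_le_rules:
  "cost_le R (f # fs) (x # xs) = sub_le (cost f x) R fs xs"
  "cost_le R [] xs = True"
  "sub_le 0 R fs xs = cost_le R fs xs"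
  "sub_le (Suc c) 0 fs xs = False"
  "sub_le (Suc c) (Suc R) fs xs = sub_le c R fs xs"
  by simp_all

lemma cost_table:
  "cost True s0 = (Suc (Suc (Suc (Suc (Suc 0)))))" "cost True s1 = (Suc (Suc (Suc 0)))" "cost True s2 = (Suc (Suc (Suc 0)))" "cost True s3 = (Suc (Suc (Suc 0)))" "cost True s4 = (Suc (Suc (Suc 0)))" "cost True s5 = (Suc (Suc (Suc 0)))" "cost True s6 = (Suc (Suc (Suc 0)))" "cost True s7 = (Suc 0)" "cost True s8 = (Suc (Suc (Suc 0)))" "cost True s9 = (Suc (Suc (Suc 0)))" "cost True sa = (Suc (Suc (Suc 0)))" "cost True sb = (Suc 0)" "cost True sc = (Suc (Suc (Suc 0)))" "cost True sd = (Suc 0)" "cost True se = (Suc 0)" "cost True sf = (Suc 0)"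
  "cost False x = wt x"
  by simp_all

text \<open>All flag vectors from the list give cost larger than the bound.\<close>
fun far :: "bool list list \<Rightarrow> nat \<Rightarrow> sym list \<Rightarrow> bool" where
  "far [] R v = True" | "far (f # fs) R v = (\<not> cost_le R f v \<and> far fs R v)"

fun evs :: "nat \<Rightarrow> sym list list \<Rightarrow> sym list \<Rightarrow> bool"
  and evs_step :: "bool \<Rightarrow> nat \<Rightarrow> sym list \<Rightarrow> sym list list \<Rightarrow> sym list \<Rightarrow> bool" where
  "evs R [] s = True"
| "evs R (y # ys) s = evs_step (low R s y) R y ys s"
| "evs_step False R y ys s = evs R ys s"
| "evs_step True R y ys s = (far e8 R (vx s y) \<and> evs R ys s)"

fun tts :: "sym list list \<Rightarrow> sym list \<Rightarrow> bool"
  and tts_step :: "bool \<Rightarrow> sym list \<Rightarrow> sym list list \<Rightarrow> sym list \<Rightarrow> bool" where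
  "tts [] s = True"
| "tts (y # ys) s = tts_step (twoA s y) y ys s"
| "tts_step False y ys s = tts ys s"
| "tts_step True y ys s = (far tetrads 6 (vx s y) \<and> tts ys s)"

datatype pos = Pos "sym list list" "sym list list"

text \<open>If \<open>h\<close> pairs of the weight allowance 6 of the first block are unused, then total weight at most 12 leaves at most \<open>6 + 2 * h\<close> for the opposite block.\<close>
fun rad :: "nat \<Rightarrow> nat" where "rad 0 = 6" | "rad (Suc h) = Suc (Suc (rad h))"

text \<open>Depth-first enumeration of all linear combinations of the remaining rows with symbol coefficients of total weight at most twice the allowance; the last coefficient of weight 2 is tried in one batch.\<close>
function dE :: "nat \<Rightarrow> pos list \<Rightarrow> sym list \<Rightarrow> bool"
  and rE :: "nat \<Rightarrow> sym list list \<Rightarrow> pos list \<Rightarrow> sym list \<Rightarrow> bool" where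
  "dE h [] s = evs (rad h) [zv] s"
| "dE 0 (p # ps) s = evs (rad 0) [zv] s"
| "dE (Suc 0) (Pos V4 V2 # ps) s = (dE (Suc 0) ps s \<and> evs (rad 0) V2 s)"
| "dE (Suc (Suc h)) (Pos V4 V2 # ps) s = (dE (Suc (Suc h)) ps s \<and> rE (Suc h) V2 ps s \<and> rE h V4 ps s)"
| "rE 0 ys ps s = evs (rad 0) ys s"
| "rE (Suc h) [] ps s = True"
| "rE (Suc h) (y # ys) ps s = (dE (Suc h) ps (vx s y) \<and> rE (Suc h) ys ps s)"
  by pat_completeness auto
termination
  by (relation "measures [\<lambda>x. case x of Inl (h, ps, s) \<Rightarrow> 2 * length ps | Inr (h, ys, ps, s) \<Rightarrow> Suc (2 * length ps),
    \<lambda>x. case x of Inl (h, ps, s) \<Rightarrow> 0 | Inr (h, ys, ps, s) \<Rightarrow> length ys]") auto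

text \<open>The same enumeration where the first nonzero coefficient is normalised by rotation.\<close>
fun nE :: "nat \<Rightarrow> pos list \<Rightarrow> bool" where
  "nE h [] = True"
| "nE (Suc (Suc h)) (Pos V4 V2 # ps) = (nE (Suc (Suc h)) ps \<and> rE (Suc h) [V2 ! 0, V2 ! 5] ps zv \<and> rE h [V4 ! 0] ps zv)"
| "nE h ps = False"

text \<open>What is to be excluded at the end of an enumeration along a tetrad: flags of any kind, or flags forming a tetrad.\<close>
datatype kind = T4 | T6
fun fin :: "kind \<Rightarrow> sym list list \<Rightarrow> sym list \<Rightarrow> bool" where
  "fin T4 ys s = evs (rad (Suc 0)) ys s" | "fin T6 ys s = tts ys s"

text \<open>Combinations in which all remaining coefficients have weight 4.\<close>
fun dY :: "kind \<Rightarrow> sym list list \<Rightarrow> pos list \<Rightarrow> sym list \<Rightarrow> bool" where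
  "dY k ys [] s = fin k ys s"
| "dY k [] (p # ps) s = True"
| "dY k (y # ys) (Pos V4 V2 # ps) s = (dY k V4 ps (vx s y) \<and> dY k ys (Pos V4 V2 # ps) s)"

text \<open>Combinations in which exactly one remaining coefficient is nonzero, of weight 2.\<close>
fun dZ :: "pos list \<Rightarrow> sym list \<Rightarrow> bool" where
  "dZ [] s = True" | "dZ (Pos V4 V2 # ps) s = (tts V2 s \<and> dZ ps s)"

text \<open>Combinations over the rows in a tetrad and over the rows outside of it, where exactly one coefficient deviates from the cheapest choice.\<close>
fun dX :: "sym list list \<Rightarrow> sym list list \<Rightarrow> pos list \<Rightarrow> pos list \<Rightarrow> sym list \<Rightarrow> bool"
  and rX :: "sym list list \<Rightarrow> pos list \<Rightarrow> pos list \<Rightarrow> sym list \<Rightarrow> bool" where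
  "dX V4 V2 ps es s = (dY T6 V2 ps s \<and> rX V4 ps es s)"
| "rX [] ps es s = True"
| "rX (y # ys) [] es s = (dZ es (vx s y) \<and> rX ys [] es s)"
| "rX (y # ys) (Pos V4 V2 # ps) es s = (dX V4 V2 ps es (vx s y) \<and> rX ys (Pos V4 V2 # ps) es s)"

text \<open>The entries at the positions of a tetrad, or at the other positions.\<close>
fun sel :: "bool \<Rightarrow> bool list \<Rightarrow> 'b list \<Rightarrow> 'b list" where
  "sel b (True # fs) (p # ps) = (if b then p # sel b fs ps else sel b fs ps)"
| "sel b (False # fs) (p # ps) = (if b then sel b fs ps else p # sel b fs ps)"
| "sel b fs ps = []"

fun t4 where "t4 (Pos V4 V2 # ps) = dY T4 [V4 ! 0] ps zv" | "t4 [] = True"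
fun t6 where "t6 (Pos V4 V2 # ps) es = dX [V4 ! 0] [V2 ! 0, V2 ! 5] ps es zv" | "t6 [] es = True"
fun t4s where "t4s [] ps = True" | "t4s (t # ts) ps = (t4 (sel True t ps) \<and> t4s ts ps)"
fun t6s where "t6s [] ps = True" | "t6s (t # ts) ps = (t6 (sel True t ps) (sel False t ps) \<and> t6s ts ps)"

fun orbit :: "nat \<Rightarrow> sym list \<Rightarrow> sym list list" where
  "orbit 0 v = []" | "orbit (Suc n) v = v # orbit n (rv v)"

definition mkpos where "mkpos v = Pos (orbit 5 v) (orbit 5 (vx v (rv v)) @ orbit 5 (vx v (rv (rv v))))"

fun chkL where "chkL ps = (nE 3 ps \<and> t4s tetrads ps \<and> t6s tetrads ps)"
fun chkR where "chkR ps = (nE 3 ps \<and> t4s tetrads ps)"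

fun heads where "heads [] = []" | "heads ((x # xs) # rs) = x # heads rs" | "heads ([] # rs) = heads rs"
fun tails where "tails [] = []" | "tails ((x # xs) # rs) = xs # tails rs" | "tails ([] # rs) = tails rs"
fun dual_n where "dual_n 0 A = []" | "dual_n (Suc n) A = map conj (heads A) # dual_n n (tails A)"
text \<open>The conjugate transpose.\<close>
definition dual where "dual A = dual_n 8 A"

lemma nums: "(1::nat) = Suc 0" "(2::nat) = Suc (Suc 0)" "(4::nat) = Suc (Suc (Suc (Suc 0)))" "(7::nat) = Suc (Suc (Suc (Suc (Suc (Suc (Suc 0))))))" "(6::nat) = Suc (Suc (Suc (Suc (Suc (Suc 0)))))" "(5::nat) = Suc (Suc (Suc (Suc (Suc 0))))" "(3::nat) = Suc (Suc (Suc 0))" "(8::nat) = Suc (Suc (Suc (Suc (Suc (Suc (Suc (Suc 0)))))))"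
  by simp_all
text \<open>Multiplication in the field with 16 elements; the symbol written se is the unit.\<close>
primrec mu :: "sym \<Rightarrow> sym \<Rightarrow> sym" where
  "mu s0 x = s0"
| "mu s1 x = xr x (rot (rot (rot (rot x))))"
| "mu s2 x = xr (rot x) (rot (rot (rot (rot x))))"
| "mu s3 x = xr x (rot x)"
| "mu s4 x = xr (rot (rot x)) (rot (rot (rot (rot x))))"
| "mu s5 x = xr x (rot (rot x))"
| "mu s6 x = xr (rot x) (rot (rot x))"
| "mu s7 x = rot (rot (rot x))"
| "mu s8 x = xr (rot (rot (rot x))) (rot (rot (rot (rot x))))"
| "mu s9 x = xr x (rot (rot (rot x)))"
| "mu sa x = xr (rot x) (rot (rot (rot x)))"
| "mu sb x = rot (rot x)"
| "mu sc x = xr (rot (rot x)) (rot (rot (rot x)))"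
| "mu sd x = rot x"
| "mu se x = x"
| "mu sf x = rot (rot (rot (rot x)))"

fun n2 :: "sym list \<Rightarrow> nat" where "n2 [] = 0" | "n2 (x # xs) = (if wt x = 2 then Suc (n2 xs) else n2 xs)"
fun n4 :: "sym list \<Rightarrow> nat" where "n4 [] = 0" | "n4 (x # xs) = (if wt x = 4 then Suc (n4 xs) else n4 xs)"

text \<open>Numbers of symbols of weight 2 and of weight 4.\<close>
definition patt :: "nat \<Rightarrow> nat \<Rightarrow> sym list \<Rightarrow> bool" where "patt m n v \<longleftrightarrow> n2 v = m \<and> n4 v = n"
definition patt_step :: "nat \<Rightarrow> nat \<Rightarrow> nat \<Rightarrow> sym list \<Rightarrow> bool" where
  "patt_step w m n v \<longleftrightarrow> (if w = 2 then Suc (n2 v) else n2 v) = m \<and> (if w = 4 then Suc (n4 v) else n4 v) = n"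

lemma patt_rules:
  "patt 0 0 [] = True" "patt (Suc m) n [] = False" "patt m (Suc n) [] = False"
  "patt m n (x # xs) = patt_step (wt x) m n xs"
  "patt_step 0 m n xs = patt m n xs"
  "patt_step (Suc (Suc 0)) 0 n xs = False" "patt_step (Suc (Suc 0)) (Suc m) n xs = patt m n xs"
  "patt_step (Suc (Suc (Suc (Suc 0)))) m 0 xs = False" "patt_step (Suc (Suc (Suc (Suc 0)))) m (Suc n) xs = patt m n xs"
  by (auto simp: patt_def patt_step_def)

text \<open>Searches for a combination of rows with given numbers of coefficients of weight 2 and 4, such that the resulting vector has given numbers of symbols of weight 2 and 4.\<close>
function ex :: "nat \<Rightarrow> nat \<Rightarrow> nat \<Rightarrow> nat \<Rightarrow> pos list \<Rightarrow> sym list \<Rightarrow> bool"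
  and any :: "nat \<Rightarrow> nat \<Rightarrow> nat \<Rightarrow> nat \<Rightarrow> sym list list \<Rightarrow> pos list \<Rightarrow> sym list \<Rightarrow> bool" where
  "ex 0 0 m n ps s = patt m n s"
| "ex (Suc a) b m n [] s = False"
| "ex 0 (Suc b) m n [] s = False"
| "ex (Suc a) 0 m n (Pos V4 V2 # ps) s = (ex (Suc a) 0 m n ps s \<or> any a 0 m n V2 ps s)"
| "ex 0 (Suc b) m n (Pos V4 V2 # ps) s = (ex 0 (Suc b) m n ps s \<or> any 0 b m n V4 ps s)"
| "ex (Suc a) (Suc b) m n (Pos V4 V2 # ps) s = (ex (Suc a) (Suc b) m n ps s \<or> any a (Suc b) m n V2 ps s \<or> any (Suc a) b m n V4 ps s)"
| "any a b m n [] ps s = False"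
| "any a b m n (y # ys) ps s = (ex a b m n ps (vx s y) \<or> any a b m n ys ps s)"
  by pat_completeness auto
termination
  by (relation "measures [\<lambda>x. case x of Inl (a, b, m, n, ps, s) \<Rightarrow> 2 * length ps | Inr (a, b, m, n, ys, ps, s) \<Rightarrow> Suc (2 * length ps),
    \<lambda>x. case x of Inl (a, b, m, n, ps, s) \<Rightarrow> 0 | Inr (a, b, m, n, ys, ps, s) \<Rightarrow> length ys]") auto

fun exn :: "nat \<Rightarrow> nat \<Rightarrow> nat \<Rightarrow> nat \<Rightarrow> pos list \<Rightarrow> bool" where
  "exn a b m n [] = False"
| "exn 0 0 m n (p # ps) = False"
| "exn (Suc a) 0 m n (Pos V4 V2 # ps) = (exn (Suc a) 0 m n ps \<or> any a 0 m n [V2 ! 0, V2 ! 5] ps zv)"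
| "exn 0 (Suc b) m n (Pos V4 V2 # ps) = (exn 0 (Suc b) m n ps \<or> any 0 b m n [V4 ! 0] ps zv)"
| "exn (Suc a) (Suc b) m n (Pos V4 V2 # ps) = (exn (Suc a) (Suc b) m n ps \<or> any a (Suc b) m n [V2 ! 0, V2 ! 5] ps zv \<or> any (Suc a) b m n [V4 ! 0] ps zv)"

text \<open>There is an even word with prescribed numbers of cycles of weight 2 and 4 on one block and on the other; the blocks may be interchanged.\<close>
definition shows_pattern :: "nat \<times> nat \<times> nat \<times> nat \<Rightarrow> sym list list \<Rightarrow> bool" where
  "shows_pattern = (\<lambda>(a, b, m, n) A. exn a b m n (map mkpos A) \<or> exn a b m n (map mkpos (dual A)))"

text \<open>The row vector times matrix product over the field with 16 elements.\<close>
fun enc :: "sym list \<Rightarrow> sym list list \<Rightarrow> sym list" where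
  "enc (u # us) (r # rs) = vx (map (mu u) r) (enc us rs)" | "enc us rs = zv"
fun dot :: "sym list \<Rightarrow> sym list \<Rightarrow> sym" where
  "dot (r # rs) (y # ys) = xr (mu y (conj r)) (dot rs ys)" | "dot rs ys = s0"
fun two_parity :: "sym list \<Rightarrow> bool" where
  "two_parity [] = False" | "two_parity (x # xs) = (wt x = 2 \<longleftrightarrow> \<not> two_parity xs)"

lemma two_parity_rules:
  "two_parity [] = False"
  "two_parity (s0 # xs) = two_parity xs"
  "two_parity (s1 # xs) = (\<not> two_parity xs)"
  "two_parity (s2 # xs) = (\<not> two_parity xs)"
  "two_parity (s3 # xs) = (\<not> two_parity xs)"
  "two_parity (s4 # xs) = (\<not> two_parity xs)"
  "two_parity (s5 # xs) = (\<not> two_parity xs)"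
  "two_parity (s6 # xs) = (\<not> two_parity xs)"
  "two_parity (s7 # xs) = two_parity xs"
  "two_parity (s8 # xs) = (\<not> two_parity xs)"
  "two_parity (s9 # xs) = (\<not> two_parity xs)"
  "two_parity (sa # xs) = (\<not> two_parity xs)"
  "two_parity (sb # xs) = two_parity xs"
  "two_parity (sc # xs) = (\<not> two_parity xs)"
  "two_parity (sd # xs) = two_parity xs"
  "two_parity (se # xs) = two_parity xs"
  "two_parity (sf # xs) = two_parity xs"
  by simp_all

text \<open>A basis of the vectors of eight symbols over the field with two elements.\<close>
definition units :: "sym list list" where "units = [
  [s1,s0,s0,s0,s0,s0,s0,s0],
  [s2,s0,s0,s0,s0,s0,s0,s0],
  [s4,s0,s0,s0,s0,s0,s0,s0],
  [s8,s0,s0,s0,s0,s0,s0,s0],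
  [s0,s1,s0,s0,s0,s0,s0,s0],
  [s0,s2,s0,s0,s0,s0,s0,s0],
  [s0,s4,s0,s0,s0,s0,s0,s0],
  [s0,s8,s0,s0,s0,s0,s0,s0],
  [s0,s0,s1,s0,s0,s0,s0,s0],
  [s0,s0,s2,s0,s0,s0,s0,s0],
  [s0,s0,s4,s0,s0,s0,s0,s0],
  [s0,s0,s8,s0,s0,s0,s0,s0],
  [s0,s0,s0,s1,s0,s0,s0,s0],
  [s0,s0,s0,s2,s0,s0,s0,s0],
  [s0,s0,s0,s4,s0,s0,s0,s0],
  [s0,s0,s0,s8,s0,s0,s0,s0],
  [s0,s0,s0,s0,s1,s0,s0,s0],
  [s0,s0,s0,s0,s2,s0,s0,s0],
  [s0,s0,s0,s0,s4,s0,s0,s0],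
  [s0,s0,s0,s0,s8,s0,s0,s0],
  [s0,s0,s0,s0,s0,s1,s0,s0],
  [s0,s0,s0,s0,s0,s2,s0,s0],
  [s0,s0,s0,s0,s0,s4,s0,s0],
  [s0,s0,s0,s0,s0,s8,s0,s0],
  [s0,s0,s0,s0,s0,s0,s1,s0],
  [s0,s0,s0,s0,s0,s0,s2,s0],
  [s0,s0,s0,s0,s0,s0,s4,s0],
  [s0,s0,s0,s0,s0,s0,s8,s0],
  [s0,s0,s0,s0,s0,s0,s0,s1],
  [s0,s0,s0,s0,s0,s0,s0,s2],
  [s0,s0,s0,s0,s0,s0,s0,s4],
  [s0,s0,s0,s0,s0,s0,s0,s8]]"

text \<open>On basis vectors: the matrix is unitary, and it preserves the weight modulo 4.\<close>
definition unit_ok :: "sym list list \<Rightarrow> sym list \<Rightarrow> bool" where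
  "unit_ok A u \<longleftrightarrow> map (\<lambda>r. dot r (enc u A)) A = u \<and> two_parity u = two_parity (enc u A)"

definition square8 :: "sym list list \<Rightarrow> bool" where
  "square8 A \<longleftrightarrow> map length A = [8,8,8,8,8,8,8,8]"

lemmas crules = simp_thms if_True if_False xr_table rot.simps conj.simps wt.simps vx.simps rv_def list.map zv_def e8_def tetrads_def
  low.simps low_step_table twoA.simps twoB.simps two_step_table cost_le_rules cost_table far.simps evs.simps evs_step.simps
  tts.simps tts_step.simps rad.simps dE.simps rE.simps nE.simps fin.simps dY.simps dZ.simps dX.simps rX.simps sel.simps
  t4.simps t6.simps t4s.simps t6s.simps orbit.simps mkpos_def append.simps nth_Cons_0 nth_Cons_Suc chkL.simps chkR.simps heads.simps tails.simps dual_n.simps dual_def nums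
  mu.simps patt_rules ex.simps any.simps exn.simps shows_pattern_def split_conv enc.simps dot.simps two_parity_rules units_def unit_ok_def square8_def
  list.size list.pred_inject list.inject add_Suc_right add_0_right nat.inject nat.distinct

section \<open>Algebra of symbols and soundness of the enumerations\<close>

declare xr_table [simp]

lemma xr_comm: "xr x y = xr y x" by (cases x; cases y; simp)
lemma xr_s0 [simp]: "xr s0 x = x" "xr x s0 = x" by (cases x; simp)+
lemma xr_self [simp]: "xr x x = s0" by (cases x; simp)
lemma rot_xr: "rot (xr x y) = xr (rot x) (rot y)" by (cases x; cases y; simp)

fun xor_list :: "bool list \<Rightarrow> bool list \<Rightarrow> bool list" where
  "xor_list (f # fs) (g # gs) = (f \<noteq> g) # xor_list fs gs" | "xor_list _ _ = []"

lemma length_xor_list [simp]: "length (xor_list f g) = min (length f) (length g)"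
  by (induction f g rule: xor_list.induct) auto
lemma nth_xor_list: "i < length f \<Longrightarrow> i < length g \<Longrightarrow> xor_list f g ! i = (f ! i \<noteq> g ! i)"
  by (induction f g arbitrary: i rule: xor_list.induct) (auto simp: nth_Cons split: nat.split)

lemma length_cyc [simp]: "length (cyc x) = 5" by (cases x; simp)
lemma cyc_xr: "cyc (xr x y) = xor_list (cyc x) (cyc y)" by (cases x; cases y; simp)

lemma has_xr: "a < 5 \<Longrightarrow> has (xr x y) a = (has x a \<noteq> has y a)"
  by (simp add: has_def cyc_xr nth_xor_list)

lemma has_eqI: "(\<And>a. a < 5 \<Longrightarrow> has x a = has y a) \<Longrightarrow> x = y"
proof -
  assume h: "\<And>a. a < 5 \<Longrightarrow> has x a = has y a"
  have "cyc x = cyc y"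
  proof (rule nth_equalityI)
    show "length (cyc x) = length (cyc y)" by (cases x; cases y; simp)
    fix i assume "i < length (cyc x)"
    then show "cyc x ! i = cyc y ! i" using h[of i] by (simp add: has_def)
  qed
  then show ?thesis by (cases x; cases y; simp)
qed

lemma xr_assoc: "xr (xr x y) z = xr x (xr y z)" by (rule has_eqI) (auto simp: has_xr)
lemma xr_left_comm: "xr x (xr y z) = xr y (xr x z)" by (metis xr_assoc xr_comm)
lemma xr_cancel [simp]: "xr x (xr x y) = y" by (simp add: xr_assoc[symmetric])
lemmas xr_ac = xr_assoc xr_comm xr_left_comm

lemma rot4: "rot (rot (rot (rot x))) = xr x (xr (rot x) (xr (rot (rot x)) (rot (rot (rot x)))))"
  by (cases x; simp)
lemma rot5: "rot (rot (rot (rot (rot x)))) = x" by (cases x; simp)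

lemma mu_s0 [simp]: "mu u s0 = s0" by (cases u; simp)
lemma mu_xr_left: "mu (xr u v) x = xr (mu u x) (mu v x)"
  by (cases u; cases v; simp add: rot4 xr_ac)
lemma mu_rot_left: "mu (rot u) x = rot (mu u x)" by (cases u; simp add: rot_xr rot5 xr_ac)
lemma mu_comm: "mu u x = mu x u" by (cases u; cases x; simp)

definition b01 :: "bool \<Rightarrow> int" where "b01 b = (if b then 1 else 0)"

text \<open>The trace form: the parity of the intersection of two symbols.\<close>
definition tp :: "sym \<Rightarrow> sym \<Rightarrow> bool" where
  "tp x y \<longleftrightarrow> odd (\<Sum>a<5. b01 (has x a) * b01 (has y a))"

lemma lessThan_5: "{..<5::nat} = {0,1,2,3,4}" by auto

lemma has_s0: "a < 5 \<Longrightarrow> \<not> has s0 a" using has_xr[of a s0 s0] by simp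

lemma tp_comm: "tp x y = tp y x" by (simp add: tp_def mult.commute)
lemma tp_s0 [simp]: "tp s0 x = False" "tp x s0 = False"
proof -
  have "(\<Sum>a<5. b01 (has s0 a) * b01 (has x a)) = 0" by (rule sum.neutral) (simp add: has_s0 b01_def)
  then show "tp s0 x = False" by (simp add: tp_def)
  then show "tp x s0 = False" by (simp only: tp_comm[of x])
qed
lemma tp_xr_left: "tp (xr x y) z = (tp x z \<noteq> tp y z)"
proof -
  let ?s = "\<lambda>x. \<Sum>a<5. b01 (has x a) * b01 (has z a)"
  let ?t = "\<Sum>a<5. b01 (has x a) * b01 (has y a) * b01 (has z a)"
  have "?s (xr x y) = (\<Sum>a<5. b01 (has x a) * b01 (has z a) + b01 (has y a) * b01 (has z a)
      - 2 * (b01 (has x a) * b01 (has y a) * b01 (has z a)))"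
    by (rule sum.cong) (auto simp: has_xr b01_def)
  also have "\<dots> = ?s x + ?s y - 2 * ?t" by (simp add: sum.distrib sum_subtractf sum_distrib_left)
  finally show ?thesis unfolding tp_def by simp
qed
lemma tp_xr_right: "tp z (xr x y) = (tp z x \<noteq> tp z y)" by (simp add: tp_comm[of z] tp_xr_left)
lemma tp_rot: "tp (rot x) y = tp x (rot (rot (rot (rot y))))"
  by (cases x; cases y; simp add: tp_def has_def lessThan_5 b01_def)
text \<open>Multiplication by a field element is adjoint to multiplication by its conjugate.\<close>
lemma tp_mu: "tp (mu u r) v = tp u (mu v (conj r))"
proof -
  have "tp (mu r u) v = tp u (mu (conj r) v)"
    by (cases r; simp add: tp_xr_left tp_xr_right tp_rot rot5; auto)
  then show ?thesis by (simp only: mu_comm)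
qed

text \<open>Weights of even sets are 0, 2 or 4, so the weight modulo 4 is a quadratic form with the trace form as polarisation.\<close>
lemma two_xr: "(wt (xr x y) = 2) = (((wt x = 2) \<noteq> (wt y = 2)) \<noteq> tp x y)"
  by (cases x; cases y; simp add: tp_def has_def lessThan_5 b01_def)

lemma wt_rot [simp]: "wt (rot x) = wt x" by (cases x; simp)
lemma cost_rot [simp]: "cost f (rot x) = cost f x" by (cases f) auto


lemma length_vx [simp]: "length (vx x y) = min (length x) (length y)"
  by (induction x y rule: vx.induct) auto
lemma nth_vx: "i < length x \<Longrightarrow> i < length y \<Longrightarrow> vx x y ! i = xr (x ! i) (y ! i)"
  by (induction x y arbitrary: i rule: vx.induct) (auto simp: nth_Cons split: nat.split)
lemma rv_Cons: "rv (x # xs) = rot x # rv xs" and rv_Nil: "rv [] = []" by (simp_all add: rv_def)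
lemma length_rv [simp]: "length (rv x) = length x" by (simp add: rv_def)
lemma length_zv [simp]: "length zv = 8" by (simp add: zv_def)
lemma zv_replicate: "zv = replicate 8 s0" by (simp add: zv_def numeral_eq_Suc)

lemma vx_Nil_right [simp]: "vx xs [] = []" by (cases xs) simp_all
lemma vx_comm: "vx x y = vx y x" by (induction x y rule: vx.induct) (auto simp: xr_comm) 
lemma vx_assoc: "vx (vx x y) z = vx x (vx y z)"
proof (induction x y arbitrary: z rule: vx.induct)
  case (1 x xs y ys) then show ?case by (cases z) (auto simp: xr_assoc)
next
  case (3 x xs) then show ?case by (cases z) auto
qed auto
lemma vx_left_comm: "vx x (vx y z) = vx y (vx x z)" by (metis vx_assoc vx_comm)
lemmas vx_ac = vx_assoc vx_comm vx_left_comm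

lemma vx_replicate: "vx (replicate n s0) y = (if length y \<le> n then y else take n y)"
proof (induction n arbitrary: y)
  case 0 then show ?case by (cases y) auto
next
  case (Suc n) then show ?case by (cases y) auto
qed
lemma vx_zv [simp]: "length y = 8 \<Longrightarrow> vx zv y = y" "length y = 8 \<Longrightarrow> vx y zv = y"
  by (simp add: zv_replicate vx_replicate) (metis vx_comm zv_replicate vx_replicate order_refl)
lemma rv_vx: "rv (vx x y) = vx (rv x) (rv y)"
  unfolding rv_def by (induction x y rule: vx.induct) (auto simp: rot_xr)
lemma rv_zv [simp]: "rv zv = zv" by (simp add: zv_def rv_def)
lemma map_mu_s0: "map (mu s0) r = replicate (length r) s0" by (induction r) auto
lemma map_mu_s0_8 [simp]: "length r = 8 \<Longrightarrow> map (mu s0) r = zv" by (simp add: map_mu_s0 zv_replicate)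
lemma map_mu_xr: "map (mu (xr u v)) r = vx (map (mu u) r) (map (mu v) r)"
  by (induction r) (auto simp: mu_xr_left)
lemma map_mu_rot: "map (mu (rot u)) r = rv (map (mu u) r)" by (simp add: rv_def mu_rot_left)

definition rows8 :: "sym list list \<Rightarrow> bool" where "rows8 A \<longleftrightarrow> (\<forall>r\<in>set A. length r = 8)"
lemma rows8_Cons [simp]: "rows8 (r # rs) \<longleftrightarrow> length r = 8 \<and> rows8 rs" "rows8 []" by (auto simp: rows8_def)

lemma length_enc [simp]: "rows8 A \<Longrightarrow> length (enc us A) = 8"
  by (induction us A rule: enc.induct) auto

lemma enc_s0 [simp]: "length r = 8 \<Longrightarrow> rows8 rs \<Longrightarrow> enc (s0 # us) (r # rs) = enc us rs"
  by (simp add: map_mu_s0 zv_replicate[symmetric])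

lemma enc_vx: "rows8 A \<Longrightarrow> length x = length A \<Longrightarrow> length y = length A \<Longrightarrow> enc (vx x y) A = vx (enc x A) (enc y A)"
proof (induction A arbitrary: x y)
  case (Cons r A)
  then obtain u us v vs where "x = u # us" "y = v # vs" by (metis length_Suc_conv)
  with Cons show ?case by (simp add: map_mu_xr vx_ac)
qed simp

lemma enc_rot: "rows8 A \<Longrightarrow> enc (rv x) A = rv (enc x A)"
proof (induction x A rule: enc.induct)
  case (1 u us r rs) then show ?case by (simp add: rv_Cons rv_vx map_mu_rot)
qed (simp_all add: rv_Cons rv_Nil)

lemma enc_zero: "rows8 A \<Longrightarrow> set us \<subseteq> {s0} \<Longrightarrow> enc us A = zv"
  by (induction us A rule: enc.induct) (auto simp: map_mu_s0 zv_replicate[symmetric])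

fun ipar :: "sym list \<Rightarrow> sym list \<Rightarrow> bool" where
  "ipar (x # xs) (y # ys) = (tp x y \<noteq> ipar xs ys)" | "ipar _ _ = False"

lemma ipar_vx: "length x = length z \<Longrightarrow> length y = length z \<Longrightarrow> ipar (vx x y) z = (ipar x z \<noteq> ipar y z)"
proof (induction z arbitrary: x y)
  case (Cons c z)
  then obtain u us v vs where "x = u # us" "y = v # vs" by (metis length_Suc_conv)
  with Cons show ?case by (auto simp: tp_xr_left)
qed simp

lemma ipar_zero: "ipar (replicate n s0) y = False"
proof (induction n arbitrary: y)
  case (Suc n) then show ?case by (cases y) auto
qed simp

lemma ipar_mu: "length r = length y \<Longrightarrow> ipar (map (mu u) r) y = tp u (dot r y)"
proof (induction r arbitrary: y)
  case (Cons a r) then show ?case by (cases y) (auto simp: tp_mu tp_xr_right)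
qed simp

text \<open>The adjoint of a matrix with respect to the trace form is its conjugate transpose.\<close>
lemma ipar_enc: "rows8 A \<Longrightarrow> length x = length A \<Longrightarrow> length y = 8 \<Longrightarrow> ipar (enc x A) y = ipar x (map (\<lambda>r. dot r y) A)"
proof (induction A arbitrary: x)
  case (Cons r A)
  then obtain u us where "x = u # us" by (metis length_Suc_conv)
  with Cons show ?case by (simp add: ipar_vx ipar_mu)
qed (simp add: zv_replicate ipar_zero)

lemma dot_vx: "length x = length r \<Longrightarrow> length y = length r \<Longrightarrow> dot r (vx x y) = xr (dot r x) (dot r y)"
proof (induction r arbitrary: x y)
  case (Cons c r)
  then obtain u us v vs where "x = u # us" "y = v # vs" by (metis length_Suc_conv)
  with Cons show ?case by (simp add: mu_xr_left xr_ac)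
qed simp

lemma two_parity_vx: "length x = length y \<Longrightarrow> two_parity (vx x y) = ((two_parity x \<noteq> two_parity y) \<noteq> ipar x y)"
  by (induction x y rule: list_induct2) (auto simp: two_xr)

lemma two_parity_zv [simp]: "two_parity zv = False" by (simp add: zv_def)

definition unit :: "nat \<Rightarrow> sym \<Rightarrow> sym list" where "unit i u = (replicate 8 s0)[i := u]"

lemma length_unit [simp]: "length (unit i u) = 8" by (simp add: unit_def)

text \<open>Properties that are preserved under sums need to be checked on basis vectors only.\<close>
lemma units_span:
  assumes units: "\<And>u. u \<in> set units \<Longrightarrow> P u" and zero: "P zv"
    and closed: "\<And>x y. length x = 8 \<Longrightarrow> length y = 8 \<Longrightarrow> P x \<Longrightarrow> P y \<Longrightarrow> P (vx x y)" and x: "length x = 8"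
  shows "P x"
proof -
  have unit_vx: "unit i (xr u v) = vx (unit i u) (unit i v)" if "i < 8" for i u v
    using that by (intro nth_equalityI) (auto simp: nth_vx unit_def nth_list_update)
  have base: "P (unit i b)" if "i < 8" "b \<in> {s1, s2, s4, s8}" for i b
  proof -
    have "i = 0 \<or> i = 1 \<or> i = 2 \<or> i = 3 \<or> i = 4 \<or> i = 5 \<or> i = 6 \<or> i = 7" using that(1) by presburger
    then have "unit i b \<in> set units" using that(2)
      by (elim disjE) (auto simp: unit_def units_def numeral_eq_Suc)
    then show ?thesis by (rule units)
  qed
  have unit0: "unit i s0 = zv" for i
    unfolding unit_def zv_replicate by (rule nth_equalityI, simp, rename_tac j, case_tac "j = i") simp_all
  have u1: "P (unit i u)" if i: "i < 8" for i u
  proof -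
    have a: "P (unit i (xr v w))" if "P (unit i v)" "P (unit i w)" for v w
      unfolding unit_vx[OF i] by (rule closed) (use that in auto)
    have b: "P (unit i s1)" "P (unit i s2)" "P (unit i s4)" "P (unit i s8)" "P (unit i s0)"
      using base[OF i] zero by (auto simp: unit0)
    have c: "P (unit i (xr (xr s1 s2) (xr s4 s8)))" "P (unit i (xr s1 (xr s2 s4)))" "P (unit i (xr s1 (xr s2 s8)))"
      "P (unit i (xr s1 (xr s4 s8)))" "P (unit i (xr s2 (xr s4 s8)))" "P (unit i (xr s1 s2))" "P (unit i (xr s1 s4))"
      "P (unit i (xr s1 s8))" "P (unit i (xr s2 s4))" "P (unit i (xr s2 s8))" "P (unit i (xr s4 s8))"
      by (intro a b)+
    show ?thesis using b c by (cases u) simp_all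
  qed
  have "P (take n x @ replicate (8 - n) s0)" if "n \<le> 8" for n
    using that
  proof (induction n)
    case 0 then show ?case using zero by (simp add: zv_replicate)
  next
    case (Suc n)
    have "take (Suc n) x @ replicate (8 - Suc n) s0 = vx (take n x @ replicate (8 - n) s0) (unit n (x ! n))"
      using Suc.prems x by (intro nth_equalityI) (auto simp: nth_vx unit_def nth_append nth_list_update less_Suc_eq min_def)
    moreover have "P \<dots>" using Suc x by (intro closed u1) auto
    ultimately show ?case by simp
  qed
  from this[of 8] show ?thesis using x by simp
qed


definition gd :: "nat \<Rightarrow> sym list \<Rightarrow> bool" where "gd R v \<longleftrightarrow> (\<forall>f\<in>set e8. R < vcost f v)"
definition gt :: "sym list \<Rightarrow> bool" where "gt v \<longleftrightarrow> (\<forall>f\<in>set tetrads. 6 < vcost f v)"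

lemma far_iff: "far fs R v \<longleftrightarrow> (\<forall>f\<in>set fs. R < vcost f v)" by (induction fs) auto

lemma cost_ge: "min (wt x) (5 - wt x) \<le> cost f x" by (cases f) auto

text \<open>For every symbol the smaller one of its two costs is a lower bound for its contribution, whatever the flags are.\<close>
lemma low_sound: "\<not> low R s y \<Longrightarrow> length f = length s \<Longrightarrow> length s = length y \<Longrightarrow> R < vcost f (vx s y)"
proof (induction s arbitrary: R y f)
  case (Cons a s)
  then obtain b y' c f' where e: "y = b # y'" "f = c # f'" by (metis length_Suc_conv)
  let ?m = "min (wt (xr a b)) (5 - wt (xr a b))"
  have "\<not> (?m \<le> R \<and> low (R - ?m) s y')" using Cons.prems(1) e by (simp add: low_step.simps)
  moreover have "?m \<le> cost c (xr a b)" by (rule cost_ge)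
  moreover have "\<not> low (R - ?m) s y' \<Longrightarrow> R - ?m < vcost f' (vx s y')" using Cons e by auto
  ultimately show ?case using e by fastforce
qed simp

lemma length_e8: "f \<in> set e8 \<Longrightarrow> length f = 8" by (auto simp: e8_def)
lemma length_tetrads: "f \<in> set tetrads \<Longrightarrow> length f = 8" by (auto simp: tetrads_def)

lemma evs_sound: "evs R ys s \<Longrightarrow> length s = 8 \<Longrightarrow> y \<in> set ys \<Longrightarrow> length y = 8 \<Longrightarrow> gd R (vx s y)"
proof (induction ys)
  case (Cons z ys)
  show ?case
  proof (cases "low R s z")
    case True then show ?thesis using Cons by (auto simp: far_iff gd_def)
  next
    case False
    then have "length z = 8 \<Longrightarrow> gd R (vx s z)" using low_sound Cons.prems(2) length_e8 by (auto simp: gd_def)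
    then show ?thesis using Cons False by auto
  qed
qed simp

lemma cost_tetrad: "(if f then 1 else 0) + (if wt x = 2 then 2 else 0) \<le> cost f x"
  by (cases f; cases x; simp)

text \<open>Every complemented symbol costs at least 1, and a symbol of weight 2 costs at least 2 more than the minimum.\<close>
lemma vcost_tetrad: "length f = length v \<Longrightarrow> length (filter id f) + 2 * n2 v \<le> vcost f v"
proof (induction f v rule: list_induct2)
  case (Cons a f x v) then show ?case using cost_tetrad[of a x] by (auto split: if_splits)
qed simp

lemma twoB_sound: "\<not> twoB s y \<Longrightarrow> length s = length y \<Longrightarrow> 1 \<le> n2 (vx s y)"
  by (induction s arbitrary: y) (auto simp: length_Suc_conv twoB_step.simps Suc_length_conv split: if_splits)
lemma twoA_sound: "\<not> twoA s y \<Longrightarrow> length s = length y \<Longrightarrow> 2 \<le> n2 (vx s y)"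
proof (induction s arbitrary: y)
  case (Cons a s)
  then obtain b y' where e: "y = b # y'" by (metis length_Suc_conv)
  then show ?case using Cons twoB_sound[of s y'] by (auto simp: twoA_step.simps split: if_splits)
qed simp

lemma tetrad_weight: "f \<in> set tetrads \<Longrightarrow> length (filter id f) = 4" by (auto simp: tetrads_def)

lemma tts_sound: "tts ys s \<Longrightarrow> length s = 8 \<Longrightarrow> y \<in> set ys \<Longrightarrow> length y = 8 \<Longrightarrow> gt (vx s y)"
proof (induction ys)
  case (Cons z ys)
  show ?case
  proof (cases "twoA s z")
    case True then show ?thesis using Cons by (auto simp: far_iff gt_def)
  next
    case False
    have "length z = 8 \<Longrightarrow> gt (vx s z)"
      unfolding gt_def
    proof
      fix f assume z: "length z = 8" and f: "f \<in> set tetrads"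
      have "2 \<le> n2 (vx s z)" using twoA_sound[OF False] z Cons.prems(2) by simp
      then show "6 < vcost f (vx s z)"
        using vcost_tetrad[of f "vx s z"] length_tetrads[OF f] tetrad_weight[OF f] z Cons.prems(2) by simp
    qed
    then show ?thesis using Cons False by auto
  qed
qed simp

definition V4 :: "sym list \<Rightarrow> sym list list" where "V4 r = orbit 5 r"
definition V2 :: "sym list \<Rightarrow> sym list list" where "V2 r = orbit 5 (vx r (rv r)) @ orbit 5 (vx r (rv (rv r)))"
lemma mkpos_V: "mkpos r = Pos (V4 r) (V2 r)" by (simp add: mkpos_def V4_def V2_def)

lemma dZ_Cons: "dZ (mkpos r # ps) s = (tts (V2 r) s \<and> dZ ps s)" by (simp only: mkpos_V dZ.simps)
lemma nE_Cons: "nE (Suc (Suc h)) (mkpos r # ps) =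
  (nE (Suc (Suc h)) ps \<and> rE (Suc h) [V2 r ! 0, V2 r ! 5] ps zv \<and> rE h [V4 r ! 0] ps zv)"
  by (simp only: mkpos_V nE.simps)

lemma map_xr: "map (\<lambda>x. xr (f x) (g x)) r = vx (map f r) (map g r)" by (induction r) auto
lemma wt_cases: "wt u = 0 \<or> wt u = 2 \<or> wt u = 4" by (cases u; simp)
lemma wt0: "wt u = 0 \<longleftrightarrow> u = s0" by (cases u; simp)

lemma orbit_5: "orbit 5 v = [v, rv v, rv (rv v), rv (rv (rv v)), rv (rv (rv (rv v)))]"
  by (simp add: numeral_eq_Suc)

lemma map_mu4:
  "map (mu se) r = r" "map (mu sd) r = rv r" "map (mu sb) r = rv (rv r)" "map (mu s7) r = rv (rv (rv r))"
  "map (mu sf) r = rv (rv (rv (rv r)))"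
  by (induction r) (simp_all add: rv_def)

lemma map_mu2:
  "map (mu s3) r = vx r (rv r)" "map (mu s6) r = rv (vx r (rv r))" "map (mu sc) r = rv (rv (vx r (rv r)))"
  "map (mu s8) r = rv (rv (rv (vx r (rv r))))" "map (mu s1) r = rv (rv (rv (rv (vx r (rv r)))))"
  "map (mu s5) r = vx r (rv (rv r))" "map (mu sa) r = rv (vx r (rv (rv r)))" "map (mu s4) r = rv (rv (vx r (rv (rv r))))"
  "map (mu s9) r = rv (rv (rv (vx r (rv (rv r)))))" "map (mu s2) r = rv (rv (rv (rv (vx r (rv (rv r))))))"
  by (induction r) (simp_all add: rv_def rot_xr rot5 xr_comm)

text \<open>The symbols of weight 4 are the fifth roots of unity, so multiplication by them rotates a row.\<close>
lemma mu_image4: "(\<lambda>u. map (mu u) r) ` {u. wt u = 4} = set (V4 r)"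
proof -
  have "{u. wt u = 4} = {se, sd, sb, s7, sf}"
    by (rule set_eqI, rename_tac u, case_tac u) auto
  then show ?thesis by (simp only: image_insert image_empty map_mu4 V4_def orbit_5 list.set)
qed

lemma mu_image2: "(\<lambda>u. map (mu u) r) ` {u. wt u = 2} = set (V2 r)"
proof -
  have "{u. wt u = 2} = {s3, s6, sc, s8, s1, s5, sa, s4, s9, s2}"
    by (rule set_eqI, rename_tac u, case_tac u) auto
  then show ?thesis
    by (simp only: image_insert image_empty map_mu2 V2_def orbit_5 set_append list.set Un_insert_left Un_empty_left)
qed

lemma V4_mem: "wt u = 4 \<Longrightarrow> map (mu u) r \<in> set (V4 r)" unfolding mu_image4[symmetric] by auto
lemma V2_mem: "wt u = 2 \<Longrightarrow> map (mu u) r \<in> set (V2 r)" unfolding mu_image2[symmetric] by auto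
lemma V_rep: "map (mu se) r = V4 r ! 0" "map (mu s3) r = V2 r ! 0" "map (mu s5) r = V2 r ! 5"
  by (simp_all add: V4_def V2_def orbit_5 map_mu4 map_mu2)

fun half :: "sym list \<Rightarrow> nat" where "half [] = 0" | "half (u # us) = wt u div 2 + half us"

lemma half_0: "half us = 0 \<longleftrightarrow> set us \<subseteq> {s0}"
proof (induction us)
  case (Cons u us) then show ?case using wt_cases[of u] wt0[of u] by auto
qed simp

text \<open>Both enumerations are treated together: the second one is the loop over the values of the current coefficient.\<close>
lemma dE_sound:
  "dE h (map mkpos rs) s \<Longrightarrow> rows8 rs \<Longrightarrow> length s = 8 \<Longrightarrow> length us = length rs \<Longrightarrow> half us \<le> h \<Longrightarrow>
     gd (rad (h - half us)) (vx s (enc us rs))"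
  "rE h ys (map mkpos rs) s \<Longrightarrow> rows8 rs \<Longrightarrow> length s = 8 \<Longrightarrow> length us = length rs \<Longrightarrow> half us \<le> h \<Longrightarrow> y \<in> set ys \<Longrightarrow> length y = 8 \<Longrightarrow>
     gd (rad (h - half us)) (vx (vx s y) (enc us rs))"
proof (induction rs arbitrary: h s us ys y)
  case Nil
  {
    case 1
    then show ?case using evs_sound[of "rad h" "[zv]" s zv] by simp
  next
    case 2
    show ?case
    proof (cases h)
      case 0 then show ?thesis using 2 evs_sound[of "rad 0" ys s y] by simp
    next
      case (Suc h')
      have "rE (Suc h') ys [] s \<Longrightarrow> y \<in> set ys \<Longrightarrow> dE (Suc h') [] (vx s y)" by (induction ys) auto
      then show ?thesis using 2 Suc evs_sound[of "rad (Suc h')" "[zv]" "vx s y" zv] by simp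
    qed
  }
next
  case (Cons r rs)
  note IH = Cons.IH
  have one: "gd (rad (h - half us)) (vx s (enc us (r # rs)))"
    if A: "dE h (map mkpos (r # rs)) s" "rows8 (r # rs)" "length s = 8" "length us = length (r # rs)" "half us \<le> h" for h s us
  proof -
    obtain u us' where us: "us = u # us'" using A(4) by (metis length_Suc_conv list.size(4))
    have l: "length r = 8" "rows8 rs" "length us' = length rs" using A us by auto
    show ?thesis
    proof (cases "half us = 0")
      case True
      then have z: "enc us (r # rs) = zv" using A(2) by (intro enc_zero) (auto simp: half_0)
      have "gd (rad h) (vx s zv)"
      proof -
        have "h = 0 \<or> (\<exists>k. h = Suc k)" by (cases h) auto
        then show ?thesis
        proof
          assume "h = 0" then show ?thesis using A evs_sound[of "rad 0" "[zv]" s zv] by simp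
        next
          assume "\<exists>k. h = Suc k"
          then obtain k where "h = Suc k" by blast
          then have "dE h (map mkpos rs) s" using A(1) by (cases k) (auto simp: mkpos_V)
          then show ?thesis using IH(1)[of h s "map (\<lambda>_. s0) rs"] A l by (simp add: enc_zero half_0[THEN iffD2] image_subset_iff)
        qed
      qed
      then show ?thesis using z True by simp
    next
      case False
      then obtain k where h: "h = Suc k" using A(5) by (cases h) auto
      consider "wt u = 0" | "wt u = 2" | "wt u = 4" by (cases u) simp_all
      then show ?thesis
      proof cases
        case 1
        then have "u = s0" by (simp add: wt0)
        moreover have "dE h (map mkpos rs) s" using A(1) h by (cases k) (auto simp: mkpos_V)
        ultimately show ?thesis using IH(1)[of h s us'] A l us by simp
      next
        case 2
        have m: "map (mu u) r \<in> set (V2 r)" using 2 by (rule V2_mem)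
        have "gd (rad (k - half us')) (vx (vx s (map (mu u) r)) (enc us' rs))"
        proof (cases k)
          case 0
          then have "half us' = 0" using A(5) us 2 h by simp
          then have "enc us' rs = zv" using l by (intro enc_zero) (auto simp: half_0)
          moreover have "evs (rad 0) (V2 r) s" using A(1) h 0 by (simp add: mkpos_V)
          ultimately show ?thesis using evs_sound m A(3) l 0 by simp
        next
          case (Suc k')
          then have "rE k (V2 r) (map mkpos rs) s" using A(1) h by (simp add: mkpos_V)
          then show ?thesis using IH(2)[of k "V2 r" s us' "map (mu u) r"] A l us h m 2 by simp
        qed
        then show ?thesis using us 2 h by (simp add: vx_assoc)
      next
        case 3
        have m: "map (mu u) r \<in> set (V4 r)" using 3 by (rule V4_mem)
        obtain k' where k: "k = Suc k'" using 3 A(5) us h by (cases k) auto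
        then have "rE k' (V4 r) (map mkpos rs) s" using A(1) h by (simp add: mkpos_V)
        then have "gd (rad (k' - half us')) (vx (vx s (map (mu u) r)) (enc us' rs))"
          using IH(2)[of k' "V4 r" s us' "map (mu u) r"] A l us h k m 3 by simp
        then show ?thesis using us 3 h k by (simp add: vx_assoc)
      qed
    qed
  qed
  {
    case 1 then show ?case by (rule one)
  next
    case 2
    show ?case
    proof (cases h)
      case 0
      then have "half us = 0" using 2 by simp
      then have "enc us (r # rs) = zv" using 2 by (intro enc_zero) (auto simp: half_0)
      moreover have "evs (rad 0) ys s" using 2 0 by simp
      ultimately show ?thesis using evs_sound 2 0 by simp
    next
      case (Suc h')
      have "rE (Suc h') ys ps s \<Longrightarrow> y \<in> set ys \<Longrightarrow> dE (Suc h') ps (vx s y)" for ps by (induction ys) auto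
      then have "dE h (map mkpos (r # rs)) (vx s y)" using 2 Suc by blast
      then show ?thesis using one[of h "vx s y" us] 2 by simp
    qed
  }
qed

definition rep :: "sym \<Rightarrow> bool" where "rep u \<longleftrightarrow> u = se \<or> u = s3 \<or> u = s5"

fun normed :: "sym list \<Rightarrow> bool" where
  "normed [] = False" | "normed (u # us) = (if u = s0 then normed us else rep u)"

text \<open>Every nonzero symbol is a rotation of one of three representatives, so the enumeration loses nothing by normalising the first nonzero coefficient.\<close>
lemma nE_sound:
  "nE h (map mkpos rs) \<Longrightarrow> rows8 rs \<Longrightarrow> length us = length rs \<Longrightarrow> half us \<le> h \<Longrightarrow> normed us \<Longrightarrow> gd (rad (h - half us)) (enc us rs)"
proof (induction rs arbitrary: us)
  case (Cons r rs)
  obtain u us' where us: "us = u # us'" using Cons.prems(3) by (metis length_Suc_conv list.size(4))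
  obtain k where h: "h = Suc (Suc k)" using Cons.prems(1) by (cases "(h, map mkpos (r # rs))" rule: nE.cases) (auto simp: mkpos_V)
  have l: "length r = 8" "rows8 rs" "length us' = length rs" using Cons.prems us by auto
  have c: "nE (Suc (Suc k)) (map mkpos rs)" "rE (Suc k) [V2 r ! 0, V2 r ! 5] (map mkpos rs) zv" "rE k [V4 r ! 0] (map mkpos rs) zv"
    using Cons.prems(1) unfolding h list.map nE_Cons by blast+
  show ?case
  proof (cases "u = s0")
    case True then show ?thesis using Cons.IH[OF c(1)[folded h] l(2,3)] Cons.prems us l by simp
  next
    case False
    then consider "u = se" | "u = s3" | "u = s5" using Cons.prems(5) us by (auto simp: rep_def)
    then show ?thesis
    proof cases
      case 1
      have "gd (rad (k - half us')) (vx (vx zv (map (mu u) r)) (enc us' rs))"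
        by (rule dE_sound(2)[OF c(3) l(2) _ l(3)]) (use 1 Cons.prems us h l in \<open>auto simp: V_rep[symmetric]\<close>)
      then show ?thesis using us 1 h l by simp
    next
      case 2
      have "gd (rad (Suc k - half us')) (vx (vx zv (map (mu u) r)) (enc us' rs))"
        by (rule dE_sound(2)[OF c(2) l(2) _ l(3)]) (use 2 Cons.prems us h l in \<open>auto simp: V_rep[symmetric]\<close>)
      then show ?thesis using us 2 h l by simp
    next
      case 3
      have "gd (rad (Suc k - half us')) (vx (vx zv (map (mu u) r)) (enc us' rs))"
        by (rule dE_sound(2)[OF c(2) l(2) _ l(3)]) (use 3 Cons.prems us h l in \<open>auto simp: V_rep[symmetric]\<close>)
      then show ?thesis using us 3 h l by simp
    qed
  qed
qed simp

definition all4 :: "sym list \<Rightarrow> bool" where "all4 us \<longleftrightarrow> (\<forall>u\<in>set us. wt u = 4)"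
definition all0 :: "sym list \<Rightarrow> bool" where "all0 us \<longleftrightarrow> (\<forall>u\<in>set us. wt u = 0)"
fun one2 :: "nat \<Rightarrow> sym list \<Rightarrow> bool" where
  "one2 w [] = False" | "one2 w (u # us) = (wt u = 2 \<and> (\<forall>v\<in>set us. wt v = w) \<or> wt u = w \<and> one2 w us)"

fun finP :: "kind \<Rightarrow> sym list \<Rightarrow> bool" where "finP T4 v = gd 8 v" | "finP T6 v = gt v"

lemma fin_sound: "fin k ys s \<Longrightarrow> length s = 8 \<Longrightarrow> y \<in> set ys \<Longrightarrow> length y = 8 \<Longrightarrow> finP k (vx s y)"
  using evs_sound[of 8 ys s y] tts_sound[of ys s y] by (cases k) (auto simp: numeral_eq_Suc)

lemma dY_sound:
  "dY k ys (map mkpos rs) s \<Longrightarrow> rows8 rs \<Longrightarrow> length s = 8 \<Longrightarrow> length us = length rs \<Longrightarrow> all4 us \<Longrightarrow> y \<in> set ys \<Longrightarrow> length y = 8 \<Longrightarrow>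
    finP k (vx (vx s y) (enc us rs))"
proof (induction rs arbitrary: s us ys y)
  case Nil then show ?case using fin_sound[of k ys s y] by simp
next
  case (Cons r rs)
  obtain u us' where us: "us = u # us'" using Cons.prems(4) by (metis length_Suc_conv list.size(4))
  have "dY k ys (map mkpos (r # rs)) s \<Longrightarrow> y \<in> set ys \<Longrightarrow> dY k (V4 r) (map mkpos rs) (vx s y)"
    by (induction ys) (auto simp: mkpos_V)
  then have "dY k (V4 r) (map mkpos rs) (vx s y)" using Cons.prems by blast
  then have "finP k (vx (vx (vx s y) (map (mu u) r)) (enc us' rs))"
    using Cons.prems us by (intro Cons.IH[of "V4 r"]) (auto simp: all4_def V4_mem)
  then show ?case using us by (simp add: vx_assoc)
qed

lemma dZ_sound: "dZ (map mkpos rs) s \<Longrightarrow> rows8 rs \<Longrightarrow> length s = 8 \<Longrightarrow> length us = length rs \<Longrightarrow> one2 0 us \<Longrightarrow> gt (vx s (enc us rs))"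
proof (induction rs arbitrary: us)
  case (Cons r rs)
  obtain u us' where us: "us = u # us'" using Cons.prems(4) by (metis length_Suc_conv list.size(4))
  have c: "tts (V2 r) s" "dZ (map mkpos rs) s" using Cons.prems(1) unfolding list.map dZ_Cons by blast+
  show ?case
  proof (cases "wt u = 2 \<and> (\<forall>v\<in>set us'. wt v = 0)")
    case True
    then have "enc us' rs = zv" using Cons.prems by (intro enc_zero) (auto simp: wt0)
    moreover have "gt (vx s (map (mu u) r))" using c(1) True Cons.prems by (intro tts_sound[of "V2 r"]) (auto simp: V2_mem)
    ultimately show ?thesis using us Cons.prems by simp
  next
    case False
    then have "u = s0" "one2 0 us'" using Cons.prems us by (auto simp: wt0)
    then show ?thesis using Cons.IH[OF c(2)] Cons.prems us by simp
  qed
qed simp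

lemma dX_sound:
  "dX W4 W2 (map mkpos os) (map mkpos es) s \<Longrightarrow> rows8 os \<Longrightarrow> rows8 es \<Longrightarrow> length s = 8 \<Longrightarrow> length us = length os \<Longrightarrow> length vs = length es \<Longrightarrow> length y = 8 \<Longrightarrow>
    y \<in> set W2 \<and> all4 us \<and> all0 vs \<or> y \<in> set W4 \<and> one2 4 us \<and> all0 vs \<or> y \<in> set W4 \<and> all4 us \<and> one2 0 vs \<Longrightarrow>
    gt (vx (vx (vx s y) (enc us os)) (enc vs es))"
proof (induction os arbitrary: W4 W2 s us y)
  case Nil
  have r: "rX ys [] es s \<Longrightarrow> y \<in> set ys \<Longrightarrow> dZ es (vx s y)" for ys es by (induction ys) auto
  from Nil.prems(8) consider "y \<in> set W2" "all0 vs" | "y \<in> set W4" "one2 0 vs" using Nil.prems(5) by auto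
  then show ?case
  proof cases
    case 1
    then have "enc vs es = zv" using Nil.prems by (intro enc_zero) (auto simp: all0_def wt0)
    moreover have "tts W2 s" using Nil.prems(1) by simp
    ultimately show ?thesis using tts_sound[of W2 s y] 1 Nil.prems by simp
  next
    case 2
    then have "dZ (map mkpos es) (vx s y)" using Nil.prems(1) r[of W4 "map mkpos es"] by simp
    then show ?thesis using dZ_sound[of es "vx s y" vs] 2 Nil.prems by simp
  qed
next
  case (Cons r os)
  obtain u us' where us: "us = u # us'" using Cons.prems(5) by (metis length_Suc_conv list.size(4))
  have rr: "rX ys (map mkpos (r # os)) E s \<Longrightarrow> y \<in> set ys \<Longrightarrow> dX (V4 r) (V2 r) (map mkpos os) E (vx s y)" for ys E
    by (induction ys) (auto simp: mkpos_V)
  show ?case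
  proof (cases "y \<in> set W2 \<and> all4 us \<and> all0 vs")
    case True
    have "dY T6 W2 (map mkpos (r # os)) s" using Cons.prems(1) by simp
    then have "finP T6 (vx (vx s y) (enc us (r # os)))" using True Cons.prems by (intro dY_sound[of T6 W2]) auto
    moreover have "enc vs es = zv" using True Cons.prems by (intro enc_zero) (auto simp: all0_def wt0)
    ultimately show ?thesis using Cons.prems by simp
  next
    case False
    then have y: "y \<in> set W4" and d: "one2 4 us \<and> all0 vs \<or> all4 us \<and> one2 0 vs" using Cons.prems(8) by auto
    have "dX (V4 r) (V2 r) (map mkpos os) (map mkpos es) (vx s y)" using Cons.prems(1) y rr[of W4 "map mkpos es"] by simp
    then have "gt (vx (vx (vx (vx s y) (map (mu u) r)) (enc us' os)) (enc vs es))"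
    proof (rule Cons.IH)
      show "map (mu u) r \<in> set (V2 r) \<and> all4 us' \<and> all0 vs \<or> map (mu u) r \<in> set (V4 r) \<and> one2 4 us' \<and> all0 vs \<or>
        map (mu u) r \<in> set (V4 r) \<and> all4 us' \<and> one2 0 vs"
        using d us by (auto simp: all4_def V4_mem V2_mem)
    qed (use Cons.prems us in auto)
    then show ?thesis using us by (simp add: vx_assoc)
  qed
qed

lemma sel_map: "sel b f (map g xs) = map g (sel b f xs)" by (induction b f xs rule: sel.induct) auto
lemma set_sel: "set (sel b f xs) \<subseteq> set xs" by (induction b f xs rule: sel.induct) auto
lemma rows8_sel: "rows8 A \<Longrightarrow> rows8 (sel b f A)" using set_sel[of b f A] by (auto simp: rows8_def)
lemma length_sel: "length f = length x \<Longrightarrow> length y = length x \<Longrightarrow> length (sel b f x) = length (sel b f y)"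
proof (induction f x arbitrary: y rule: list_induct2)
  case (Cons a f x xs) then show ?case by (cases y; cases a; cases b) auto
qed simp

lemma enc_sel: "rows8 A \<Longrightarrow> length f = length A \<Longrightarrow> length x = length A \<Longrightarrow>
  enc x A = vx (enc (sel True f x) (sel True f A)) (enc (sel False f x) (sel False f A))"
proof (induction A arbitrary: f x)
  case (Cons r A)
  then obtain a f' u x' where "f = a # f'" "x = u # x'" by (metis length_Suc_conv)
  have r: "rows8 (sel b f' A)" for b using Cons.prems(1) by (simp add: rows8_sel)
  show ?case using Cons r \<open>f = a # f'\<close> \<open>x = u # x'\<close> by (cases a) (simp_all add: vx_ac)
qed simp

section \<open>Minimum distance and profiles of unitary matrices\<close>

definition f0 :: "bool list" where "f0 = [False,False,False,False,False,False,False,False]"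
definition f1 :: "bool list" where "f1 = [True,True,True,True,True,True,True,True]"

lemma f0_replicate: "f0 = replicate 8 False" by (simp add: f0_def numeral_eq_Suc)

lemma set_e8: "set e8 = insert f0 (insert f1 (set tetrads))"
  unfolding f0_def f1_def by (simp add: e8_def tetrads_def insert_commute)

lemma length_f01 [simp]: "length f0 = 8" "length f1 = 8" by (simp_all add: f0_def f1_def)

lemma e8_closed: "f \<in> set e8 \<Longrightarrow> g \<in> set e8 \<Longrightarrow> xor_list f g \<in> set e8"
proof -
  have "\<forall>f\<in>set e8. \<forall>g\<in>set e8. xor_list f g \<in> set e8" by (simp add: e8_def)
  then show "f \<in> set e8 \<Longrightarrow> g \<in> set e8 \<Longrightarrow> xor_list f g \<in> set e8" by blast
qed

lemma distinct_e8: "distinct e8" by (simp add: e8_def)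

lemma upt_8: "[0..<8] = [0,1,2,3,4,5,6,7::nat]" by (simp add: upt_rec)

lemma tetrads_triple:
  assumes "p < 8" "q < 8" "r < 8" shows "\<exists>t\<in>set tetrads. t ! p \<and> t ! q \<and> t ! r"
proof -
  have "list_all (\<lambda>p. list_all (\<lambda>q. list_all (\<lambda>r. list_ex (\<lambda>t. t ! p \<and> t ! q \<and> t ! r) tetrads) [0..<8]) [0..<8]) [0..<8]"
    unfolding upt_8 by (simp add: tetrads_def nth_Cons_numeral)
  then have all: "\<forall>p\<in>set [0..<8]. \<forall>q\<in>set [0..<8]. \<forall>r\<in>set [0..<8]. \<exists>t\<in>set tetrads. t ! p \<and> t ! q \<and> t ! r"
    by (simp only: list_all_iff list_ex_iff)
  have "p \<in> set [0..<8]" "q \<in> set [0..<8]" "r \<in> set [0..<8]" using assms by simp_all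
  then show ?thesis by (intro bspec[OF bspec[OF bspec[OF all]]])
qed

lemma cost_parts: "\<exists>k. cost f x = (if f then 1 else 0) + (if wt x = 2 then 2 else 0) + 4 * k"
proof -
  have "cost f x = (if f then 1 else 0) + (if wt x = 2 then 2 else 0) + 4 * (if (wt x = 0 \<and> f) \<or> (wt x = 4 \<and> \<not> f) then 1 else 0)"
    by (cases f; cases x; simp)
  then show ?thesis by blast
qed

text \<open>The cost of a symbol is congruent modulo 4 to the flag plus twice the indicator of weight 2.\<close>
lemma vcost_parts:
  "length f = length x \<Longrightarrow> \<exists>k. vcost f x = length (filter id f) + (if two_parity x then 2 else 0) + 4 * k"
proof (induction f x rule: list_induct2)
  case (Cons a f x xs)
  obtain k where k: "vcost f xs = length (filter id f) + (if two_parity xs then 2 else 0) + 4 * k" using Cons.IH by blast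
  obtain c where c: "cost a x = (if a then 1 else 0) + (if wt x = 2 then 2 else 0) + 4 * c" using cost_parts by blast
  have "vcost (a # f) (x # xs) = length (filter id (a # f)) + (if two_parity (x # xs) then 2 else 0) +
      4 * (k + c + (if wt x = 2 \<and> two_parity xs then 1 else 0))"
    using k c by simp
  then show ?case by blast
qed simp

lemma e8_weight: "f \<in> set e8 \<Longrightarrow> \<exists>k. length (filter id f) = 4 * k"
proof -
  have "\<forall>f\<in>set e8. length (filter id f) = 4 * 0 \<or> length (filter id f) = 4 * 1 \<or> length (filter id f) = 4 * 2"
    by (simp add: e8_def)
  then show "f \<in> set e8 \<Longrightarrow> \<exists>k. length (filter id f) = 4 * k" by blast
qed

lemma vcost_e8_parts:
  assumes "f \<in> set e8" "length x = 8" shows "\<exists>k. vcost f x = (if two_parity x then 2 else 0) + 4 * k"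
proof -
  obtain j where "length (filter id f) = 4 * j" using e8_weight[OF assms(1)] by blast
  moreover obtain k where "vcost f x = length (filter id f) + (if two_parity x then 2 else 0) + 4 * k"
    using vcost_parts[of f x] length_e8[OF assms(1)] assms(2) by auto
  ultimately have "vcost f x = (if two_parity x then 2 else 0) + 4 * (j + k)" by simp
  then show ?thesis by blast
qed

lemma even_vcost: "f \<in> set e8 \<Longrightarrow> length x = 8 \<Longrightarrow> even (vcost f x)"
  using vcost_e8_parts[of f x] by auto

lemma vcost_rv [simp]: "vcost f (rv x) = vcost f x"
proof (induction f arbitrary: x)
  case (Cons a f) then show ?case by (cases x) (auto simp: rv_def)
qed (simp add: rv_def)

lemma vcost_f0: "length x = 8 \<Longrightarrow> vcost f0 x = 2 * half x"
proof -
  have "vcost (replicate n False) x = 2 * half x" if "length x = n" for n x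
    using that
  proof (induction n arbitrary: x)
    case (Suc n)
    then obtain u us where "x = u # us" by (metis length_Suc_conv)
    then show ?case using Suc wt_cases[of u] by auto
  qed simp
  from this[of x 8] show "length x = 8 \<Longrightarrow> vcost f0 x = 2 * half x" by (simp add: f0_def numeral_eq_Suc)
qed

lemma vcost_ge: "length f = length x \<Longrightarrow> length (filter id f) \<le> vcost f x"
  using vcost_tetrad[of f x] by simp

lemma vcost_f1: "length x = 8 \<Longrightarrow> 8 \<le> vcost f1 x"
  using vcost_ge[of f1 x] by (simp add: f1_def)


lemma rot_pow5: "(rot ^^ n) u = s0 \<longleftrightarrow> u = s0"
proof (induction n)
  case (Suc n)
  have "rot x = s0 \<longleftrightarrow> x = s0" for x by (cases x) simp_all
  then show ?case using Suc by simp
qed simp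

lemma rv_pow: "(rv ^^ n) x = map (rot ^^ n) x"
  by (induction n) (auto simp: rv_def)
lemma length_rv_pow [simp]: "length ((rv ^^ n) x) = length x" by (simp add: rv_pow)
lemma vcost_rv_pow [simp]: "vcost f ((rv ^^ n) x) = vcost f x" by (induction n) auto
lemma enc_rv_pow: "rows8 A \<Longrightarrow> enc ((rv ^^ n) x) A = (rv ^^ n) (enc x A)"
  by (induction n) (auto simp: enc_rot)
lemma sel_rv_pow: "sel b f ((rv ^^ n) x) = (rv ^^ n) (sel b f x)" by (simp add: rv_pow sel_map)
lemma wt_rot_pow [simp]: "wt ((rot ^^ n) u) = wt u" by (induction n) auto
lemma gd_rv_pow [simp]: "gd R ((rv ^^ n) x) = gd R x" by (simp add: gd_def)
lemma half_rv_pow [simp]: "half ((rv ^^ n) x) = half x"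
  unfolding rv_pow by (induction x) auto

lemma rotate_to_rep: "u \<noteq> s0 \<Longrightarrow> \<exists>n. rep ((rot ^^ n) u)"
proof -
  assume u: "u \<noteq> s0"
  have "rep u \<or> rep (rot u) \<or> rep (rot (rot u)) \<or> rep (rot (rot (rot u))) \<or> rep (rot (rot (rot (rot u))))"
    using u by (cases u) (simp_all add: rep_def)
  then have "rep ((rot ^^ 0) u) \<or> rep ((rot ^^ 1) u) \<or> rep ((rot ^^ 2) u) \<or> rep ((rot ^^ 3) u) \<or> rep ((rot ^^ 4) u)"
    by (simp add: numeral_eq_Suc)
  then show ?thesis by blast
qed

text \<open>The rotation acts freely on nonzero symbols and has three orbits, represented by se, s3 and s5.\<close>
lemma rotate_to_normed: "\<not> set x \<subseteq> {s0} \<Longrightarrow> \<exists>n. normed ((rv ^^ n) x)"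
proof (induction x)
  case (Cons u x)
  show ?case
  proof (cases "u = s0")
    case True
    then obtain n where "normed ((rv ^^ n) x)" using Cons by auto
    then show ?thesis using True rot_pow5[of n s0] by (auto simp: rv_pow intro!: exI[of _ n])
  next
    case False
    then obtain n where "rep ((rot ^^ n) u)" using rotate_to_rep by blast
    then show ?thesis using False rot_pow5[of n u] by (auto simp: rv_pow intro!: exI[of _ n])
  qed
qed simp

lemma not_zv: "length x = 8 \<Longrightarrow> x \<noteq> zv \<Longrightarrow> \<not> set x \<subseteq> {s0}"
  using replicate_eqI[of x 8 s0] by (auto simp: zv_replicate)

text \<open>Words that are even on the first block and have weight at most 6 there.\<close>
lemma check_even_side:
  assumes "nE 3 (map mkpos A)" "rows8 A" "length A = 8" "length x = 8" "x \<noteq> zv" "vcost f0 x \<le> 6" "g \<in> set e8"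
  shows "12 < vcost f0 x + vcost g (enc x A)"
proof -
  obtain n where n: "normed ((rv ^^ n) x)" using rotate_to_normed not_zv assms(4,5) by blast
  have h: "half x \<le> 3" using assms(4,6) vcost_f0 by simp
  have "gd (rad (3 - half x)) (enc ((rv ^^ n) x) A)"
    using nE_sound[OF assms(1,2), of "(rv ^^ n) x"] n h assms(3,4) by simp
  then have "gd (rad (3 - half x)) (enc x A)" using assms(2) by (simp add: enc_rv_pow)
  moreover have "rad (3 - half x) = 12 - 2 * half x"
  proof -
    have r: "rad k = 6 + 2 * k" for k by (induction k) auto
    show ?thesis using h by (simp add: r)
  qed
  ultimately have "12 - 2 * half x < vcost g (enc x A)" using assms(7) by (auto simp: gd_def)
  then show ?thesis using vcost_f0[OF assms(4)] by simp
qed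

fun deficit :: "sym list \<Rightarrow> nat" where "deficit [] = 0" | "deficit (u # us) = (4 - wt u) div 2 + deficit us"

lemma deficit_0: "deficit us = 0 \<longleftrightarrow> all4 us"
proof (induction us)
  case (Cons u us) then show ?case using wt_cases[of u] by (auto simp: all4_def)
qed (simp add: all4_def)
lemma deficit_1: "deficit us = 1 \<Longrightarrow> one2 4 us"
proof (induction us)
  case (Cons u us)
  consider "wt u = 0" | "wt u = 2" | "wt u = 4" by (cases u) simp_all
  then show ?case using Cons deficit_0[of us] by cases (auto simp: all4_def)
qed simp
lemma half_all0: "half us = 0 \<longleftrightarrow> all0 us" unfolding half_0 all0_def by (auto simp: wt0)
lemma half_1: "half us = 1 \<Longrightarrow> one2 0 us"
proof (induction us)
  case (Cons u us)
  consider "wt u = 0" | "wt u = 2" | "wt u = 4" by (cases u) simp_all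
  then show ?case using Cons half_all0[of us] by cases (auto simp: all0_def)
qed simp

text \<open>With flags along a tetrad, each of its symbols costs at least 1 and the excess over 4 is twice the number of units by which the symbols deviate from the cheapest ones.\<close>
lemma vcost_sel: "length f = length x \<Longrightarrow> vcost f x = length (filter id f) + 2 * deficit (sel True f x) + 2 * half (sel False f x)"
proof (induction f x rule: list_induct2)
  case (Cons a f x xs) then show ?case using wt_cases[of x] by (cases a) auto
qed simp

lemma length_sel_True: "length f = length x \<Longrightarrow> length (sel True f x) = length (filter id f)"
  by (induction f x rule: list_induct2) auto

lemma map_sel: "sel b f (map g x) = map g (sel b f x)" by (rule sel_map)

lemma t4s_iff: "t4s ts ps \<longleftrightarrow> (\<forall>t\<in>set ts. t4 (sel True t ps))" by (induction ts) auto
lemma t6s_iff: "t6s ts ps \<longleftrightarrow> (\<forall>t\<in>set ts. t6 (sel True t ps) (sel False t ps))" by (induction ts) auto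

lemma rep_wt4: "rep u \<Longrightarrow> wt u = 4 \<Longrightarrow> u = se" and rep_wt2: "rep u \<Longrightarrow> wt u = 2 \<Longrightarrow> u = s3 \<or> u = s5"
  by (auto simp: rep_def)

text \<open>After a rotation the coefficient at the first position of the tetrad is one of the three representatives; it cannot be zero because it would then cost 5.\<close>
lemma tetrad_split:
  assumes "rows8 A" "length A = 8" "length x = 8" "t \<in> set tetrads" "vcost t x \<le> 6"
  obtains n u us r rs where "sel True t ((rv ^^ n) x) = u # us" "sel True t A = r # rs" "length us = length rs" "rep u"
    "length (sel False t ((rv ^^ n) x)) = length (sel False t A)"
    "rows8 (r # rs)" "rows8 (sel False t A)"
    "enc ((rv ^^ n) x) A = vx (vx (map (mu u) r) (enc us rs)) (enc (sel False t ((rv ^^ n) x)) (sel False t A))"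
proof -
  have t: "length t = 8" "length (filter id t) = 4" using assms(4) length_tetrads tetrad_weight by auto
  have "length (sel True t x) = 4" using length_sel_True[of t x] t assms(3) by simp
  then obtain v vs where v: "sel True t x = v # vs" by (cases "sel True t x") auto
  have "v \<noteq> s0"
  proof
    assume "v = s0"
    then have "4 + 2 * 2 \<le> vcost t x" using vcost_sel[of t x] t assms(3) v by simp
    then show False using assms(5) by simp
  qed
  then obtain n where n: "rep ((rot ^^ n) v)" using rotate_to_rep by blast
  let ?x = "(rv ^^ n) x"
  have s: "sel True t ?x = (rot ^^ n) v # map (rot ^^ n) vs" unfolding sel_rv_pow v by (simp add: rv_pow)
  have l: "length (sel b t ?x) = length (sel b t A)" for b
    using length_sel[of t ?x A b] t assms(2,3) by simp
  then obtain r rs where r: "sel True t A = r # rs" using s by (metis length_Suc_conv)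
  have R: "rows8 (sel b t A)" for b by (rule rows8_sel[OF assms(1)])
  show thesis
  proof (rule that[OF s r _ n l])
    show "length (map (rot ^^ n) vs) = length rs" using l[of True] s r by simp
    show "rows8 (r # rs)" using R[of True] r by simp
    show "rows8 (sel False t A)" by (rule R)
    show "enc ?x A = vx (vx (map (mu ((rot ^^ n) v)) r) (enc (map (rot ^^ n) vs) rs)) (enc (sel False t ?x) (sel False t A))"
      using enc_sel[of A t ?x] assms(1,2,3) t unfolding s r by simp
  qed
qed

lemma check_tetrad4_side:
  assumes "t4s tetrads (map mkpos A)" "rows8 A" "length A = 8" "length x = 8" "t \<in> set tetrads" "vcost t x = 4" "g \<in> set e8"
  shows "8 < vcost g (enc x A)"
proof -
  have t: "length t = 8" "length (filter id t) = 4" using assms(5) length_tetrads tetrad_weight by auto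
  obtain n u us r rs where s: "sel True t ((rv ^^ n) x) = u # us" "sel True t A = r # rs" "length us = length rs" "rep u"
    "length (sel False t ((rv ^^ n) x)) = length (sel False t A)" "rows8 (r # rs)" "rows8 (sel False t A)"
    "enc ((rv ^^ n) x) A = vx (vx (map (mu u) r) (enc us rs)) (enc (sel False t ((rv ^^ n) x)) (sel False t A))"
    by (rule tetrad_split[OF assms(2,3,4,5)]) (use assms(6) in simp)
  have v: "vcost t ((rv ^^ n) x) = 4" using assms(6) by simp
  then have d: "deficit (u # us) = 0" "half (sel False t ((rv ^^ n) x)) = 0"
    using vcost_sel[of t "(rv ^^ n) x"] t assms(4) s(1) by auto
  have z: "enc (sel False t ((rv ^^ n) x)) (sel False t A) = zv"
    using d(2) s(7) by (intro enc_zero) (auto simp: half_0)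
  have a: "wt u = 4" "all4 us" using d(1) deficit_0[of "u # us"] by (auto simp: all4_def)
  then have use: "u = se" using s(4) rep_wt4 by blast
  have "dY T4 [V4 r ! 0] (map mkpos rs) zv"
    using assms(1,5) s(2) by (auto simp: t4s_iff map_sel mkpos_V)
  then have "finP T4 (vx (vx zv (V4 r ! 0)) (enc us rs))"
    by (rule dY_sound) (use s(3,6) a in \<open>auto simp: V_rep[symmetric]\<close>)
  then have "gd 8 (vx (map (mu u) r) (enc us rs))" using s(6) use by (simp add: V_rep[symmetric])
  then have "gd 8 (enc ((rv ^^ n) x) A)" using s(6,8) z by simp
  then show ?thesis using assms(2,7) by (simp add: enc_rv_pow gd_def)
qed

lemma check_tetrad6_side:
  assumes "t6s tetrads (map mkpos A)" "rows8 A" "length A = 8" "length x = 8" "t \<in> set tetrads" "vcost t x = 6" "g \<in> set tetrads"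
  shows "6 < vcost g (enc x A)"
proof -
  have t: "length t = 8" "length (filter id t) = 4" using assms(5) length_tetrads tetrad_weight by auto
  obtain n u us r rs where s: "sel True t ((rv ^^ n) x) = u # us" "sel True t A = r # rs" "length us = length rs" "rep u"
    "length (sel False t ((rv ^^ n) x)) = length (sel False t A)" "rows8 (r # rs)" "rows8 (sel False t A)"
    "enc ((rv ^^ n) x) A = vx (vx (map (mu u) r) (enc us rs)) (enc (sel False t ((rv ^^ n) x)) (sel False t A))"
    by (rule tetrad_split[OF assms(2,3,4,5)]) (use assms(6) in simp)
  let ?vs = "sel False t ((rv ^^ n) x)" and ?es = "sel False t A"
  have "vcost t ((rv ^^ n) x) = 6" using assms(6) by simp
  then have d: "deficit (u # us) + half ?vs = 1"
    using vcost_sel[of t "(rv ^^ n) x"] t assms(4) s(1) by auto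
  then consider "deficit (u # us) = 1" "half ?vs = 0" | "deficit (u # us) = 0" "half ?vs = 1" by fastforce
  then have cases: "(u = s3 \<or> u = s5) \<and> all4 us \<and> all0 ?vs \<or> u = se \<and> one2 4 us \<and> all0 ?vs \<or> u = se \<and> all4 us \<and> one2 0 ?vs"
  proof cases
    case 1
    then have "one2 4 (u # us)" "all0 ?vs" using deficit_1 half_all0 by blast+
    then show ?thesis using rep_wt4[OF s(4)] rep_wt2[OF s(4)] by (auto simp: all4_def)
  next
    case 2
    then have "all4 (u # us)" "one2 0 ?vs" using deficit_0 half_1 by blast+
    then show ?thesis using rep_wt4[OF s(4)] by (auto simp: all4_def)
  qed
  have "dX [V4 r ! 0] [V2 r ! 0, V2 r ! 5] (map mkpos rs) (map mkpos ?es) zv"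
    using assms(1,5) s(2) by (auto simp: t6s_iff map_sel mkpos_V)
  then have "gt (vx (vx (vx zv (map (mu u) r)) (enc us rs)) (enc ?vs ?es))"
    by (rule dX_sound) (use s cases in \<open>auto simp: V_rep[symmetric]\<close>)
  then have "gt (enc ((rv ^^ n) x) A)" using s(6,8) by simp
  then show ?thesis using assms(2,7) by (simp add: enc_rv_pow gt_def)
qed


definition good :: "sym list list \<Rightarrow> bool" where
  "good A \<longleftrightarrow> square8 A \<and> list_all (unit_ok A) units \<and> chkL (map mkpos A) \<and> chkR (map mkpos (dual A)) \<and> shows_pattern (2, 0, 6, 0) A"

lemma square8_rows: "square8 A \<Longrightarrow> rows8 A \<and> length A = 8"
  unfolding square8_def rows8_def
proof
  assume h: "map length A = [8,8,8,8,8,8,8,8]"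
  then have "length (map length A) = 8" by simp
  then show "length A = 8" by simp
  show "\<forall>r\<in>set A. length r = 8"
  proof
    fix r assume "r \<in> set A"
    then have "length r \<in> set (map length A)" by simp
    then show "length r = 8" unfolding h by simp
  qed
qed

lemma heads_tails: "\<forall>r\<in>set A. length r = Suc n \<Longrightarrow> heads A = map hd A \<and> tails A = map tl A"
  by (induction A rule: heads.induct) auto

lemma dual_n_map: "\<forall>r\<in>set A. length r = n \<Longrightarrow> dual_n n A = map (\<lambda>j. map (\<lambda>r. conj (r ! j)) A) [0..<n]"
proof (induction n arbitrary: A)
  case (Suc n)
  have ne: "r \<noteq> []" if "r \<in> set A" for r using Suc.prems that by fastforce
  have "dual_n n (tails A) = map (\<lambda>j. map (\<lambda>r. conj (r ! j)) (map tl A)) [0..<n]"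
    using heads_tails[OF Suc.prems] Suc.prems by (simp add: Suc.IH)
  also have "\<dots> = map (\<lambda>j. map (\<lambda>r. conj (r ! Suc j)) A) [0..<n]"
    using Suc.prems by (auto simp: nth_tl)
  finally have "dual_n (Suc n) A = map (\<lambda>r. conj (r ! 0)) A # map (\<lambda>j. map (\<lambda>r. conj (r ! Suc j)) A) [0..<n]"
    using heads_tails[OF Suc.prems] ne by (simp add: hd_conv_nth)
  then show ?case by (simp add: upt_conv_Cons map_Suc_upt[symmetric] del: upt_Suc)
qed simp

fun xsum :: "sym list \<Rightarrow> sym" where "xsum [] = s0" | "xsum (x # xs) = xr x (xsum xs)"

lemma dot_xsum: "length y = length r \<Longrightarrow> dot r y = xsum (map (\<lambda>j. mu (y ! j) (conj (r ! j))) [0..<length r])"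
proof (induction r arbitrary: y)
  case (Cons a r)
  then obtain b y' where "y = b # y'" by (metis length_Suc_conv)
  with Cons show ?case by (simp add: upt_conv_Cons map_Suc_upt[symmetric] o_def del: upt_Suc)
qed simp

lemma nth_enc: "rows8 A \<Longrightarrow> length x = length A \<Longrightarrow> i < 8 \<Longrightarrow>
  enc x A ! i = xsum (map (\<lambda>j. mu (x ! j) (A ! j ! i)) [0..<length A])"
proof (induction A arbitrary: x)
  case (Cons r A)
  then obtain u us where "x = u # us" by (metis length_Suc_conv)
  with Cons show ?case by (simp add: nth_vx upt_conv_Cons map_Suc_upt[symmetric] o_def del: upt_Suc)
qed (simp add: zv_replicate)

lemma dual_props:
  assumes "rows8 A" "length A = 8"
  shows "rows8 (dual A)" "length (dual A) = 8" "length y = 8 \<Longrightarrow> enc y (dual A) = map (\<lambda>r. dot r y) A"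
proof -
  have d: "dual A = map (\<lambda>j. map (\<lambda>r. conj (r ! j)) A) [0..<8]"
    unfolding dual_def using assms by (intro dual_n_map) (simp add: rows8_def)
  show r: "rows8 (dual A)" "length (dual A) = 8" unfolding d rows8_def using assms by auto
  assume y: "length y = 8"
  show "enc y (dual A) = map (\<lambda>r. dot r y) A"
  proof (rule nth_equalityI)
    show "length (enc y (dual A)) = length (map (\<lambda>r. dot r y) A)" using r assms by simp
    fix i assume "i < length (enc y (dual A))"
    then have i: "i < 8" using r by simp
    have len: "length (A ! i) = 8" using assms i by (simp add: rows8_def)
    have "enc y (dual A) ! i = xsum (map (\<lambda>j. mu (y ! j) (dual A ! j ! i)) [0..<8])"
      using nth_enc[of "dual A" y i] r y i by simp
    also have "\<dots> = xsum (map (\<lambda>j. mu (y ! j) (conj (A ! i ! j))) [0..<8])"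
      using i assms by (intro arg_cong[of _ _ xsum] map_cong) (auto simp: d)
    also have "\<dots> = dot (A ! i) y" using dot_xsum[of y "A ! i"] len y by simp
    finally show "enc y (dual A) ! i = map (\<lambda>r. dot r y) A ! i" using i assms by simp
  qed
qed

locale good_matrix =
  fixes A :: "sym list list"
  assumes good: "good A"
begin

lemma rows: "rows8 A" "length A = 8" using good square8_rows by (auto simp: good_def)
lemmas dual_rows = dual_props(1,2)[OF rows]

lemma unit_checks: "u \<in> set units \<Longrightarrow> map (\<lambda>r. dot r (enc u A)) A = u" "u \<in> set units \<Longrightarrow> two_parity u = two_parity (enc u A)"
  using good by (auto simp: good_def list_all_iff unit_ok_def)

text \<open>It suffices to check unitarity on the basis vectors.\<close>
lemma unitary: "length x = 8 \<Longrightarrow> enc (enc x A) (dual A) = x"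
proof -
  assume x: "length x = 8"
  have "map (\<lambda>r. dot r (enc x A)) A = x"
  proof (rule units_span[where P = "\<lambda>x. map (\<lambda>r. dot r (enc x A)) A = x"])
    show "map (\<lambda>r. dot r (enc zv A)) A = zv"
    proof -
      have e: "enc zv A = zv" using rows by (intro enc_zero) (simp_all add: zv_def)
      have "dot r (replicate n s0) = s0" for r n
      proof (induction r arbitrary: n)
        case (Cons a r) then show ?case by (cases n) auto
      qed simp
      then have "map (\<lambda>r. dot r zv) A = map (\<lambda>r. s0) A" by (simp add: zv_replicate)
      then show ?thesis using rows e by (simp add: map_replicate_const zv_replicate)
    qed
    fix x y assume h: "length x = 8" "length y = 8" "map (\<lambda>r. dot r (enc x A)) A = x" "map (\<lambda>r. dot r (enc y A)) A = y"
    have "map (\<lambda>r. dot r (enc (vx x y) A)) A = map (\<lambda>r. xr (dot r (enc x A)) (dot r (enc y A))) A"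
    proof (rule map_cong)
      fix r assume "r \<in> set A"
      then have "length r = 8" using rows by (simp add: rows8_def)
      then show "dot r (enc (vx x y) A) = xr (dot r (enc x A)) (dot r (enc y A))"
        using rows h(1,2) by (simp add: enc_vx dot_vx)
    qed simp
    then show "map (\<lambda>r. dot r (enc (vx x y) A)) A = vx x y" using h(3,4) by (simp add: map_xr)
  qed (use x unit_checks in auto)
  then show ?thesis using dual_props(3)[OF rows, of "enc x A"] rows by simp
qed

lemma parities: "length x = 8 \<Longrightarrow> two_parity (enc x A) = two_parity x"
proof (rule units_span[where P = "\<lambda>x. two_parity (enc x A) = two_parity x"])
  show "two_parity (enc zv A) = two_parity zv"
  proof -
    have "enc zv A = zv" using rows by (intro enc_zero) (simp_all add: zv_def)
    then show ?thesis by simp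
  qed
  fix x y :: "sym list" assume h: "length x = 8" "length y = 8" "two_parity (enc x A) = two_parity x" "two_parity (enc y A) = two_parity y"
  have "ipar (enc x A) (enc y A) = ipar x (map (\<lambda>r. dot r (enc y A)) A)"
    using h rows by (intro ipar_enc) auto
  also have "\<dots> = ipar x y" using unitary[OF h(2)] dual_props(3)[OF rows, of "enc y A"] rows by simp
  finally show "two_parity (enc (vx x y) A) = two_parity (vx x y)"
    using h rows by (simp add: enc_vx two_parity_vx)
qed (use unit_checks in auto)

lemma doubly_even:
  assumes "length x = 8" "f \<in> set e8" "g \<in> set e8"
  shows "4 dvd vcost f x + vcost g (enc x A)"
proof -
  have y: "length (enc x A) = 8" using rows by simp
  obtain k where k: "vcost f x = (if two_parity x then 2 else 0) + 4 * k" using vcost_e8_parts[OF assms(2,1)] by blast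
  obtain l where l: "vcost g (enc x A) = (if two_parity x then 2 else 0) + 4 * l"
    using vcost_e8_parts[OF assms(3) y] unfolding parities[OF assms(1)] by blast
  have "vcost f x + vcost g (enc x A) = 4 * (k + l + (if two_parity x then 1 else 0))" unfolding k l by simp
  then show ?thesis by (rule dvdI)
qed

lemma one_side:
  assumes chk: "nE 3 (map mkpos B)" "t4s tetrads (map mkpos B)" and B: "rows8 B" "length B = 8" "length x = 8" "x \<noteq> zv"
    and f: "f \<in> set e8" and g: "g \<in> set e8" and w: "vcost f x \<le> 4"
  shows "12 < vcost f x + vcost g (enc x B)"
proof -
  consider "f = f0" | "f = f1" | "f \<in> set tetrads" using f by (auto simp: set_e8)
  then show ?thesis
  proof cases
    case 1 then show ?thesis using check_even_side[OF chk(1) B _ g] w by simp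
  next
    case 2 then show ?thesis using vcost_f1[OF B(3)] w by simp
  next
    case 3
    then have "4 \<le> vcost f x" using vcost_ge[of f x] tetrad_weight length_tetrads B(3) by metis
    then show ?thesis using check_tetrad4_side[OF chk(2) B(1-3) 3 _ g] w by simp
  qed
qed

text \<open>Both blocks of a word have even weight, so in a word of weight at most 12 one block has weight at most 4, or both have weight 6. In the first case this block is even or a tetrad; in the second case either some block is even, or both carry tetrads. By unitarity the role of the two blocks can be exchanged by passing to the conjugate transpose.\<close>
lemma min_cost:
  assumes x: "length x = 8" and f: "f \<in> set e8" and g: "g \<in> set e8" and ne: "x \<noteq> zv \<or> f \<noteq> f0 \<or> g \<noteq> f0"
  shows "12 < vcost f x + vcost g (enc x A)"
proof (cases "x = zv")
  case True
  have e: "enc zv A = zv" using rows by (intro enc_zero) (simp_all add: zv_def)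
  have "\<forall>f\<in>set e8. f \<noteq> f0 \<longrightarrow> 12 < vcost f zv" by (simp add: e8_def f0_def zv_def)
  then show ?thesis using True e ne f g by force
next
  case False
  let ?y = "enc x A"
  have y: "length ?y = 8" using rows by simp
  have ret: "enc ?y (dual A) = x" by (rule unitary[OF x])
  have "?y \<noteq> zv"
  proof
    assume "?y = zv"
    then have "x = enc zv (dual A)" using ret by simp
    also have "\<dots> = zv" using dual_rows by (intro enc_zero) (simp_all add: zv_def)
    finally show False using False by simp
  qed
  note y = y this
  have cL: "nE 3 (map mkpos A)" "t4s tetrads (map mkpos A)" "t6s tetrads (map mkpos A)"
    and cR: "nE 3 (map mkpos (dual A))" "t4s tetrads (map mkpos (dual A))"
    using good by (auto simp: good_def)
  have L: ?thesis if "vcost f x \<le> 4" by (rule one_side[OF cL(1,2) rows x False f g that])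
  have R: ?thesis if "vcost g ?y \<le> 4" using one_side[OF cR dual_rows y g f that] ret by simp
  have ev: "even (vcost f x)" "even (vcost g ?y)" using even_vcost f g x y by auto
  show ?thesis
  proof (rule ccontr)
    assume "\<not> ?thesis"
    moreover from this have "4 < vcost f x" "4 < vcost g ?y" using L R by linarith+
    ultimately have "vcost f x = 6" "vcost g ?y = 6" using ev by presburger+
    moreover from this have "f \<noteq> f1" "g \<noteq> f1" using vcost_f1[OF x] vcost_f1[OF y(1)] by auto
    moreover have "f \<noteq> f0" using check_even_side[OF cL(1) rows x False _ g] calculation by auto
    moreover have "g \<noteq> f0" using check_even_side[OF cR(1) dual_rows y _ f] ret calculation by auto
    ultimately have "f \<in> set tetrads" "g \<in> set tetrads" "vcost f x = 6" "vcost g ?y = 6" using f g by (auto simp: set_e8)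
    then show False using check_tetrad6_side[OF cL(3) rows x] by fastforce
  qed
qed

end


lemma any_iff: "any a b m n ys ps s \<longleftrightarrow> (\<exists>y\<in>set ys. ex a b m n ps (vx s y))"
  by (induction ys) auto

lemma wt2_ne [simp]: "wt u = 2 \<Longrightarrow> wt u \<noteq> 4" by simp

lemma patt_Cons: "patt a b (u # us) \<longleftrightarrow> u = s0 \<and> patt a b us \<or> wt u = 2 \<and> (\<exists>a'. a = Suc a' \<and> patt a' b us) \<or> wt u = 4 \<and> (\<exists>b'. b = Suc b' \<and> patt a b' us)"
  using wt_cases[of u] wt0[of u] by (auto simp: patt_def)

lemma patt_0: "patt 0 0 us \<longleftrightarrow> set us \<subseteq> {s0}"
  by (induction us) (auto simp: patt_Cons, auto simp: patt_def)

lemma ex_Cons: "(\<exists>us. length us = Suc n \<and> P us) \<longleftrightarrow> (\<exists>u us. length us = n \<and> P (u # us))"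
proof
  assume "\<exists>us. length us = Suc n \<and> P us"
  then obtain us where us: "length us = Suc n" "P us" by blast
  obtain u us' where "us = u # us'" "length us' = n" using us(1) by (auto simp: length_Suc_conv)
  then show "\<exists>u us. length us = n \<and> P (u # us)" using us(2) by blast
next
  assume "\<exists>u us. length us = n \<and> P (u # us)"
  then obtain u us where "length (u # us) = Suc n" "P (u # us)" by auto
  then show "\<exists>us. length us = Suc n \<and> P us" by blast
qed

lemma ex_split: "(\<exists>u us. L us \<and> (u = z \<and> P us \<or> V u \<and> Q us \<or> W u \<and> R us) \<and> S u us) \<longleftrightarrow>
  (\<exists>us. L us \<and> P us \<and> S z us) \<or> (\<exists>u. V u \<and> (\<exists>us. L us \<and> Q us \<and> S u us)) \<or> (\<exists>u. W u \<and> (\<exists>us. L us \<and> R us \<and> S u us))"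
  by blast

text \<open>The search is exhaustive.\<close>
lemma ex_iff: "rows8 rs \<Longrightarrow> length s = 8 \<Longrightarrow>
  ex a b m n (map mkpos rs) s \<longleftrightarrow> (\<exists>us. length us = length rs \<and> patt a b us \<and> patt m n (vx s (enc us rs)))"
proof (induction rs arbitrary: a b s)
  case Nil
  then show ?case by (cases a; cases b) (auto simp: patt_def)
next
  case (Cons r rs)
  have l: "length r = 8" "rows8 rs" using Cons.prems by auto
  let ?Q = "\<lambda>a b s. \<exists>us. length us = length rs \<and> patt a b us \<and> patt m n (vx s (enc us rs))"
  have IH: "ex a b m n (map mkpos rs) s \<longleftrightarrow> ?Q a b s" if "length s = 8" for a b s using Cons.IH[OF l(2) that] .
  have A2: "any a b m n (V2 r) (map mkpos rs) s \<longleftrightarrow> (\<exists>u. wt u = 2 \<and> ?Q a b (vx s (map (mu u) r)))" for a b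
    unfolding any_iff mu_image2[symmetric] using l Cons.prems(2) by (auto simp: IH)
  have A4: "any a b m n (V4 r) (map mkpos rs) s \<longleftrightarrow> (\<exists>u. wt u = 4 \<and> ?Q a b (vx s (map (mu u) r)))" for a b
    unfolding any_iff mu_image4[symmetric] using l Cons.prems(2) by (auto simp: IH)
  have z: "map (mu s0) r = zv" using l by (simp add: map_mu_s0 zv_replicate)
  have "(\<exists>us. length us = length (r # rs) \<and> patt a b us \<and> patt m n (vx s (enc us (r # rs)))) \<longleftrightarrow>
    ?Q a b s \<or> (\<exists>u. wt u = 2 \<and> (\<exists>us. length us = length rs \<and> (\<exists>a'. a = Suc a' \<and> patt a' b us) \<and> patt m n (vx (vx s (map (mu u) r)) (enc us rs)))) \<or>
    (\<exists>u. wt u = 4 \<and> (\<exists>us. length us = length rs \<and> (\<exists>b'. b = Suc b' \<and> patt a b' us) \<and> patt m n (vx (vx s (map (mu u) r)) (enc us rs))))"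
    unfolding list.size(4) add_0_right add_Suc_right ex_Cons patt_Cons ex_split using l by (simp add: z vx_assoc)
  also have "\<dots> \<longleftrightarrow> ex a b m n (map mkpos (r # rs)) s"
  proof (cases a)
    case 0
    show ?thesis
    proof (cases b)
      case b0: 0
      have "?Q 0 0 s \<longleftrightarrow> patt m n s"
      proof
        assume "?Q 0 0 s"
        then obtain us where "length us = length rs" "set us \<subseteq> {s0}" "patt m n (vx s (enc us rs))" by (auto simp: patt_0)
        then show "patt m n s" using l Cons.prems(2) by (simp add: enc_zero)
      next
        assume p: "patt m n s"
        have "enc (replicate (length rs) s0) rs = zv" by (rule enc_zero[OF l(2)]) auto
        then show "?Q 0 0 s" using p l Cons.prems(2)
          by (intro exI[of _ "replicate (length rs) s0"]) (auto simp: patt_0)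
      qed
      then show ?thesis using 0 b0 by simp
    next
      case (Suc b') then show ?thesis using 0 Cons.prems(2) by (simp add: mkpos_V IH A4)
    qed
  next
    case (Suc a')
    then show ?thesis using Cons.prems(2) by (cases b) (simp_all add: mkpos_V IH A2 A4)
  qed
  finally show ?case by simp
qed

lemma exn_normed: "rows8 rs \<Longrightarrow>
  exn a b m n (map mkpos rs) \<longleftrightarrow> (\<exists>us. length us = length rs \<and> normed us \<and> patt a b us \<and> patt m n (enc us rs))"
proof (induction rs)
  case (Cons r rs)
  have l: "length r = 8" "rows8 rs" using Cons.prems by auto
  let ?N = "\<exists>us. length us = length rs \<and> normed us \<and> patt a b us \<and> patt m n (enc us rs)"
  let ?Q = "\<lambda>u a b. \<exists>us. length us = length rs \<and> patt a b us \<and> patt m n (vx (map (mu u) r) (enc us rs))"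
  have IH: "exn a b m n (map mkpos rs) \<longleftrightarrow> ?N" using Cons.IH l by simp
  have A2: "any a b m n [V2 r ! 0, V2 r ! 5] (map mkpos rs) zv \<longleftrightarrow> ?Q s3 a b \<or> ?Q s5 a b" for a b
    unfolding any_iff using l by (simp add: V_rep[symmetric] ex_iff)
  have A4: "any a b m n [V4 r ! 0] (map mkpos rs) zv \<longleftrightarrow> ?Q se a b" for a b
    unfolding any_iff using l by (simp add: V_rep[symmetric] ex_iff)
  have z: "map (mu s0) r = zv" using l by (simp add: map_mu_s0 zv_replicate)
  have e: "normed (u # us) \<and> patt a b (u # us) \<and> X \<longleftrightarrow> (u = s0 \<and> (normed us \<and> patt a b us) \<or>
    (u = s3 \<or> u = s5) \<and> (\<exists>a'. a = Suc a' \<and> patt a' b us) \<or> u = se \<and> (\<exists>b'. b = Suc b' \<and> patt a b' us)) \<and> X" for u us X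
    unfolding patt_Cons by (cases u) (simp_all add: rep_def)
  have "(\<exists>us. length us = length (r # rs) \<and> normed us \<and> patt a b us \<and> patt m n (enc us (r # rs))) \<longleftrightarrow>
    ?N \<or> (\<exists>u. (u = s3 \<or> u = s5) \<and> (\<exists>us. length us = length rs \<and> (\<exists>a'. a = Suc a' \<and> patt a' b us) \<and> patt m n (vx (map (mu u) r) (enc us rs)))) \<or>
    (\<exists>u. u = se \<and> (\<exists>us. length us = length rs \<and> (\<exists>b'. b = Suc b' \<and> patt a b' us) \<and> patt m n (vx (map (mu u) r) (enc us rs))))"
    unfolding list.size(4) add_0_right add_Suc_right ex_Cons e ex_split using l by (simp add: z)
  also have "\<dots> \<longleftrightarrow> exn a b m n (map mkpos (r # rs))"
  proof (cases "a = 0 \<and> b = 0")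
    case True
    have "\<not> normed us" if "set us \<subseteq> {s0}" for us using that by (induction us) auto
    then show ?thesis using True by (auto simp: patt_0)
  next
    case False
    then show ?thesis using IH by (cases a; cases b) (simp_all add: mkpos_V A2 A4 ex_disj_distrib conj_disj_distribR del: any.simps)
  qed
  finally show ?case by simp
qed simp

lemma patt_rv_pow [simp]: "patt a b ((rv ^^ n) x) = patt a b x"
proof -
  have "n2 ((rv ^^ n) x) = n2 x" "n4 ((rv ^^ n) x) = n4 x" unfolding rv_pow by (induction x) auto
  then show ?thesis by (simp add: patt_def)
qed

lemma exn_iff: "rows8 rs \<Longrightarrow>
  exn a b m n (map mkpos rs) \<longleftrightarrow> (\<exists>us. length us = length rs \<and> \<not> set us \<subseteq> {s0} \<and> patt a b us \<and> patt m n (enc us rs))"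
proof -
  assume R: "rows8 rs"
  have nz: "\<not> set us \<subseteq> {s0}" if "normed us" for us using that by (induction us) (auto split: if_splits simp: rep_def)
  have "\<exists>us'. length us' = length rs \<and> normed us' \<and> patt a b us' \<and> patt m n (enc us' rs)"
    if h: "length us = length rs" "\<not> set us \<subseteq> {s0}" "patt a b us" "patt m n (enc us rs)" for us
  proof -
    obtain k where "normed ((rv ^^ k) us)" using rotate_to_normed[OF h(2)] by blast
    then show ?thesis using h R by (intro exI[of _ "(rv ^^ k) us"]) (simp add: enc_rv_pow)
  qed
  then show ?thesis unfolding exn_normed[OF R] using nz by blast
qed

lemma (in good_matrix) enc_bij: "bij_betw (\<lambda>x. enc x A) {x. length x = 8} {x. length x = 8}"
proof -
  have fin: "finite {x :: sym list. length x = 8}"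
  proof -
    have u: "(UNIV :: sym set) = {s0,s1,s2,s3,s4,s5,s6,s7,s8,s9,sa,sb,sc,sd,se,sf}"
      by (rule set_eqI, rename_tac x, case_tac x) auto
    have "finite (UNIV :: sym set)" unfolding u by simp
    then show ?thesis using finite_lists_length_eq[of UNIV 8] by simp
  qed
  have inj: "inj_on (\<lambda>x. enc x A) {x. length x = 8}" by (rule inj_on_inverseI[where g = "\<lambda>y. enc y (dual A)"]) (simp add: unitary)
  moreover have "(\<lambda>x. enc x A) ` {x. length x = 8} = {x. length x = 8}"
    by (rule endo_inj_surj[OF fin _ inj]) (use rows in auto)
  ultimately show ?thesis by (simp add: bij_betw_def)
qed

lemma (in good_matrix) shows_pattern_iff:
  "shows_pattern (a, b, m, n) A \<longleftrightarrow> (\<exists>x. length x = 8 \<and> x \<noteq> zv \<and>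
     (patt a b x \<and> patt m n (enc x A) \<or> patt a b (enc x A) \<and> patt m n x))"
proof -
  have z: "length x = 8 \<Longrightarrow> \<not> set x \<subseteq> {s0} \<longleftrightarrow> x \<noteq> zv" for x using not_zv by (auto simp: zv_def)
  have ez: "enc zv B = zv" if "rows8 B" for B using that by (intro enc_zero) (simp_all add: zv_def)
  have nz: "enc x A \<noteq> zv \<longleftrightarrow> x \<noteq> zv" if "length x = 8" for x
    using unitary[OF that] ez rows dual_rows by metis
  have L: "exn a b m n (map mkpos A) \<longleftrightarrow> (\<exists>x. length x = 8 \<and> x \<noteq> zv \<and> patt a b x \<and> patt m n (enc x A))"
    unfolding exn_iff[OF rows(1)] rows(2) using z by blast
  have "exn a b m n (map mkpos (dual A)) \<longleftrightarrow> (\<exists>y\<in>{y. length y = 8}. y \<noteq> zv \<and> patt a b y \<and> patt m n (enc y (dual A)))"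
    unfolding exn_iff[OF dual_rows(1)] dual_rows(2) using z by blast
  also have "\<dots> \<longleftrightarrow> (\<exists>x\<in>{x. length x = 8}. enc x A \<noteq> zv \<and> patt a b (enc x A) \<and> patt m n (enc (enc x A) (dual A)))"
  proof -
    have im: "(\<lambda>x. enc x A) ` {x. length x = 8} = {x. length x = 8}" using enc_bij by (simp add: bij_betw_def)
    show ?thesis by (subst im[symmetric]) (simp only: bex_simps)
  qed
  also have "\<dots> \<longleftrightarrow> (\<exists>x. length x = 8 \<and> x \<noteq> zv \<and> patt a b (enc x A) \<and> patt m n x)"
    using nz unitary by auto
  finally have R: "exn a b m n (map mkpos (dual A)) \<longleftrightarrow> (\<exists>x. length x = 8 \<and> x \<noteq> zv \<and> patt a b (enc x A) \<and> patt m n x)" .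
  have "shows_pattern (a, b, m, n) A \<longleftrightarrow> exn a b m n (map mkpos A) \<or> exn a b m n (map mkpos (dual A))"
    by (simp add: shows_pattern_def)
  then show ?thesis unfolding L R by blast
qed

section \<open>The code of a unitary matrix\<close>

definition e8_sets :: "nat set set" where "e8_sets = (\<lambda>f. {i. i < 8 \<and> f ! i}) ` set e8"

lemma e8_sets_iff: "U \<subseteq> {..<8} \<Longrightarrow> U \<in> e8_sets \<longleftrightarrow> map (\<lambda>i. i \<in> U) [0..<8] \<in> set e8"
proof
  assume U: "U \<subseteq> {..<8}" and "U \<in> e8_sets"
  then obtain f where f: "f \<in> set e8" "U = {i. i < 8 \<and> f ! i}" by (auto simp: e8_sets_def)
  have "map (\<lambda>i. i \<in> U) [0..<8] = f" using f(2) length_e8[OF f(1)] by (intro nth_equalityI) auto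
  then show "map (\<lambda>i. i \<in> U) [0..<8] \<in> set e8" using f(1) by simp
next
  assume U: "U \<subseteq> {..<8}" and m: "map (\<lambda>i. i \<in> U) [0..<8] \<in> set e8"
  have "U = {i. i < 8 \<and> map (\<lambda>i. i \<in> U) [0..<8] ! i}" using U by auto
  then show "U \<in> e8_sets" using m unfolding e8_sets_def by blast
qed

lemma e8_sets_triple:
  assumes "p < 8" "q < 8" "r < 8" shows "\<exists>T\<in>e8_sets. T \<subseteq> {..<8} \<and> card T = 4 \<and> {p, q, r} \<subseteq> T"
proof -
  obtain t where t: "t \<in> set tetrads" "t ! p" "t ! q" "t ! r" using tetrads_triple[OF assms] by blast
  let ?T = "{i. i < 8 \<and> t ! i}"
  have "card ?T = 4" using tetrad_weight[OF t(1)] length_tetrads[OF t(1)] by (simp add: length_filter_conv_card)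
  moreover have "?T \<in> e8_sets" unfolding e8_sets_def using t(1) by (auto simp: set_e8)
  ultimately show ?thesis using t assms by (intro bexI[of _ ?T]) auto
qed

locale array =
  fixes pt :: "nat \<Rightarrow> nat \<Rightarrow> 'a::finite" and \<sigma> :: "'a \<Rightarrow> 'a"
  assumes bij_pt: "bij_betw (\<lambda>(k, a). pt k a) ({..<16} \<times> {..<5}) UNIV"
    and \<sigma>_pt: "\<And>k a. k < 16 \<Longrightarrow> a < 5 \<Longrightarrow> \<sigma> (pt k a) = pt k ((a + 1) mod 5)"

sublocale array \<subseteq> coordinates pt \<sigma> e8_sets
proof
  have "map (\<lambda>i. i \<in> {}) [0..<8] = f0" unfolding upt_8 by (simp add: f0_def)
  then show "{} \<in> e8_sets" using e8_sets_iff[of "{}"] by (simp add: set_e8)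
qed (use bij_pt \<sigma>_pt e8_sets_triple in auto)

text \<open>Any bijection between the grid and the 80 coordinates will do.\<close>
lemma array_exists:
  assumes "CARD('a::finite) = 80"
  shows "\<exists>pt (\<sigma> :: 'a \<Rightarrow> 'a). array pt \<sigma>"
proof -
  let ?S = "{..<16::nat} \<times> {..<5::nat}"
  have "card ?S = card (UNIV :: 'a set)" using assms by (simp add: card_cartesian_product)
  then obtain h :: "nat \<times> nat \<Rightarrow> 'a" where h: "bij_betw h ?S UNIV"
    using finite_same_card_bij[of ?S "UNIV :: 'a set"] by auto
  define \<sigma> where "\<sigma> x = (case inv_into ?S h x of (k, a) \<Rightarrow> h (k, (a + 1) mod 5))" for x
  have "array (\<lambda>k a. h (k, a)) \<sigma>"
  proof
    show "bij_betw (\<lambda>(k, a). h (k, a)) ?S UNIV" using h by simp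
    fix k a :: nat assume "k < 16" "a < 5"
    then have "inv_into ?S h (h (k, a)) = (k, a)" using h by (intro inv_into_f_f) (auto simp: bij_betw_def)
    then show "\<sigma> (h (k, a)) = h (k, (a + 1) mod 5)" by (simp add: \<sigma>_def)
  qed
  then show ?thesis by blast
qed

lemma card_has: "card {a. a < 5 \<and> has x a \<noteq> b} = cost b x"
proof -
  have "length (cyc x) = 5" by (cases x) simp_all
  then have "card {a. a < 5 \<and> has x a \<noteq> b} = length (filter (\<lambda>c. c \<noteq> b) (cyc x))"
    by (simp add: length_filter_conv_card has_def)
  then show ?thesis by (cases b; cases x) simp_all
qed

lemma odd_cost: "odd (cost b x) = b" by (cases b; cases x) simp_all

lemma vcost_sum: "length f = length x \<Longrightarrow> vcost f x = (\<Sum>k<length x. cost (f ! k) (x ! k))"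
  by (induction f x rule: list_induct2) (simp_all add: sum.lessThan_Suc_shift del: sum.lessThan_Suc)

lemma vcost_append: "length f = length x \<Longrightarrow> vcost (f @ g) (x @ y) = vcost f x + vcost g y"
  by (induction f x rule: list_induct2) simp_all

lemma vx_append: "length x = length x' \<Longrightarrow> vx (x @ y) (x' @ y') = vx x x' @ vx y y'"
  by (induction x x' rule: list_induct2) simp_all
lemma xor_list_append: "length x = length x' \<Longrightarrow> xor_list (x @ y) (x' @ y') = xor_list x x' @ xor_list y y'"
  by (induction x x' rule: list_induct2) simp_all

lemma UNIV_sym: "(UNIV :: sym set) = {s0,s1,s2,s3,s4,s5,s6,s7,s8,s9,sa,sb,sc,sd,se,sf}"
  by (rule set_eqI, rename_tac x, case_tac x) auto

lemma card_vectors: "finite {x :: sym list. length x = 8}" "card {x :: sym list. length x = 8} = 16 ^ 8"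
proof -
  have c: "finite (UNIV :: sym set)" "card (UNIV :: sym set) = 16" by (simp_all add: UNIV_sym)
  show "finite {x :: sym list. length x = 8}" using finite_lists_length_eq[OF c(1), of 8] by simp
  show "card {x :: sym list. length x = 8} = 16 ^ 8" using card_lists_length_eq[OF c(1), of 8] unfolding c(2) by simp
qed

lemma card_e8: "card (set e8) = 16"
  using distinct_card[OF distinct_e8] by (simp add: e8_def)

definition pattern_mset :: "nat \<Rightarrow> nat \<Rightarrow> nat multiset" where
  "pattern_mset a b = replicate_mset a 2 + replicate_mset b 4 + replicate_mset (8 - a - b) 0"

definition block_weights :: "bool list \<Rightarrow> sym list \<Rightarrow> nat multiset" where
  "block_weights f x = image_mset (\<lambda>k. cost (f ! k) (x ! k)) (mset_set {..<8})"

lemma wt_mset: "\<exists>m. n2 x + n4 x + m = length x \<and> mset (map wt x) = replicate_mset (n2 x) 2 + replicate_mset (n4 x) 4 + replicate_mset m 0"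
proof (induction x)
  case (Cons u x)
  then obtain m where m: "n2 x + n4 x + m = length x" "mset (map wt x) = replicate_mset (n2 x) 2 + replicate_mset (n4 x) 4 + replicate_mset m 0" by blast
  consider "wt u = 0" | "wt u = 2" | "wt u = 4" by (cases u) simp_all
  then show ?case
  proof cases
    case 1 then show ?thesis using m by (intro exI[of _ "Suc m"]) simp
  qed (use m in \<open>auto intro!: exI[of _ m]\<close>)
qed simp

lemma block_weights_f0: "length x = 8 \<Longrightarrow> block_weights f0 x = pattern_mset (n2 x) (n4 x)"
proof -
  assume x: "length x = 8"
  have "cost (f0 ! k) (x ! k) = wt (x ! k)" if "k < 8" for k
  proof -
    have "f0 ! k = False" using that nth_replicate[of k 8 False] by (simp add: f0_replicate)
    then show ?thesis by simp
  qed
  then have "block_weights f0 x = image_mset (\<lambda>k. wt (x ! k)) (mset_set {..<8})"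
    unfolding block_weights_def by (intro image_mset_cong) auto
  also have "\<dots> = mset (map (\<lambda>k. wt (x ! k)) [0..<8])" by (simp add: lessThan_atLeast0)
  also have "map (\<lambda>k. wt (x ! k)) [0..<8] = map wt x" using x by (intro nth_equalityI) auto
  finally obtain m where m: "n2 x + n4 x + m = 8" "block_weights f0 x = replicate_mset (n2 x) 2 + replicate_mset (n4 x) 4 + replicate_mset m 0"
    using wt_mset[of x] x by auto
  have "8 - n2 x - n4 x = m" using m(1) by linarith
  then show ?thesis using m(2) by (simp add: pattern_mset_def)
qed

lemma pattern_mset_inj: "pattern_mset a b = pattern_mset a' b' \<longleftrightarrow> a = a' \<and> b = b'"
proof
  assume h: "pattern_mset a b = pattern_mset a' b'"
  have "count (pattern_mset a b) 2 = a" "count (pattern_mset a b) 4 = b" for a b by (simp_all add: pattern_mset_def)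
  then show "a = a' \<and> b = b'" using h by metis
qed simp

lemma block_weights_pattern:
  assumes "length x = 8" "length f = 8"
  shows "block_weights f x = pattern_mset a b \<longleftrightarrow> f = f0 \<and> patt a b x"
proof
  assume h: "block_weights f x = pattern_mset a b"
  have "\<not> f ! k" if "k < 8" for k
  proof -
    have "cost (f ! k) (x ! k) \<in># block_weights f x" using that by (simp add: block_weights_def)
    then have "even (cost (f ! k) (x ! k))" unfolding h pattern_mset_def by (auto split: if_splits)
    then show ?thesis using odd_cost[of "f ! k" "x ! k"] by blast
  qed
  then have "f = replicate 8 False" using assms(2) by (intro nth_equalityI) auto
  then have "f = f0" by (simp only: f0_replicate)
  then show "f = f0 \<and> patt a b x" using h block_weights_f0[OF assms(1)] by (simp add: pattern_mset_inj patt_def)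
next
  assume "f = f0 \<and> patt a b x"
  then show "block_weights f x = pattern_mset a b" using block_weights_f0[OF assms(1)] by (simp add: patt_def)
qed

lemma pair_mset_eq: "{#a, b#} = {#c, d#} \<longleftrightarrow> a = c \<and> b = d \<or> a = d \<and> b = c"
  by (auto simp: add_eq_conv_ex)

lemma half_n2_n4: "half x = n2 x + 2 * n4 x"
proof (induction x)
  case (Cons u x) then show ?case using wt_cases[of u] by auto
qed simp

text \<open>Seven profiles that suffice to separate the matrices below.\<close>
definition patterns :: "(nat \<times> nat \<times> nat \<times> nat) list" where
  "patterns = [(2,0,2,2),(1,1,1,7),(0,2,2,4),(1,1,1,6),(0,1,6,2),(0,2,6,0),(1,0,7,1)]"

definition signature :: "sym list list \<Rightarrow> bool list" where
  "signature A = map (\<lambda>P. shows_pattern P A) patterns"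

context array begin

definition word :: "sym list \<Rightarrow> bool list \<Rightarrow> 'a set" where
  "word e f = {pt k a | k a. k < 16 \<and> a < 5 \<and> has (e ! k) a \<noteq> f ! k}"

lemma mem_word: "k < 16 \<Longrightarrow> a < 5 \<Longrightarrow> pt k a \<in> word e f \<longleftrightarrow> has (e ! k) a \<noteq> f ! k"
  unfolding word_def by (fastforce simp: pt_inj)

lemma set_eq_pt: "(\<And>k a. k < 16 \<Longrightarrow> a < 5 \<Longrightarrow> pt k a \<in> X \<longleftrightarrow> pt k a \<in> Y) \<Longrightarrow> X = Y"
  by (rule set_eqI) (metis pt_surj)

definition code_of :: "sym list list \<Rightarrow> 'a set set" where
  "code_of A = {word (x @ enc x A) (f @ g) | x f g. length x = 8 \<and> f \<in> set e8 \<and> g \<in> set e8}"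

text \<open>Words are added by adding symbols and flags.\<close>
lemma word_sdiff:
  assumes "length e = 16" "length e' = 16" "length f = 16" "length f' = 16"
  shows "word (vx e e') (xor_list f f') = word e f \<triangle> word e' f'"
  by (rule set_eq_pt) (use assms in \<open>auto simp: mem_word nth_vx nth_xor_list has_xr\<close>)

lemma word_cycle: "k < 16 \<Longrightarrow> card (word e f \<inter> cycle k) = cost (f ! k) (e ! k)"
proof -
  assume k: "k < 16"
  have "word e f \<inter> cycle k = pt k ` {a. a < 5 \<and> has (e ! k) a \<noteq> f ! k}"
    using k by (auto simp: cycle_def mem_word)
  moreover have "inj_on (pt k) {a. a < 5 \<and> has (e ! k) a \<noteq> f ! k}" using k by (auto simp: inj_on_def pt_inj)
  ultimately show ?thesis by (simp only: card_image card_has)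
qed

lemma card_word: "length e = 16 \<Longrightarrow> length f = 16 \<Longrightarrow> card (word e f) = vcost f e"
proof -
  assume l: "length e = 16" "length f = 16"
  have "word e f = (\<Union>k\<in>{..<16}. word e f \<inter> cycle k)" by (auto simp: word_def cycle_def)
  also have "card \<dots> = (\<Sum>k\<in>{..<16}. card (word e f \<inter> cycle k))"
    by (rule card_UN_disjoint) (use cycle_disjoint in auto)
  also have "\<dots> = vcost f e" using l by (simp add: vcost_sum word_cycle)
  finally show ?thesis .
qed

lemma word_inj:
  assumes "length e = 16" "length e' = 16" "length f = 16" "length f' = 16" "word e f = word e' f'"
  shows "e = e' \<and> f = f'"
proof -
  have f: "f ! k = f' ! k" if "k < 16" for k
    using word_cycle[OF that, of e f] word_cycle[OF that, of e' f'] assms(5) odd_cost by metis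
  have "e ! k = e' ! k" if k: "k < 16" for k
  proof (rule has_eqI)
    fix a :: nat assume "a < 5"
    then show "has (e ! k) a = has (e' ! k) a" using mem_word[OF k, of a e f] mem_word[OF k, of a e' f'] assms(5) f[OF k] by auto
  qed
  then show ?thesis using f assms(1-4) by (auto intro: nth_equalityI)
qed

lemma profile_word:
  assumes "length x = 8" "length y = 8" "length f = 8" "length g = 8"
  shows "block_profile (word (x @ y) (f @ g)) = {# block_weights f x, block_weights g y #}"
proof -
  have b: "mset_set (block b) = image_mset (\<lambda>k. 8 * b + k) (mset_set {..<8})" for b
  proof -
    have "block b = (\<lambda>k. 8 * b + k) ` {..<8}"
    proof (rule set_eqI)
      fix x
      show "x \<in> block b \<longleftrightarrow> x \<in> (\<lambda>k. 8 * b + k) ` {..<8}"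
      proof
        assume "x \<in> block b"
        then have "x = 8 * b + (x - 8 * b)" "x - 8 * b \<in> {..<8}" by (auto simp: block_def)
        then show "x \<in> (\<lambda>k. 8 * b + k) ` {..<8}" by (rule image_eqI)
      qed (auto simp: block_def)
    qed
    then show ?thesis by (simp add: image_mset_mset_set)
  qed
  have "image_mset (\<lambda>k. card (word (x @ y) (f @ g) \<inter> cycle k)) (mset_set (block 0)) = block_weights f x"
    unfolding b block_weights_def image_mset.compositionality o_def
    by (rule image_mset_cong) (use assms in \<open>auto simp: word_cycle nth_append\<close>)
  moreover have "image_mset (\<lambda>k. card (word (x @ y) (f @ g) \<inter> cycle k)) (mset_set (block 1)) = block_weights g y"
    unfolding b block_weights_def image_mset.compositionality o_def
    by (rule image_mset_cong) (use assms in \<open>auto simp: word_cycle nth_append\<close>)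
  ultimately show ?thesis by (simp add: block_profile_def)
qed

lemma \<sigma>_word: "length e = 16 \<Longrightarrow> \<sigma> ` word e f = word (rv e) f"
proof -
  assume e: "length e = 16"
  have rot: "has (rot x) ((a + 1) mod 5) = has x a" if "a < 5" for x a
  proof -
    have "a = 0 \<or> a = 1 \<or> a = 2 \<or> a = 3 \<or> a = 4" using that by presburger
    then show ?thesis by (elim disjE; cases x; simp add: has_def)
  qed
  have "\<sigma> ` word e f \<subseteq> word (rv e) f"
  proof
    fix u assume "u \<in> \<sigma> ` word e f"
    then obtain k a where ka: "u = \<sigma> (pt k a)" "k < 16" "a < 5" "has (e ! k) a \<noteq> f ! k" by (auto simp: word_def)
    have "has (rv e ! k) ((a + 1) mod 5) = has (e ! k) a" using rot[OF ka(3)] ka(2) e by (simp add: rv_def)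
    then have "pt k ((a + 1) mod 5) \<in> word (rv e) f" using ka mem_word[of k "(a + 1) mod 5"] by simp
    then show "u \<in> word (rv e) f" using ka by (simp add: \<sigma>_pt)
  qed
  moreover have "word (rv e) f \<subseteq> \<sigma> ` word e f"
  proof
    fix u assume u: "u \<in> word (rv e) f"
    obtain k b where kb: "u = pt k b" "k < 16" "b < 5" by (rule pt_surj)
    let ?a = "(b + 4) mod 5"
    have b: "(?a + 1) mod 5 = b" "?a < 5" using kb(3) by presburger+
    then have "\<sigma> (pt k ?a) = u" using kb by (simp add: \<sigma>_pt)
    moreover have "has (e ! k) ?a \<noteq> f ! k"
      using u rot[OF b(2), of "e ! k"] kb e unfolding b(1) by (simp add: mem_word rv_def)
    then have "pt k ?a \<in> word e f" using kb b by (simp add: mem_word)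
    ultimately show "u \<in> \<sigma> ` word e f" by blast
  qed
  ultimately show ?thesis by blast
qed

lemma bij_\<sigma>: "bij \<sigma>"
proof -
  have "surj \<sigma>"
  proof
    show "UNIV \<subseteq> range \<sigma>"
    proof
      fix u obtain k b where kb: "u = pt k b" "k < 16" "b < 5" by (rule pt_surj)
      have b: "((b + 4) mod 5 + 1) mod 5 = b" "(b + 4) mod 5 < 5" using kb(3) by presburger+
      then have "\<sigma> (pt k ((b + 4) mod 5)) = u" using kb by (simp add: \<sigma>_pt)
      then show "u \<in> range \<sigma>" by blast
    qed
  qed simp
  then show ?thesis by (simp add: bij_def finite_UNIV_surj_inj)
qed

end

locale code_array = array pt \<sigma> + good_matrix A
  for pt :: "nat \<Rightarrow> nat \<Rightarrow> 'a::finite" and \<sigma> and A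
begin

lemma in_code: "length x = 8 \<Longrightarrow> f \<in> set e8 \<Longrightarrow> g \<in> set e8 \<Longrightarrow> word (x @ enc x A) (f @ g) \<in> code_of A"
  unfolding code_of_def by blast

lemma codeE:
  assumes "X \<in> code_of A"
  obtains x f g where "X = word (x @ enc x A) (f @ g)" "length x = 8" "f \<in> set e8" "g \<in> set e8" "length f = 8" "length g = 8" "length (enc x A) = 8"
proof -
  obtain x f g where h: "X = word (x @ enc x A) (f @ g)" "length x = 8" "f \<in> set e8" "g \<in> set e8"
    using assms by (auto simp: code_of_def)
  show thesis by (rule that[OF h length_e8[OF h(3)] length_e8[OF h(4)]]) (simp add: rows)
qed

lemma enc_zv: "enc zv A = zv"
  using rows by (intro enc_zero) (simp_all add: zv_def)

lemma word_zero: "word (zv @ zv) (f0 @ f0) = {}"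
proof -
  have "card (word (zv @ zv) (f0 @ f0)) = 0"
    by (subst card_word) (simp_all add: zv_def f0_def)
  then show ?thesis by simp
qed

lemma linear_code: "linear (code_of A)"
  unfolding linear_def
proof (intro conjI ballI)
  have "f0 \<in> set e8" by (simp add: set_e8)
  then show "{} \<in> code_of A" using in_code[of zv f0 f0] by (simp add: enc_zv word_zero)
  fix X Y assume "X \<in> code_of A"
  then obtain x f g where X: "X = word (x @ enc x A) (f @ g)" "length x = 8" "f \<in> set e8" "g \<in> set e8" "length f = 8" "length g = 8" "length (enc x A) = 8"
    by (rule codeE)
  assume "Y \<in> code_of A"
  then obtain y f' g' where Y: "Y = word (y @ enc y A) (f' @ g')" "length y = 8" "f' \<in> set e8" "g' \<in> set e8" "length f' = 8" "length g' = 8" "length (enc y A) = 8"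
    by (rule codeE)
  have "X \<triangle> Y = word (vx (x @ enc x A) (y @ enc y A)) (xor_list (f @ g) (f' @ g'))"
    unfolding X(1) Y(1) by (rule word_sdiff[symmetric]) (use X Y in simp_all)
  also have "\<dots> = word (vx x y @ enc (vx x y) A) (xor_list f f' @ xor_list g g')"
    using X Y rows by (simp add: vx_append xor_list_append enc_vx)
  also have "\<dots> \<in> code_of A" using X Y by (intro in_code e8_closed) simp_all
  finally show "X \<triangle> Y \<in> code_of A" .
qed

lemma card_codeword: "length x = 8 \<Longrightarrow> f \<in> set e8 \<Longrightarrow> g \<in> set e8 \<Longrightarrow> card (word (x @ enc x A) (f @ g)) = vcost f x + vcost g (enc x A)"
  using length_e8[of f] length_e8[of g] rows by (simp add: card_word vcost_append)

text \<open>On each block the weight modulo 4 depends only on the number of symbols of weight 2, and the parities of these numbers on the two blocks agree.\<close>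
lemma weight_dvd: "X \<in> code_of A \<Longrightarrow> 4 dvd card X"
  by (erule codeE) (simp add: card_codeword doubly_even)

lemma weight_min: "X \<in> code_of A \<Longrightarrow> X \<noteq> {} \<Longrightarrow> 16 \<le> card X"
proof -
  assume X: "X \<in> code_of A" "X \<noteq> {}"
  obtain x f g where x: "X = word (x @ enc x A) (f @ g)" "length x = 8" "f \<in> set e8" "g \<in> set e8"
    using X(1) by (rule codeE)
  have "x \<noteq> zv \<or> f \<noteq> f0 \<or> g \<noteq> f0" using X(2) x(1) enc_zv word_zero by auto
  then have "12 < card X" using min_cost[OF x(2-4)] x by (simp add: card_codeword)
  moreover have "4 dvd card X" by (rule weight_dvd[OF X(1)])
  ultimately show ?thesis by presburger
qed

text \<open>A linear doubly-even code is self-orthogonal.\<close>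
lemma even_inter: "X \<in> code_of A \<Longrightarrow> Y \<in> code_of A \<Longrightarrow> even (card (X \<inter> Y))"
proof -
  assume h: "X \<in> code_of A" "Y \<in> code_of A"
  then have "4 dvd card X" "4 dvd card Y" "4 dvd card (X \<triangle> Y)" using weight_dvd linear_sdiff[OF linear_code] by blast+
  moreover have "card (X \<triangle> Y) + 2 * card (X \<inter> Y) = card X + card Y" by (rule card_sdiff) auto
  ultimately show ?thesis by presburger
qed

lemma codeword_inj:
  assumes "length x = 8" "length y = 8" "f \<in> set e8" "g \<in> set e8" "length f' = 8" "length g' = 8" "length y' = 8"
    "word (x @ enc x A) (f @ g) = word (y @ y') (f' @ g')"
  shows "x = y \<and> enc x A = y' \<and> f = f' \<and> g = g'"
proof -
  have l: "length f = 8" "length g = 8" "length (enc x A) = 8" using assms length_e8 rows by auto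
  have e: "x @ enc x A = y @ y' \<and> f @ g = f' @ g'" by (rule word_inj) (use assms l in simp_all)
  have 1: "x = y" using arg_cong[OF conjunct1[OF e], of "take 8"] assms(1,2) by simp
  have 2: "enc x A = y'" using arg_cong[OF conjunct1[OF e], of "drop 8"] assms(1,2) by simp
  have 3: "f = f'" using arg_cong[OF conjunct2[OF e], of "take 8"] assms(5) l(1) by simp
  have 4: "g = g'" using arg_cong[OF conjunct2[OF e], of "drop 8"] assms(5) l(1) by simp
  show ?thesis by (intro conjI 1 2 3 4)
qed

text \<open>The word determines its flags, which are the parities on the cycles, and then its symbols.\<close>
lemma card_code: "card (code_of A) = 2 ^ 40"
proof -
  let ?P = "{x :: sym list. length x = 8} \<times> set e8 \<times> set e8"
  have "code_of A = (\<lambda>(x, f, g). word (x @ enc x A) (f @ g)) ` ?P" by (auto simp: code_of_def image_iff)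
  moreover have "inj_on (\<lambda>(x, f, g). word (x @ enc x A) (f @ g)) ?P"
  proof (rule inj_onI)
    fix p q assume pq: "p \<in> ?P" "q \<in> ?P"
      "(case p of (x, f, g) \<Rightarrow> word (x @ enc x A) (f @ g)) = (case q of (x, f, g) \<Rightarrow> word (x @ enc x A) (f @ g))"
    obtain x f g y f' g' where e: "p = (x, f, g)" "q = (y, f', g')" by (cases p; cases q)
    have h: "length x = 8" "length y = 8" "f \<in> set e8" "g \<in> set e8" "f' \<in> set e8" "g' \<in> set e8"
      "word (x @ enc x A) (f @ g) = word (y @ enc y A) (f' @ g')"
      using pq unfolding e by simp_all
    have "length (enc y A) = 8" using rows by simp
    from codeword_inj[OF h(1-4) length_e8[OF h(5)] length_e8[OF h(6)] this h(7)]
    show "p = q" unfolding e by simp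
  qed
  ultimately have "card (code_of A) = card ?P" by (simp add: card_image)
  also have "\<dots> = 16 ^ 8 * (16 * 16)" by (simp add: card_cartesian_product card_vectors card_e8)
  finally show ?thesis by simp
qed

lemma is_code_code: "is_code (code_of A)"
  unfolding is_code_def using linear_code card_code even_inter weight_min by blast

lemma \<sigma>_Aut: "\<sigma> \<in> Aut (code_of A)"
proof -
  have inj: "inj ((`) \<sigma>)" unfolding inj_def using inj_image_eq_iff[OF bij_is_inj[OF bij_\<sigma>]] by simp
  have "(`) \<sigma> ` code_of A \<subseteq> code_of A"
  proof
    fix Z assume "Z \<in> (`) \<sigma> ` code_of A"
    then obtain X where X: "X \<in> code_of A" "Z = \<sigma> ` X" by blast
    obtain x f g where x: "X = word (x @ enc x A) (f @ g)" "length x = 8" "f \<in> set e8" "g \<in> set e8" "length (enc x A) = 8"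
      using X(1) by (rule codeE)
    have "Z = word (rv x @ enc (rv x) A) (f @ g)"
      unfolding X(2) x(1) using x rows by (subst \<sigma>_word) (simp_all add: enc_rot, simp add: rv_def)
    then show "Z \<in> code_of A" using x by (simp add: in_code)
  qed
  moreover have "finite (code_of A)" by simp
  ultimately have "(`) \<sigma> ` code_of A = code_of A" using inj by (intro endo_inj_surj) (auto intro: inj_on_subset)
  then show ?thesis using bij_\<sigma> by (simp add: Aut_def)
qed

lemma cycles_word:
  assumes "U \<subseteq> {..<16}"
  shows "cycles U = word (zv @ zv) (map (\<lambda>i. i \<in> U) [0..<8] @ map (\<lambda>i. i + 8 \<in> U) [0..<8])"
proof (rule set_eq_pt)
  fix k a :: nat assume k: "k < 16" "a < 5"
  have "has s0 a = False" using k(2) has_s0 by simp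
  moreover have "(zv @ zv) ! k = s0" using k(1) by (simp add: nth_append zv_replicate)
  ultimately have "has ((zv @ zv) ! k) a = False" by simp
  note zero = this
  show "pt k a \<in> cycles U \<longleftrightarrow> pt k a \<in> word (zv @ zv) (map (\<lambda>i. i \<in> U) [0..<8] @ map (\<lambda>i. i + 8 \<in> U) [0..<8])"
  proof (cases "k < 8")
    case True
    then show ?thesis using k assms zero by (simp add: mem_word mem_cycles nth_append)
  next
    case False
    then have "k - 8 < 8" "k - 8 + 8 = k" using k(1) by auto
    then have "(map (\<lambda>i. i \<in> U) [0..<8] @ map (\<lambda>i. i + 8 \<in> U) [0..<8]) ! k = (k \<in> U)"
      using False by (simp add: nth_append)
    then show ?thesis using k assms zero by (simp add: mem_word mem_cycles)
  qed
qed

text \<open>A union of cycles has all symbols zero, and its flags are arbitrary pairs of words of the extended Hamming code.\<close>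
lemma cyclic_code: "cyclic (code_of A)"
  unfolding cyclic_def
proof (intro conjI allI impI)
  show "is_code (code_of A)" "\<sigma> \<in> Aut (code_of A)" by (rule is_code_code \<sigma>_Aut)+
  fix U :: "nat set" assume U: "U \<subseteq> {..<16}"
  let ?f = "map (\<lambda>i. i \<in> U) [0..<8]" and ?g = "map (\<lambda>i. i + 8 \<in> U) [0..<8]"
  have "cycles U \<in> code_of A \<longleftrightarrow> ?f \<in> set e8 \<and> ?g \<in> set e8"
  proof
    assume "cycles U \<in> code_of A"
    then obtain x f g where x: "cycles U = word (x @ enc x A) (f @ g)" "length x = 8" "f \<in> set e8" "g \<in> set e8"
      by (rule codeE)
    have "x = zv \<and> enc x A = zv \<and> f = ?f \<and> g = ?g"
      by (rule codeword_inj[OF x(2) _ x(3,4)]) (use x(1) cycles_word[OF U] in simp_all)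
    then show "?f \<in> set e8 \<and> ?g \<in> set e8" using x by simp
  next
    assume "?f \<in> set e8 \<and> ?g \<in> set e8"
    then show "cycles U \<in> code_of A" using in_code[of zv ?f ?g] by (simp add: cycles_word[OF U] enc_zv)
  qed
  also have "?f \<in> set e8 \<longleftrightarrow> U \<inter> {..<8} \<in> e8_sets"
  proof -
    have e: "?f = map (\<lambda>i. i \<in> U \<inter> {..<8}) [0..<8]" by auto
    show ?thesis unfolding e by (rule e8_sets_iff[symmetric]) simp
  qed
  also have "?g \<in> set e8 \<longleftrightarrow> (\<lambda>k. k - 8) ` (U \<inter> {8..<16}) \<in> e8_sets"
  proof -
    have "i + 8 \<in> U \<longleftrightarrow> i \<in> (\<lambda>k. k - 8) ` (U \<inter> {8..<16})" if "i < 8" for i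
      using that by (force simp: image_iff)
    then have e: "?g = map (\<lambda>i. i \<in> (\<lambda>k. k - 8) ` (U \<inter> {8..<16})) [0..<8]" by auto
    have "(\<lambda>k. k - 8) ` (U \<inter> {8..<16}) \<subseteq> {..<8}" by auto
    then show ?thesis unfolding e by (rule e8_sets_iff[symmetric])
  qed
  finally show "cycles U \<in> code_of A \<longleftrightarrow> U \<inter> {..<8} \<in> e8_sets \<and> (\<lambda>k. k - 8) ` (U \<inter> {8..<16}) \<in> e8_sets" .
qed

text \<open>A word with the given block profile has even weight on all cycles, hence no flags.\<close>
lemma shows_pattern_profile:
  assumes "a + b \<noteq> 0"
  shows "shows_pattern (a, b, m, n) A \<longleftrightarrow> {# pattern_mset a b, pattern_mset m n #} \<in> block_profile ` code_of A"
proof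
  have z: "f0 \<in> set e8" by (simp add: set_e8)
  assume "shows_pattern (a, b, m, n) A"
  then obtain x where x: "length x = 8" "patt a b x \<and> patt m n (enc x A) \<or> patt a b (enc x A) \<and> patt m n x"
    unfolding shows_pattern_iff by blast
  have "block_profile (word (x @ enc x A) (f0 @ f0)) = {# block_weights f0 x, block_weights f0 (enc x A) #}"
    using x(1) rows by (intro profile_word) simp_all
  also have "\<dots> = {# pattern_mset a b, pattern_mset m n #}"
    using x rows by (auto simp: block_weights_f0 patt_def)
  finally show "{# pattern_mset a b, pattern_mset m n #} \<in> block_profile ` code_of A"
    using in_code[OF x(1) z z] by (metis imageI)
next
  assume "{# pattern_mset a b, pattern_mset m n #} \<in> block_profile ` code_of A"
  then obtain X where X: "X \<in> code_of A" "block_profile X = {# pattern_mset a b, pattern_mset m n #}" by auto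
  obtain x f g where x: "X = word (x @ enc x A) (f @ g)" "length x = 8" "length f = 8" "length g = 8" "length (enc x A) = 8"
    using X(1) by (rule codeE)
  have "{# block_weights f x, block_weights g (enc x A) #} = {# pattern_mset a b, pattern_mset m n #}"
    using X(2) profile_word[of x "enc x A" f g] x by simp
  then have "patt a b x \<and> patt m n (enc x A) \<or> patt a b (enc x A) \<and> patt m n x"
    using x block_weights_pattern unfolding pair_mset_eq by auto
  moreover have "x \<noteq> zv"
  proof
    assume "x = zv"
    then have "patt a b zv" using calculation enc_zv by auto
    then show False using assms by (simp add: patt_def zv_def)
  qed
  ultimately show "shows_pattern (a, b, m, n) A" unfolding shows_pattern_iff using x(2) by blast
qed

lemma weight_16: "\<exists>X\<in>code_of A. card X = 16"
proof -
  have z: "f0 \<in> set e8" by (simp add: set_e8)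
  have "shows_pattern (2, 0, 6, 0) A" using good by (simp add: good_def)
  then obtain x where x: "length x = 8" "patt 2 0 x \<and> patt 6 0 (enc x A) \<or> patt 2 0 (enc x A) \<and> patt 6 0 x"
    unfolding shows_pattern_iff by blast
  have "card (word (x @ enc x A) (f0 @ f0)) = 2 * half x + 2 * half (enc x A)"
    using x(1) rows z by (simp add: card_codeword vcost_f0)
  also have "\<dots> = 16" using x(2) by (auto simp: half_n2_n4 patt_def)
  finally show ?thesis using in_code[OF x(1) z z] by blast
qed

end

text \<open>The signature can be read off from the set of block profiles.\<close>
lemma (in array) signature_invariant:
  assumes "good A" "good B" "bij p" "(`) p ` code_of A = code_of B"
  shows "signature A = signature B"
proof -
  interpret A: code_array pt \<sigma> A by unfold_locales (rule assms)
  interpret B: code_array pt \<sigma> B by unfold_locales (rule assms)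
  have "block_profile ` code_of A = block_profile ` code_of B"
    by (rule equivalent_block_profiles[OF A.cyclic_code B.cyclic_code assms(3,4)])
  then have "shows_pattern (a, b, m, n) A = shows_pattern (a, b, m, n) B" if "a + b \<noteq> 0" for a b m n
    using A.shows_pattern_profile[OF that] B.shows_pattern_profile[OF that] by simp
  then show ?thesis by (simp add: signature_def patterns_def)
qed

section \<open>Binary vectors\<close>

definition supp :: "'n::finite binary_vec \<Rightarrow> 'n set" where "supp v = {i. v $ i \<noteq> 0}"

lemma supp_inverse: "supp (\<chi> i. of_bool (i \<in> X)) = X" by (auto simp: supp_def)

lemma bit_eqI: "((a :: bit) \<noteq> 0 \<longleftrightarrow> b \<noteq> 0) \<Longrightarrow> a = b" by (cases a; cases b) simp_all

lemma supp_inj: "supp u = supp v \<longleftrightarrow> u = v"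
proof
  assume h: "supp u = supp v"
  have "u $ i = v $ i" for i using h by (intro bit_eqI) (auto simp: supp_def)
  then show "u = v" by (simp add: vec_eq_iff)
qed simp

lemma finite_binary_vec [simp]: "finite (V :: 'n::finite binary_vec set)"
proof (rule finite_imageD)
  show "finite (supp ` V)" by (rule finite)
  show "inj_on supp V" by (simp add: inj_on_def supp_inj)
qed

lemma supp_add: "supp (u + v) = supp u \<triangle> supp v"
proof -
  have "a + b \<noteq> 0 \<longleftrightarrow> (a \<noteq> 0) \<noteq> (b \<noteq> 0)" for a b :: bit by (cases a; cases b) simp_all
  then show ?thesis by (auto simp: supp_def)
qed

lemma supp_0: "supp 0 = {}" by (simp add: supp_def)

lemma scalar_product_supp: "scalar_product u v = 0 \<longleftrightarrow> even (card (supp u \<inter> supp v))"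
proof -
  have e: "u $ i * v $ i = (if i \<in> supp u \<inter> supp v then 1 else 0)" for i
    by (cases "u $ i"; cases "v $ i") (simp_all add: supp_def)
  have "scalar_product u v = (\<Sum>i\<in>UNIV. if i \<in> supp u \<inter> supp v then 1 else 0)"
    unfolding scalar_product_def by (rule sum.cong[OF refl]) (rule e)
  also have "\<dots> = (\<Sum>i\<in>UNIV \<inter> (supp u \<inter> supp v). 1)" by (rule sum.inter_restrict[symmetric]) (rule finite)
  also have "\<dots> = of_nat (card (supp u \<inter> supp v))" by (simp only: Int_UNIV_left sum_constant mult_1_right)
  also have "\<dots> = (0 :: bit) \<longleftrightarrow> even (card (supp u \<inter> supp v))"
    by (cases "even (card (supp u \<inter> supp v))") (auto elim!: evenE oddE)
  finally show ?thesis .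
qed

lemma weight_supp: "hamming_weight v = card (supp v)" by (simp add: hamming_weight_def supp_def)

lemma distance_supp: "hamming_distance u v = card (supp u \<triangle> supp v)"
proof -
  have h: "u $ i \<noteq> v $ i \<longleftrightarrow> (u $ i \<noteq> 0) \<noteq> (v $ i \<noteq> 0)" for i by (cases "u $ i"; cases "v $ i") simp_all
  have "{i. u $ i \<noteq> v $ i} = {i. (u $ i \<noteq> 0) \<noteq> (v $ i \<noteq> 0)}" by (simp only: h)
  also have "\<dots> = supp u \<triangle> supp v" by (simp only: sdiff_def supp_def mem_Collect_eq)
  finally show ?thesis by (simp only: hamming_distance_def)
qed

definition vectors :: "'n::finite set set \<Rightarrow> 'n binary_vec set" where "vectors \<C> = {v. supp v \<in> \<C>}"

lemma supp_vectors: "supp ` vectors \<C> = \<C>"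
proof
  show "\<C> \<subseteq> supp ` vectors \<C>"
  proof
    fix X assume "X \<in> \<C>"
    then show "X \<in> supp ` vectors \<C>" using supp_inverse[of X] by (intro image_eqI[of _ _ "\<chi> i. of_bool (i \<in> X)"]) (simp_all add: vectors_def)
  qed
qed (auto simp: vectors_def)

lemma subspace_vectors: "linear \<C> \<Longrightarrow> vec.subspace (vectors \<C>)"
proof -
  assume l: "linear \<C>"
  have z: "0 \<in> vectors \<C>" using l by (simp add: vectors_def supp_0 linear_empty)
  have "c *s v \<in> vectors \<C>" if v: "v \<in> vectors \<C>" for c v
  proof (cases "c = 0")
    case True then show ?thesis using z by simp
  next
    case False
    then have "c = 1" by (cases c) simp_all
    then show ?thesis using v by simp
  qed
  then show ?thesis
    using l unfolding vec.subspace_def by (auto simp: vectors_def supp_0 supp_add linear_empty linear_sdiff)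
qed

text \<open>Adding a vector to an independent set doubles its span.\<close>
lemma card_span: "finite B \<Longrightarrow> vec.independent B \<Longrightarrow> card (vec.span B) = 2 ^ card (B :: 'n::finite binary_vec set)"
proof (induction B rule: finite_induct)
  case (insert b B)
  have ind: "vec.independent B" using insert.prems vec.independent_mono by blast
  have b: "b \<notin> vec.span B" using insert.prems insert.hyps by (simp add: vec.independent_insert)
  have bb: "b + b = 0" for b :: "'n binary_vec" by (simp add: vec_eq_iff)
  have "vec.span (insert b B) = vec.span B \<union> (+) b ` vec.span B"
  proof (rule set_eqI)
    fix x
    have "x \<in> vec.span (insert b B) \<longleftrightarrow> (\<exists>k :: bit. x - k *s b \<in> vec.span B)" by (rule vec.span_breakdown_eq)
    also have "\<dots> \<longleftrightarrow> x \<in> vec.span B \<or> x - b \<in> vec.span B"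
    proof
      assume "\<exists>k :: bit. x - k *s b \<in> vec.span B"
      then obtain k :: bit where k: "x - k *s b \<in> vec.span B" by blast
      then show "x \<in> vec.span B \<or> x - b \<in> vec.span B" by (cases k) simp_all
    next
      assume "x \<in> vec.span B \<or> x - b \<in> vec.span B"
      then show "\<exists>k :: bit. x - k *s b \<in> vec.span B"
      proof
        assume "x \<in> vec.span B" then show ?thesis by (intro exI[of _ 0]) simp
      next
        assume "x - b \<in> vec.span B" then show ?thesis by (intro exI[of _ 1]) simp
      qed
    qed
    also have "\<dots> \<longleftrightarrow> x \<in> vec.span B \<union> (+) b ` vec.span B"
      by (auto simp: image_iff intro: bexI[of _ "x - b"])
    finally show "x \<in> vec.span (insert b B) \<longleftrightarrow> x \<in> vec.span B \<union> (+) b ` vec.span B" .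
  qed
  moreover have "vec.span B \<inter> (+) b ` vec.span B = {}"
  proof -
    have False if "y \<in> vec.span B" "b + y \<in> vec.span B" for y
    proof -
      have "b + y - y \<in> vec.span B" using that vec.span_diff by blast
      then show False using b by simp
    qed
    then show ?thesis by auto
  qed
  moreover have "card ((+) b ` vec.span B) = card (vec.span B)" by (simp add: card_image)
  ultimately have "card (vec.span (insert b B)) = 2 * card (vec.span B)"
    by (simp add: card_Un_disjoint)
  then show ?case using insert ind by simp
qed simp

lemma card_subspace:
  assumes "vec.subspace (V :: 'n::finite binary_vec set)" shows "card V = 2 ^ vec.dim V"
proof -
  obtain B where B: "B \<subseteq> V" "vec.independent B" "V \<subseteq> vec.span B" "card B = vec.dim V"
    using vec.basis_exists[of V] by blast
  have "vec.span B = V" using B assms by (simp add: vec.span_minimal subset_antisym)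
  moreover have "finite B" by simp
  ultimately show ?thesis using card_span[of B] B by simp
qed

lemma card_vectors_code: "card (vectors \<C>) = card \<C>"
proof -
  have "card (supp ` vectors \<C>) = card (vectors \<C>)" by (rule card_image) (auto simp: inj_on_def supp_inj)
  then show ?thesis by (simp add: supp_vectors)
qed

text \<open>A self-orthogonal code with \<open>2 ^ 40\<close> words in length 80 is self-dual by counting.\<close>
lemma dual_vectors:
  assumes "is_code \<C>" "CARD('n::finite) = 80"
  shows "dual_code (vectors (\<C> :: 'n set set)) = vectors \<C>"
proof -
  have lin: "linear \<C>" and card: "card \<C> = 2 ^ 40" and orthC: "\<And>X Y. X \<in> \<C> \<Longrightarrow> Y \<in> \<C> \<Longrightarrow> even (card (X \<inter> Y))"
    using assms by (auto simp: is_code_def)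
  have "card \<C> * card (orth UNIV \<C>) = 2 ^ 80" using card_orth[of UNIV \<C>] lin assms(2) by simp
  then have "card (orth UNIV \<C>) = card \<C>" unfolding card by simp
  moreover have "\<C> \<subseteq> orth UNIV \<C>" using orthC by (auto simp: orth_def)
  ultimately have "orth UNIV \<C> = \<C>" by (intro card_subset_eq[symmetric]) auto
  moreover have "v \<in> dual_code (vectors \<C>) \<longleftrightarrow> supp v \<in> orth UNIV \<C>" for v
  proof -
    have "v \<in> dual_code (vectors \<C>) \<longleftrightarrow> (\<forall>X\<in>supp ` vectors \<C>. even (card (X \<inter> supp v)))"
      by (simp add: dual_code_def scalar_product_supp)
    then show ?thesis by (simp add: supp_vectors orth_def)
  qed
  ultimately show ?thesis by (auto simp: vectors_def)
qed

lemma min_distance_vectors: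
  assumes "is_code \<C>" "X \<in> \<C>" "card X = 16"
  shows "min_distance (vectors \<C>) = 16"
  unfolding min_distance_def
proof (rule Min_eqI)
  have lin: "linear \<C>" using assms by (simp add: is_code_def)
  let ?D = "{hamming_distance u v | u v. u \<in> vectors \<C> \<and> v \<in> vectors \<C> \<and> u \<noteq> v}"
  have "?D \<subseteq> (\<lambda>(u, v). hamming_distance u v) ` (vectors \<C> \<times> vectors \<C>)" by auto
  then show "finite ?D" by (rule finite_subset) simp
  show "16 \<le> d" if "d \<in> ?D" for d
  proof -
    obtain u v where uv: "d = card (supp u \<triangle> supp v)" "supp u \<in> \<C>" "supp v \<in> \<C>" "u \<noteq> v"
      using \<open>d \<in> ?D\<close> by (auto simp: distance_supp vectors_def)
    then have "supp u \<triangle> supp v \<in> \<C>" "supp u \<triangle> supp v \<noteq> {}"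
      using lin by (simp_all add: linear_sdiff sdiff_eq_empty supp_inj)
    then show ?thesis using assms(1) uv(1) by (simp add: is_code_def)
  qed
  obtain u where u: "u \<in> vectors \<C>" "supp u = X" using assms(2) supp_vectors[of \<C>] by (metis imageE)
  have z: "0 \<in> vectors \<C>" using lin by (simp add: vectors_def supp_0 linear_empty)
  have "u \<noteq> 0" using u(2) assms(3) supp_0 by auto
  moreover have "hamming_distance u 0 = 16" using u(2) assms(3) by (simp add: distance_supp supp_0)
  ultimately show "16 \<in> ?D" using u(1) z by force
qed

lemma equivalent_vectors:
  assumes "equivalent_codes (vectors \<C>) (vectors \<D>)"
  shows "\<exists>p. bij p \<and> (`) p ` \<C> = \<D>"
proof -
  obtain p where p: "bij p" "vectors \<D> = permute_coords p ` vectors \<C>" using assms by (auto simp: equivalent_codes_def)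
  have s: "supp (permute_coords p v) = inv p ` supp v" for v
  proof -
    have "supp (permute_coords p v) = p -` supp v" by (auto simp: supp_def permute_coords_def)
    then show ?thesis using p(1) by (simp add: bij_vimage_eq_inv_image)
  qed
  have "\<D> = supp ` permute_coords p ` vectors \<C>" using p(2) supp_vectors by metis
  also have "\<dots> = (`) (inv p) ` supp ` vectors \<C>" by (simp add: image_image s)
  finally show ?thesis using p(1) by (intro exI[of _ "inv p"]) (simp add: supp_vectors bij_imp_bij_inv)
qed

lemma (in code_array) extremal_type_II:
  assumes "CARD('a) = 80"
  shows "type_II (vectors (code_of A))" "extremal (vectors (code_of A))" "has_parameters (vectors (code_of A)) 80 40 16"
proof -
  let ?V = "vectors (code_of A)"
  have sub: "binary_linear_code ?V" unfolding binary_linear_code_def by (rule subspace_vectors[OF linear_code])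
  have sd: "self_dual ?V" unfolding self_dual_def using sub dual_vectors[OF is_code_code assms] by simp
  have md: "min_distance ?V = 16" using weight_16 min_distance_vectors[OF is_code_code] by blast
  show "type_II ?V" unfolding type_II_def using sd weight_dvd by (auto simp: weight_supp vectors_def)
  show "extremal ?V" unfolding extremal_def using sd md assms by (simp add: self_dual_bound_def)
  have "(2::nat) ^ vec.dim ?V = 2 ^ 40"
    using card_subspace[of ?V] sub card_vectors_code[of "code_of A"] card_code by (simp add: binary_linear_code_def)
  then have "vec.dim ?V = 40" by (rule iffD1[OF power_inject_exp, rotated]) simp
  then show "has_parameters ?V 80 40 16" unfolding has_parameters_def using sub md assms by simp
qed

text \<open>Distinct signatures make the codes pairwise inequivalent, in particular distinct.\<close>
lemma extremal_codes_from_matrices: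
  assumes "\<forall>A\<in>set As. good A" "distinct (map signature As)"
  shows "\<exists>\<C> :: (80 binary_vec) set set. finite \<C> \<and> card \<C> = length As \<and>
    (\<forall>C\<in>\<C>. type_II C \<and> extremal C \<and> has_parameters C 80 40 16) \<and> pairwise (\<lambda>C D. \<not> equivalent_codes C D) \<C>"
proof -
  have c80: "CARD(80) = 80" by simp
  obtain pt and \<sigma> :: "80 \<Rightarrow> 80" where "array pt \<sigma>" using array_exists[OF c80] by blast
  then interpret array pt \<sigma> .
  let ?V = "\<lambda>A. vectors (code_of A)"
  have inv: "signature A = signature B" if h: "A \<in> set As" "B \<in> set As" "equivalent_codes (?V A) (?V B)" for A B
  proof -
    obtain p where p: "bij p" "(`) p ` code_of A = code_of B" using equivalent_vectors[OF h(3)] by (elim exE conjE)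
    have "good A" "good B" using h(1,2) assms(1) by blast+
    then show ?thesis using p by (rule signature_invariant)
  qed
  have sig: "A = B" if "A \<in> set As" "B \<in> set As" "signature A = signature B" for A B
    using assms(2) that by (auto simp: distinct_map inj_on_def)
  have refl: "equivalent_codes C C" for C :: "80 binary_vec set"
    unfolding equivalent_codes_def by (intro exI[of _ id]) (simp add: permute_coords_def)
  have "inj_on ?V (set As)"
  proof (rule inj_onI)
    fix A B assume h: "A \<in> set As" "B \<in> set As" "?V A = ?V B"
    then have "equivalent_codes (?V A) (?V B)" using refl[of "?V A"] by simp
    then show "A = B" by (intro sig[OF h(1,2)] inv[OF h(1,2)])
  qed
  then have "card (?V ` set As) = length As" using assms(2) by (simp add: card_image distinct_map distinct_card)
  moreover have "type_II C \<and> extremal C \<and> has_parameters C 80 40 16" if C: "C \<in> ?V ` set As" for C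
  proof -
    obtain A where A: "A \<in> set As" "C = ?V A" using C by blast
    interpret code_array pt \<sigma> A by unfold_locales (use assms(1) A(1) in blast)
    show ?thesis unfolding A(2) using extremal_type_II[OF c80] by blast
  qed
  moreover have "pairwise (\<lambda>C D. \<not> equivalent_codes C D) (?V ` set As)"
    unfolding pairwise_def
  proof (intro ballI impI notI)
    fix C D assume "C \<in> ?V ` set As" "D \<in> ?V ` set As" and ne: "C \<noteq> D" and eq: "equivalent_codes C D"
    then obtain A B where AB: "A \<in> set As" "C = ?V A" "B \<in> set As" "D = ?V B" by (elim imageE)
    have "A = B" by (rule sig[OF AB(1,3) inv[OF AB(1,3)]]) (use eq AB(2,4) in simp)
    then show False using ne AB(2,4) by simp
  qed
  moreover have "finite (?V ` set As)" by simp
  ultimately show ?thesis by (intro exI[of _ "?V ` set As"] conjI ballI) blast+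
qed

section \<open>The matrices\<close>

definition code1 :: "sym list list" where "code1 =
  [[s9,s2,sd,s0,s7,sf,sd,s7],[s2,s9,s0,sd,sf,s7,s7,sd],[sd,s0,s9,s2,sd,s7,s7,sf],[s0,sd,s2,s9,s7,sd,sf,s7],[s7,sf,sd,s7,s5,s7,sa,s0],[sf,s7,s7,sd,s7,s5,s0,sa],[sd,s7,s7,sf,sa,s0,s5,s7],[s7,sd,sf,s7,s0,sa,s7,s5]]"

definition code2 :: "sym list list" where "code2 =
  [[sc,sc,s0,s2,s7,se,se,s5],[sc,s2,s2,s0,s1,sd,se,se],[s0,s2,sc,sc,se,s9,sb,se],[s2,s0,sc,s2,se,se,s3,sf],[sb,s3,se,se,s0,s1,s5,s9],[se,sf,s5,se,s3,s0,s9,s1],[se,se,s7,s1,s9,s5,s0,s3],[s9,se,se,sd,s5,s3,s1,s0]]"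

definition code3 :: "sym list list" where "code3 =
  [[s3,se,s5,se,sb,sb,s2,s5],[se,s3,se,s5,sb,sb,s5,s2],[s9,se,s1,se,s2,s9,s7,s7],[se,s9,se,s1,s9,s2,s7,s7],[sc,s3,sf,sf,sb,sc,sf,s2],[s3,sc,sf,sf,sc,sb,s2,sf],[sd,sd,sc,s1,sd,s2,s7,sc],[sd,sd,s1,sc,s2,sd,sc,s7]]"

definition code4 :: "sym list list" where "code4 =
  [[se,s6,sb,s4,s8,s2,s4,s3],[s8,se,s4,sf,s5,sa,sc,s8],[s7,sa,se,s8,sa,s1,s6,s2],[sa,sd,s6,se,sc,s6,s9,s4],[s6,s9,s4,sc,sc,sd,s4,sb],[s2,s4,s3,s8,sf,s2,sb,s8],[sa,sc,s8,s5,sa,s7,sc,sf],[s1,s6,s2,sa,s7,s6,sd,s2]]"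

definition code5 :: "sym list list" where "code5 =
  [[s0,sf,se,se,s9,sa,s7,sf],[sf,s0,se,se,sa,s9,sf,s7],[se,se,s0,sd,sb,sd,s5,s4],[se,se,sd,s0,sd,sb,s4,s5],[s9,sa,sb,sd,sa,s1,s2,s2],[sa,s9,sd,sb,s1,sa,s2,s2],[s7,sf,s5,s4,s2,s2,s4,s3],[sf,s7,s4,s5,s2,s2,s3,s4]]"

definition code6 :: "sym list list" where "code6 =
  [[s6,s1,s4,s1,sa,se,s5,sf],[s1,s6,sa,s5,s4,sf,s1,se],[s9,s4,s8,s3,se,s3,sd,sa],[s3,sa,s3,s8,sd,s9,se,s4],[sf,se,s5,sa,s1,s1,s4,s6],[sa,s3,sd,se,s3,s4,s8,s9],[se,sf,s1,s4,s5,s6,sa,s1],[s4,s9,se,sd,s8,sa,s3,s3]]"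

definition code7 :: "sym list list" where "code7 =
  [[s1,sf,sd,sd,sf,s3,s2,sc],[sd,s3,sf,sf,s1,sd,sc,s2],[sd,sd,s1,sf,s2,sc,sf,s3],[sf,sf,sd,s3,sc,s2,s1,sd],[sf,sc,s2,s1,s7,s3,s6,s1],[sc,sd,s3,s2,s1,sb,s3,s8],[s2,s1,sf,sc,s6,s1,s7,s3],[s3,s2,sc,sd,s3,s8,s1,sb]]"

definition code8 :: "sym list list" where "code8 =
  [[s2,s4,s0,s3,s2,s6,s2,sf],[sa,s2,s1,s0,s8,s2,sd,s2],[s0,s3,s2,s4,s2,sf,s2,s6],[s1,s0,sa,s2,sd,s2,s8,s2],[s2,s6,s2,sf,s0,s2,s2,sc],[s8,s2,sd,s2,s2,s0,sc,s2],[s2,sf,s2,s6,s2,sc,s0,s2],[sd,s2,s8,s2,sc,s2,s2,s0]]"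

definition code9 :: "sym list list" where "code9 =
  [[sd,s1,s0,s4,sc,s9,sb,sd],[s3,sf,sc,s7,s0,sf,sa,s5],[sb,sc,sd,s1,s9,s4,sd,s0],[sa,s0,s3,sf,sf,s7,s5,sc],[sc,s7,s5,sf,sf,s0,s3,sa],[s5,sf,sa,s0,s7,sf,sc,s3],[s0,s4,sd,s9,s1,sc,sd,sb],[sd,s9,sb,sc,s4,s1,s0,sd]]"

definition code10 :: "sym list list" where "code10 =
  [[s1,s4,s1,sa,s3,s2,s6,s8],[sa,s3,s4,s3,s2,s1,s6,s8],[s1,sa,s1,s4,s6,s8,s3,s2],[s4,s3,sa,s3,s6,s8,s2,s1],[s6,s6,s3,s2,s3,sa,s3,s4],[s8,s8,s2,s1,s4,s1,sa,s1],[s3,s2,s6,s6,s3,s4,s3,sa],[s2,s1,s8,s8,sa,s1,s4,s1]]"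

definition code11 :: "sym list list" where "code11 =
  [[se,s1,sa,s8,s9,s2,sd,sc],[s1,se,sc,sd,s2,s9,s8,sa],[sf,sc,se,s3,s4,s6,s5,s2],[s6,s4,s3,se,sc,sf,s2,s5],[sc,sf,s2,s5,s6,s4,s3,se],[s2,s9,s8,sa,s1,se,sc,sd],[s4,s6,s5,s2,sf,sc,se,s3],[s9,s2,sd,sc,se,s1,sa,s8]]"

definition code12 :: "sym list list" where "code12 =
  [[s6,sd,s9,sd,s6,s6,sc,sc],[sd,s6,sd,s9,sc,s6,s6,sc],[s9,sd,s6,sd,sc,sc,s6,s6],[sd,s9,sd,s6,s6,sc,sc,s6],[s6,sc,sc,s6,sc,s9,s2,s9],[s6,s6,sc,sc,s9,sc,s9,s2],[sc,s6,s6,sc,s2,s9,sc,s9],[sc,sc,s6,s6,s9,s2,s9,sc]]"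

definition code13 :: "sym list list" where "code13 =
  [[sc,s8,sd,s3,s3,sd,sc,s4],[s8,sc,sc,s4,sd,s3,sd,s3],[sa,sc,sc,s6,s1,sf,s1,sf],[s1,sf,s6,sc,sa,sc,sf,s1],[s3,sd,s3,sd,sc,s8,s4,sc],[sd,s3,s4,sc,s8,sc,s3,sd],[sc,sa,s1,sf,sf,s1,sc,s6],[sf,s1,sf,s1,sc,sa,s6,sc]]"

definition code14 :: "sym list list" where "code14 =
  [[s0,s3,s2,s6,se,s5,s4,s4],[s1,s0,s8,s2,s9,se,sa,sa],[s2,s6,s0,s3,s4,s4,se,s5],[s8,s2,s1,s0,sa,sa,s9,se],[se,s5,sa,s4,sc,s1,s0,s9],[s9,se,sa,s4,s3,sc,s5,s0],[sa,s4,se,s5,s0,s9,sc,s1],[sa,s4,s9,se,s5,s0,s3,sc]]"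

definition code15 :: "sym list list" where "code15 =
  [[se,sa,sc,s7,se,s6,sd,s8],[s4,se,sb,sc,s8,se,s6,sf],[sc,s7,se,sa,sd,s8,se,s6],[sb,sc,s4,se,s6,sf,s8,se],[se,s6,sf,s8,sc,sb,s2,se],[s8,se,s6,sd,s7,sc,se,s2],[sf,s8,se,s6,s2,se,sc,sb],[s6,sd,s8,se,se,s2,s7,sc]]"

definition code16 :: "sym list list" where "code16 =
  [[s4,sc,s2,se,s2,s9,sf,s5],[sc,sa,se,s2,s5,s2,s9,sd],[s2,se,sa,sc,sd,s9,s2,s5],[se,s2,sc,s4,s5,sf,s9,s2],[s2,s5,sd,s5,sb,s2,sc,s2],[s9,s2,s9,sf,s2,s7,s2,sc],[sf,s9,s2,s9,sc,s2,s7,s2],[s5,sd,s5,s2,s2,sc,s2,sb]]"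

definition code17 :: "sym list list" where "code17 =
  [[s9,s4,s8,sd,s3,s3,se,sa],[sa,s5,s4,s1,sf,se,s1,s6],[s8,sa,s9,se,s3,s3,sd,s4],[sd,s1,se,sc,sa,s4,sa,s1],[se,s1,sd,sa,s4,sa,sc,s1],[s3,sf,s3,s4,sc,s4,sa,se],[s3,se,s3,sa,s4,sc,s4,sf],[s4,s6,sa,s1,se,sf,s1,s5]]"

definition code18 :: "sym list list" where "code18 =
  [[sf,sd,s7,sb,se,sd,s8,s9],[sd,sf,sb,s7,sd,se,s9,s8],[sb,s7,sd,sf,s6,s5,se,sf],[s7,sb,sf,sd,s5,s6,sf,se],[s4,s1,se,sb,s2,s8,sc,sa],[s1,s4,sb,se,s8,s2,sa,sc],[se,s7,sa,s3,sc,s4,s2,s6],[s7,se,s3,sa,s4,sc,s6,s2]]"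

definition code19 :: "sym list list" where "code19 =
  [[s5,s2,se,sa,s8,s9,sf,s5],[s2,s5,s5,sf,s9,s8,sa,se],[se,s5,s5,s8,sa,sf,s9,s2],[sa,sf,s8,s7,sd,s7,s5,s9],[s8,s9,sa,sd,s7,s5,s7,sf],[s9,s8,sf,s7,s5,s7,sd,sa],[sf,sa,s9,s5,s7,sd,s7,s8],[s5,se,s2,s9,sf,sa,s8,s5]]"

definition code20 :: "sym list list" where "code20 =
  [[sf,s4,sd,s4,sa,s8,s5,s2],[s4,sf,s2,s5,s8,sa,s4,sd],[sd,s2,sf,sa,s4,s5,s8,s4],[s4,s5,sa,s8,s9,s1,s4,s8],[sa,s8,s4,s9,s8,s4,s1,s5],[s8,sa,s5,s1,s4,s8,s9,s4],[s5,s4,s8,s4,s1,s9,s8,sa],[s2,sd,s4,s8,s5,s4,sa,sf]]"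

definition code21 :: "sym list list" where "code21 =
  [[s5,sb,s9,sb,sf,se,s0,sd],[s7,s9,s7,s5,se,sd,sf,s0],[s9,sb,s5,sb,s0,sd,sf,se],[s7,s5,s7,s9,sf,s0,se,sd],[s0,sd,sd,se,s7,s9,sb,s9],[sf,s0,se,sf,s5,sb,s5,s7],[sd,se,s0,sd,sb,s9,s7,s9],[se,sf,sf,s0,s5,s7,s5,sb]]"

definition code22 :: "sym list list" where "code22 =
  [[s6,sd,s9,s4,s4,se,sd,se],[sd,s6,s4,s9,se,s4,se,sd],[s9,s4,s6,sd,sd,se,s4,se],[s4,s9,sd,s6,se,sd,se,s4],[s4,se,sd,se,s6,s2,s9,sb],[se,s4,se,sd,s2,s6,sb,s9],[sd,se,s4,se,s9,sb,s6,s2],[se,sd,se,s4,sb,s9,s2,s6]]"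

definition code23 :: "sym list list" where "code23 =
  [[s7,s4,s5,s0,s4,s7,sb,s9],[sa,sb,sa,s7,s9,s5,s0,sb],[sb,s4,s7,s4,s7,s0,s9,s5],[s9,s7,sb,s4,s0,s4,s5,s7],[s5,s0,s9,s7,s4,s4,s7,sb],[sa,s7,sb,s5,sb,s9,sa,s0],[sb,s5,s0,s9,s7,sb,sa,sa],[s0,s9,sa,sb,s5,s7,sb,sa]]"

definition code24 :: "sym list list" where "code24 =
  [[s2,s4,sc,s8,s4,s6,s8,s1],[s4,s2,s8,sc,s6,s4,s1,s8],[sc,s6,s2,sa,s6,s3,sa,s8],[s6,sc,sa,s2,s3,s6,s8,sa],[s4,s5,s8,s4,se,sb,se,sf],[s5,s4,s4,s8,sb,se,sf,se],[s6,sa,sa,s9,se,sd,se,s7],[sa,s6,s9,sa,sd,se,s7,se]]"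

definition code25 :: "sym list list" where "code25 =
  [[s7,s6,s4,s5,s6,s7,s7,s0],[s0,s7,s6,s6,s7,s7,s5,s4],[s4,s0,s7,s7,s7,s5,s6,s6],[s5,s7,s7,sc,sc,s3,s1,s6],[s7,s7,s6,s1,sc,sc,s3,s5],[s7,s6,s5,s3,s1,sc,sc,s7],[s6,s5,s7,sc,s3,s1,sc,s7],[s6,s4,s0,s7,s5,s6,s7,s7]]"

definition code26 :: "sym list list" where "code26 =
  [[s4,s2,sc,s9,s8,sf,sc,sd],[s2,sa,s5,sc,sd,s6,sf,sc],[sc,s5,sa,s2,sc,sf,s6,sd],[s9,sc,s2,s4,sd,sc,sf,s8],[s8,sd,sc,sd,s4,s0,s2,se],[sf,s6,sf,sc,s0,sa,se,s2],[sc,sf,s6,sf,s2,se,sa,s0],[sd,sc,sd,s8,se,s2,s0,s4]]"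

definition code27 :: "sym list list" where "code27 =
  [[s1,sc,sf,s2,se,s9,s6,s9],[sc,s3,s5,s5,s8,s2,se,sd],[s9,s9,s1,sc,sf,se,s2,s6],[s2,sd,sc,s3,s5,s8,s5,se],[s8,se,s2,sd,sc,s5,s3,s5],[se,s6,s9,s9,s1,sf,sc,s2],[s5,s5,s8,se,s2,sc,sd,s3],[sf,s2,se,s6,s9,s1,s9,sc]]"

definition code28 :: "sym list list" where "code28 =
  [[se,s9,s3,s8,se,s8,sd,se],[s5,se,se,se,s6,sf,s6,s1],[s1,se,se,sf,s6,se,s6,s5],[s6,sf,se,se,s1,se,s5,s6],[se,s8,s8,s9,se,s3,se,sd],[sd,s8,s8,s3,se,s9,se,se],[s6,se,sf,se,s5,se,s1,s6],[se,s3,s9,s8,sd,s8,se,se]]"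

definition code29 :: "sym list list" where "code29 =
  [[se,sa,s2,sa,sf,s5,sf,s0],[s4,se,s4,s2,s0,sd,s9,sd],[s2,sa,se,sa,sf,s0,sf,s5],[s4,s2,s4,se,s9,sd,s0,sd],[sd,s0,sd,s5,se,s2,s2,s2],[s9,sf,s0,sf,s2,se,s2,s2],[sd,s5,sd,s0,s2,s2,se,s2],[s0,sf,s9,sf,s2,s2,s2,se]]"

definition code30 :: "sym list list" where "code30 =
  [[s2,s0,se,s5,s8,s8,sb,sb],[s0,s2,s9,se,s6,s6,s7,s7],[se,s5,s2,s0,sb,sb,s8,s8],[s9,se,s0,s2,s7,s7,s6,s6],[s6,s8,s7,sb,s2,se,sc,se],[s6,s8,s7,sb,se,s2,se,sc],[s7,sb,s6,s8,sc,se,s2,se],[s7,sb,s6,s8,se,sc,se,s2]]"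

definition code31 :: "sym list list" where "code31 =
  [[s1,sa,s7,s4,sd,s2,s8,sc],[sa,s1,sd,s8,s7,sc,s4,s2],[s6,sf,s3,s4,s2,sa,sc,sb],[sa,sb,s4,s3,sc,s6,s2,sf],[s2,sc,s4,s7,s8,s1,sd,sa],[sc,s2,s8,sd,s4,sa,s7,s1],[sf,s6,s2,sc,s3,sb,s4,sa],[sb,sa,sc,s2,s4,sf,s3,s6]]"

definition code32 :: "sym list list" where "code32 =
  [[s2,sd,sf,sf,sc,sa,sf,s2],[sd,s2,s2,sc,sf,sf,sa,sf],[sf,s2,s2,sa,sf,sf,sc,sd],[sf,sc,sa,s4,s8,sc,s4,sf],[sc,sf,sf,s8,s4,s4,sc,sa],[sa,sf,sf,sc,s4,s4,s8,sc],[sf,sa,sc,s4,sc,s8,s4,sf],[s2,sf,sd,sf,sa,sc,sf,s2]]"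

definition code33 :: "sym list list" where "code33 =
  [[sc,s5,sc,s5,sa,sf,se,sc],[s9,sc,s9,sc,sd,s4,sc,se],[sc,s5,sc,s5,se,sc,sa,sf],[s9,sc,s9,sc,sc,se,sd,s4],[se,sc,s4,sf,sc,s2,sc,s2],[sc,se,sd,sa,s2,sc,s2,sc],[s4,sf,se,sc,sc,s2,sc,s2],[sd,sa,sc,se,s2,sc,s2,sc]]"

definition code34 :: "sym list list" where "code34 =
  [[s2,s6,se,s1,s1,sc,s6,se],[s8,s2,s3,se,sc,s3,se,s8],[se,s1,s2,s6,s6,se,s1,sc],[se,s6,sc,s1,s1,se,s6,s2],[s3,sc,s8,se,s2,s8,se,s3],[s8,se,s3,sc,se,s3,s2,s8],[sc,s1,se,s6,s6,s2,s1,se],[s3,se,s8,s2,se,s8,sc,s3]]"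

definition code35 :: "sym list list" where "code35 =
  [[sf,s4,sf,s4,sa,se,sf,s6],[s4,sf,s4,sf,s6,sa,se,sf],[sf,s4,sf,s4,sf,s6,sa,se],[s4,sf,s4,sf,se,sf,s6,sa],[sf,s6,sa,se,s7,s9,s7,s9],[se,sf,s6,sa,s9,s7,s9,s7],[sa,se,sf,s6,s7,s9,s7,s9],[s6,sa,se,sf,s9,s7,s9,s7]]"

definition code36 :: "sym list list" where "code36 =
  [[s2,s7,se,s7,s5,s0,s5,s4],[sb,s2,sb,se,sa,s9,s0,s9],[se,s7,s2,s7,s5,s4,s5,s0],[sb,se,sb,s2,s0,s9,sa,s9],[s9,s4,s9,s0,s2,s7,se,s7],[s0,s5,sa,s5,sb,s2,sb,se],[s9,s0,s9,s4,se,s7,s2,s7],[sa,s5,s0,s5,sb,se,sb,s2]]"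

definition code37 :: "sym list list" where "code37 =
  [[s0,sf,sc,s6,s6,sb,se,s8],[sd,s0,s8,sc,s7,s8,s6,se],[sc,s6,s0,sf,se,s8,s6,sb],[s8,sc,sd,s0,s6,se,s7,s8],[s8,sb,se,s8,se,s1,s0,s1],[s7,s6,s6,se,s3,se,s3,s0],[se,s8,s8,sb,s0,s1,se,s1],[s6,se,s7,s6,s3,s0,s3,se]]"

definition code38 :: "sym list list" where "code38 =
  [[se,s1,se,sa,s6,s3,s3,s6],[s3,se,s4,se,s1,s8,s8,s1],[se,sa,se,s1,s3,s6,s6,s3],[s4,se,s3,se,s8,s1,s1,s8],[s8,s3,s1,s6,sc,s0,sc,se],[s1,s6,s8,s3,s0,sc,se,sc],[s1,s6,s8,s3,sc,se,sc,s0],[s8,s3,s1,s6,se,sc,s0,sc]]"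

definition code39 :: "sym list list" where "code39 =
  [[se,se,s2,se,s5,s1,s5,sb],[se,se,se,s2,s7,s9,s3,s9],[s2,se,se,se,s5,sb,s5,s1],[se,s2,se,se,s3,s9,s7,s9],[s9,sb,s9,s1,se,sf,s2,sf],[s3,s5,s7,s5,sd,se,sd,s2],[s9,s1,s9,sb,s2,sf,se,sf],[s7,s5,s3,s5,sd,s2,sd,se]]"

definition code40 :: "sym list list" where "code40 =
  [[sb,s3,sb,s3,sb,s7,s2,s1],[s3,sb,s3,sb,s1,sb,s7,s2],[sb,s3,sb,s3,s2,s1,sb,s7],[s3,sb,s3,sb,s7,s2,s1,sb],[s2,s1,sb,s7,sd,sc,sd,sc],[s7,s2,s1,sb,sc,sd,sc,sd],[sb,s7,s2,s1,sd,sc,sd,sc],[s1,sb,s7,s2,sc,sd,sc,sd]]"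

definition code41 :: "sym list list" where "code41 =
  [[s6,s2,s4,s2,sa,s7,sa,sb],[s2,s8,s2,sa,s7,s4,sb,s4],[s4,s2,s6,s2,sa,sb,sa,s7],[s2,sa,s2,s8,sb,s4,s7,s4],[sa,s7,sa,sb,s4,se,s6,se],[s7,s4,sb,s4,se,sa,se,s8],[sa,sb,sa,s7,s6,se,s4,se],[sb,s4,s7,s4,se,s8,se,sa]]"

definition code42 :: "sym list list" where "code42 =
  [[s2,s4,s2,sc,sc,sa,s9,s1],[s3,s2,sa,s5,s4,sc,sc,s2],[s2,s1,s2,sc,sc,s9,sa,s4],[sc,sa,sc,sc,sc,s6,s4,s9],[sc,s9,sc,sc,sc,s4,s6,sa],[s5,sc,s4,sa,s8,sc,sc,sc],[s4,sc,s5,s8,sa,sc,sc,sc],[sa,s2,s3,s4,s5,sc,sc,s2]]"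

definition code43 :: "sym list list" where "code43 =
  [[sa,s9,sa,s5,s2,s7,s6,s7],[s5,s4,s9,s4,sb,s8,sb,s2],[sa,s5,sa,s9,s6,s7,s2,s7],[s9,s4,s5,s4,sb,s2,sb,s8],[s6,sb,s2,sb,s9,s9,s9,s5],[s7,s2,s7,s8,s5,s5,s9,s5],[s2,sb,s6,sb,s9,s5,s9,s9],[s7,s8,s7,s2,s9,s5,s5,s5]]"

definition code44 :: "sym list list" where "code44 =
  [[s0,s4,s0,s3,s8,sd,s7,s1],[s1,s0,s4,s7,sd,s8,s3,s0],[s0,s1,s0,s8,s3,s7,sd,s4],[s8,sd,s3,s4,s4,s6,s2,s7],[s3,s7,s8,s4,s4,s2,s6,sd],[s7,s3,sd,s2,s6,s4,s4,s8],[sd,s8,s7,s6,s2,s4,s4,s3],[s4,s0,s1,sd,s7,s3,s8,s0]]"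

lemma good_code1: "good code1"
proof -
  have "square8 code1" "list_all (unit_ok code1) units" "shows_pattern (2, 0, 6, 0) code1" by (simp_all only: crules code1_def)
  moreover have "chkL (map mkpos code1)" by (simp only: crules code1_def)
  moreover have "chkR (map mkpos (dual code1))" by (simp only: crules code1_def)
  ultimately show ?thesis unfolding good_def by (intro conjI)
qed
lemma signature_code1: "signature code1 = [False,False,False,False,False,False,False]"
  by (simp only: crules signature_def patterns_def code1_def)

lemma good_code2: "good code2"
proof -
  have "square8 code2" "list_all (unit_ok code2) units" "shows_pattern (2, 0, 6, 0) code2" by (simp_all only: crules code2_def)
  moreover have "chkL (map mkpos code2)" by (simp only: crules code2_def)
  moreover have "chkR (map mkpos (dual code2))" by (simp only: crules code2_def)
  ultimately show ?thesis unfolding good_def by (intro conjI)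
qed
lemma signature_code2: "signature code2 = [False,False,False,False,False,True,False]"
  by (simp only: crules signature_def patterns_def code2_def)

lemma good_code3: "good code3"
proof -
  have "square8 code3" "list_all (unit_ok code3) units" "shows_pattern (2, 0, 6, 0) code3" by (simp_all only: crules code3_def)
  moreover have "chkL (map mkpos code3)" by (simp only: crules code3_def)
  moreover have "chkR (map mkpos (dual code3))" by (simp only: crules code3_def)
  ultimately show ?thesis unfolding good_def by (intro conjI)
qed
lemma signature_code3: "signature code3 = [False,False,False,False,False,True,True]"
  by (simp only: crules signature_def patterns_def code3_def)

lemma good_code4: "good code4"
proof -
  have "square8 code4" "list_all (unit_ok code4) units" "shows_pattern (2, 0, 6, 0) code4" by (simp_all only: crules code4_def)
  moreover have "chkL (map mkpos code4)" by (simp only: crules code4_def)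
  moreover have "chkR (map mkpos (dual code4))" by (simp only: crules code4_def)
  ultimately show ?thesis unfolding good_def by (intro conjI)
qed
lemma signature_code4: "signature code4 = [False,False,False,False,True,False,False]"
  by (simp only: crules signature_def patterns_def code4_def)

lemma good_code5: "good code5"
proof -
  have "square8 code5" "list_all (unit_ok code5) units" "shows_pattern (2, 0, 6, 0) code5" by (simp_all only: crules code5_def)
  moreover have "chkL (map mkpos code5)" by (simp only: crules code5_def)
  moreover have "chkR (map mkpos (dual code5))" by (simp only: crules code5_def)
  ultimately show ?thesis unfolding good_def by (intro conjI)
qed
lemma signature_code5: "signature code5 = [False,False,False,False,True,False,True]"
  by (simp only: crules signature_def patterns_def code5_def)

lemma good_code6: "good code6"
proof -
  have "square8 code6" "list_all (unit_ok code6) units" "shows_pattern (2, 0, 6, 0) code6" by (simp_all only: crules code6_def)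
  moreover have "chkL (map mkpos code6)" by (simp only: crules code6_def)
  moreover have "chkR (map mkpos (dual code6))" by (simp only: crules code6_def)
  ultimately show ?thesis unfolding good_def by (intro conjI)
qed
lemma signature_code6: "signature code6 = [False,False,False,False,True,True,False]"
  by (simp only: crules signature_def patterns_def code6_def)

lemma good_code7: "good code7"
proof -
  have "square8 code7" "list_all (unit_ok code7) units" "shows_pattern (2, 0, 6, 0) code7" by (simp_all only: crules code7_def)
  moreover have "chkL (map mkpos code7)" by (simp only: crules code7_def)
  moreover have "chkR (map mkpos (dual code7))" by (simp only: crules code7_def)
  ultimately show ?thesis unfolding good_def by (intro conjI)
qed
lemma signature_code7: "signature code7 = [False,False,False,False,True,True,True]"
  by (simp only: crules signature_def patterns_def code7_def)

lemma good_code8: "good code8"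
proof -
  have "square8 code8" "list_all (unit_ok code8) units" "shows_pattern (2, 0, 6, 0) code8" by (simp_all only: crules code8_def)
  moreover have "chkL (map mkpos code8)" by (simp only: crules code8_def)
  moreover have "chkR (map mkpos (dual code8))" by (simp only: crules code8_def)
  ultimately show ?thesis unfolding good_def by (intro conjI)
qed
lemma signature_code8: "signature code8 = [False,False,False,True,False,True,False]"
  by (simp only: crules signature_def patterns_def code8_def)

lemma good_code9: "good code9"
proof -
  have "square8 code9" "list_all (unit_ok code9) units" "shows_pattern (2, 0, 6, 0) code9" by (simp_all only: crules code9_def)
  moreover have "chkL (map mkpos code9)" by (simp only: crules code9_def)
  moreover have "chkR (map mkpos (dual code9))" by (simp only: crules code9_def)
  ultimately show ?thesis unfolding good_def by (intro conjI)
qed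
lemma signature_code9: "signature code9 = [False,False,True,False,False,False,False]"
  by (simp only: crules signature_def patterns_def code9_def)

lemma good_code10: "good code10"
proof -
  have "square8 code10" "list_all (unit_ok code10) units" "shows_pattern (2, 0, 6, 0) code10" by (simp_all only: crules code10_def)
  moreover have "chkL (map mkpos code10)" by (simp only: crules code10_def)
  moreover have "chkR (map mkpos (dual code10))" by (simp only: crules code10_def)
  ultimately show ?thesis unfolding good_def by (intro conjI)
qed
lemma signature_code10: "signature code10 = [False,False,True,False,False,True,False]"
  by (simp only: crules signature_def patterns_def code10_def)

lemma good_code11: "good code11"
proof -
  have "square8 code11" "list_all (unit_ok code11) units" "shows_pattern (2, 0, 6, 0) code11" by (simp_all only: crules code11_def)
  moreover have "chkL (map mkpos code11)" by (simp only: crules code11_def)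
  moreover have "chkR (map mkpos (dual code11))" by (simp only: crules code11_def)
  ultimately show ?thesis unfolding good_def by (intro conjI)
qed
lemma signature_code11: "signature code11 = [False,False,True,False,True,False,False]"
  by (simp only: crules signature_def patterns_def code11_def)

lemma good_code12: "good code12"
proof -
  have "square8 code12" "list_all (unit_ok code12) units" "shows_pattern (2, 0, 6, 0) code12" by (simp_all only: crules code12_def)
  moreover have "chkL (map mkpos code12)" by (simp only: crules code12_def)
  moreover have "chkR (map mkpos (dual code12))" by (simp only: crules code12_def)
  ultimately show ?thesis unfolding good_def by (intro conjI)
qed
lemma signature_code12: "signature code12 = [False,False,True,False,True,False,True]"
  by (simp only: crules signature_def patterns_def code12_def)

lemma good_code13: "good code13"
proof -
  have "square8 code13" "list_all (unit_ok code13) units" "shows_pattern (2, 0, 6, 0) code13" by (simp_all only: crules code13_def)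
  moreover have "chkL (map mkpos code13)" by (simp only: crules code13_def)
  moreover have "chkR (map mkpos (dual code13))" by (simp only: crules code13_def)
  ultimately show ?thesis unfolding good_def by (intro conjI)
qed
lemma signature_code13: "signature code13 = [False,False,True,False,True,True,True]"
  by (simp only: crules signature_def patterns_def code13_def)

lemma good_code14: "good code14"
proof -
  have "square8 code14" "list_all (unit_ok code14) units" "shows_pattern (2, 0, 6, 0) code14" by (simp_all only: crules code14_def)
  moreover have "chkL (map mkpos code14)" by (simp only: crules code14_def)
  moreover have "chkR (map mkpos (dual code14))" by (simp only: crules code14_def)
  ultimately show ?thesis unfolding good_def by (intro conjI)
qed
lemma signature_code14: "signature code14 = [False,False,True,True,False,True,False]"
  by (simp only: crules signature_def patterns_def code14_def)

lemma good_code15: "good code15"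
proof -
  have "square8 code15" "list_all (unit_ok code15) units" "shows_pattern (2, 0, 6, 0) code15" by (simp_all only: crules code15_def)
  moreover have "chkL (map mkpos code15)" by (simp only: crules code15_def)
  moreover have "chkR (map mkpos (dual code15))" by (simp only: crules code15_def)
  ultimately show ?thesis unfolding good_def by (intro conjI)
qed
lemma signature_code15: "signature code15 = [False,False,True,True,False,True,True]"
  by (simp only: crules signature_def patterns_def code15_def)

lemma good_code16: "good code16"
proof -
  have "square8 code16" "list_all (unit_ok code16) units" "shows_pattern (2, 0, 6, 0) code16" by (simp_all only: crules code16_def)
  moreover have "chkL (map mkpos code16)" by (simp only: crules code16_def)
  moreover have "chkR (map mkpos (dual code16))" by (simp only: crules code16_def)
  ultimately show ?thesis unfolding good_def by (intro conjI)
qed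
lemma signature_code16: "signature code16 = [False,False,True,True,True,False,True]"
  by (simp only: crules signature_def patterns_def code16_def)

lemma good_code17: "good code17"
proof -
  have "square8 code17" "list_all (unit_ok code17) units" "shows_pattern (2, 0, 6, 0) code17" by (simp_all only: crules code17_def)
  moreover have "chkL (map mkpos code17)" by (simp only: crules code17_def)
  moreover have "chkR (map mkpos (dual code17))" by (simp only: crules code17_def)
  ultimately show ?thesis unfolding good_def by (intro conjI)
qed
lemma signature_code17: "signature code17 = [False,False,True,True,True,True,False]"
  by (simp only: crules signature_def patterns_def code17_def)

lemma good_code18: "good code18"
proof -
  have "square8 code18" "list_all (unit_ok code18) units" "shows_pattern (2, 0, 6, 0) code18" by (simp_all only: crules code18_def)
  moreover have "chkL (map mkpos code18)" by (simp only: crules code18_def)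
  moreover have "chkR (map mkpos (dual code18))" by (simp only: crules code18_def)
  ultimately show ?thesis unfolding good_def by (intro conjI)
qed
lemma signature_code18: "signature code18 = [False,False,True,True,True,True,True]"
  by (simp only: crules signature_def patterns_def code18_def)

lemma good_code19: "good code19"
proof -
  have "square8 code19" "list_all (unit_ok code19) units" "shows_pattern (2, 0, 6, 0) code19" by (simp_all only: crules code19_def)
  moreover have "chkL (map mkpos code19)" by (simp only: crules code19_def)
  moreover have "chkR (map mkpos (dual code19))" by (simp only: crules code19_def)
  ultimately show ?thesis unfolding good_def by (intro conjI)
qed
lemma signature_code19: "signature code19 = [False,True,False,False,True,False,True]"
  by (simp only: crules signature_def patterns_def code19_def)

lemma good_code20: "good code20"
proof -
  have "square8 code20" "list_all (unit_ok code20) units" "shows_pattern (2, 0, 6, 0) code20" by (simp_all only: crules code20_def)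
  moreover have "chkL (map mkpos code20)" by (simp only: crules code20_def)
  moreover have "chkR (map mkpos (dual code20))" by (simp only: crules code20_def)
  ultimately show ?thesis unfolding good_def by (intro conjI)
qed
lemma signature_code20: "signature code20 = [False,True,False,True,True,False,True]"
  by (simp only: crules signature_def patterns_def code20_def)

lemma good_code21: "good code21"
proof -
  have "square8 code21" "list_all (unit_ok code21) units" "shows_pattern (2, 0, 6, 0) code21" by (simp_all only: crules code21_def)
  moreover have "chkL (map mkpos code21)" by (simp only: crules code21_def)
  moreover have "chkR (map mkpos (dual code21))" by (simp only: crules code21_def)
  ultimately show ?thesis unfolding good_def by (intro conjI)
qed
lemma signature_code21: "signature code21 = [False,True,True,False,False,False,False]"
  by (simp only: crules signature_def patterns_def code21_def)

lemma good_code22: "good code22"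
proof -
  have "square8 code22" "list_all (unit_ok code22) units" "shows_pattern (2, 0, 6, 0) code22" by (simp_all only: crules code22_def)
  moreover have "chkL (map mkpos code22)" by (simp only: crules code22_def)
  moreover have "chkR (map mkpos (dual code22))" by (simp only: crules code22_def)
  ultimately show ?thesis unfolding good_def by (intro conjI)
qed
lemma signature_code22: "signature code22 = [False,True,True,False,False,False,True]"
  by (simp only: crules signature_def patterns_def code22_def)

lemma good_code23: "good code23"
proof -
  have "square8 code23" "list_all (unit_ok code23) units" "shows_pattern (2, 0, 6, 0) code23" by (simp_all only: crules code23_def)
  moreover have "chkL (map mkpos code23)" by (simp only: crules code23_def)
  moreover have "chkR (map mkpos (dual code23))" by (simp only: crules code23_def)
  ultimately show ?thesis unfolding good_def by (intro conjI)
qed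
lemma signature_code23: "signature code23 = [False,True,True,False,False,True,False]"
  by (simp only: crules signature_def patterns_def code23_def)

lemma good_code24: "good code24"
proof -
  have "square8 code24" "list_all (unit_ok code24) units" "shows_pattern (2, 0, 6, 0) code24" by (simp_all only: crules code24_def)
  moreover have "chkL (map mkpos code24)" by (simp only: crules code24_def)
  moreover have "chkR (map mkpos (dual code24))" by (simp only: crules code24_def)
  ultimately show ?thesis unfolding good_def by (intro conjI)
qed
lemma signature_code24: "signature code24 = [False,True,True,False,False,True,True]"
  by (simp only: crules signature_def patterns_def code24_def)

lemma good_code25: "good code25"
proof -
  have "square8 code25" "list_all (unit_ok code25) units" "shows_pattern (2, 0, 6, 0) code25" by (simp_all only: crules code25_def)
  moreover have "chkL (map mkpos code25)" by (simp only: crules code25_def)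
  moreover have "chkR (map mkpos (dual code25))" by (simp only: crules code25_def)
  ultimately show ?thesis unfolding good_def by (intro conjI)
qed
lemma signature_code25: "signature code25 = [False,True,True,False,True,False,True]"
  by (simp only: crules signature_def patterns_def code25_def)

lemma good_code26: "good code26"
proof -
  have "square8 code26" "list_all (unit_ok code26) units" "shows_pattern (2, 0, 6, 0) code26" by (simp_all only: crules code26_def)
  moreover have "chkL (map mkpos code26)" by (simp only: crules code26_def)
  moreover have "chkR (map mkpos (dual code26))" by (simp only: crules code26_def)
  ultimately show ?thesis unfolding good_def by (intro conjI)
qed
lemma signature_code26: "signature code26 = [False,True,True,False,True,True,False]"
  by (simp only: crules signature_def patterns_def code26_def)

lemma good_code27: "good code27"
proof -
  have "square8 code27" "list_all (unit_ok code27) units" "shows_pattern (2, 0, 6, 0) code27" by (simp_all only: crules code27_def)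
  moreover have "chkL (map mkpos code27)" by (simp only: crules code27_def)
  moreover have "chkR (map mkpos (dual code27))" by (simp only: crules code27_def)
  ultimately show ?thesis unfolding good_def by (intro conjI)
qed
lemma signature_code27: "signature code27 = [False,True,True,True,True,True,False]"
  by (simp only: crules signature_def patterns_def code27_def)

lemma good_code28: "good code28"
proof -
  have "square8 code28" "list_all (unit_ok code28) units" "shows_pattern (2, 0, 6, 0) code28" by (simp_all only: crules code28_def)
  moreover have "chkL (map mkpos code28)" by (simp only: crules code28_def)
  moreover have "chkR (map mkpos (dual code28))" by (simp only: crules code28_def)
  ultimately show ?thesis unfolding good_def by (intro conjI)
qed
lemma signature_code28: "signature code28 = [True,False,False,False,False,False,True]"
  by (simp only: crules signature_def patterns_def code28_def)

lemma good_code29: "good code29"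
proof -
  have "square8 code29" "list_all (unit_ok code29) units" "shows_pattern (2, 0, 6, 0) code29" by (simp_all only: crules code29_def)
  moreover have "chkL (map mkpos code29)" by (simp only: crules code29_def)
  moreover have "chkR (map mkpos (dual code29))" by (simp only: crules code29_def)
  ultimately show ?thesis unfolding good_def by (intro conjI)
qed
lemma signature_code29: "signature code29 = [True,False,False,False,False,True,False]"
  by (simp only: crules signature_def patterns_def code29_def)

lemma good_code30: "good code30"
proof -
  have "square8 code30" "list_all (unit_ok code30) units" "shows_pattern (2, 0, 6, 0) code30" by (simp_all only: crules code30_def)
  moreover have "chkL (map mkpos code30)" by (simp only: crules code30_def)
  moreover have "chkR (map mkpos (dual code30))" by (simp only: crules code30_def)
  ultimately show ?thesis unfolding good_def by (intro conjI)
qed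
lemma signature_code30: "signature code30 = [True,False,False,False,False,True,True]"
  by (simp only: crules signature_def patterns_def code30_def)

lemma good_code31: "good code31"
proof -
  have "square8 code31" "list_all (unit_ok code31) units" "shows_pattern (2, 0, 6, 0) code31" by (simp_all only: crules code31_def)
  moreover have "chkL (map mkpos code31)" by (simp only: crules code31_def)
  moreover have "chkR (map mkpos (dual code31))" by (simp only: crules code31_def)
  ultimately show ?thesis unfolding good_def by (intro conjI)
qed
lemma signature_code31: "signature code31 = [True,False,False,False,True,False,False]"
  by (simp only: crules signature_def patterns_def code31_def)

lemma good_code32: "good code32"
proof -
  have "square8 code32" "list_all (unit_ok code32) units" "shows_pattern (2, 0, 6, 0) code32" by (simp_all only: crules code32_def)
  moreover have "chkL (map mkpos code32)" by (simp only: crules code32_def)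
  moreover have "chkR (map mkpos (dual code32))" by (simp only: crules code32_def)
  ultimately show ?thesis unfolding good_def by (intro conjI)
qed
lemma signature_code32: "signature code32 = [True,False,False,False,True,False,True]"
  by (simp only: crules signature_def patterns_def code32_def)

lemma good_code33: "good code33"
proof -
  have "square8 code33" "list_all (unit_ok code33) units" "shows_pattern (2, 0, 6, 0) code33" by (simp_all only: crules code33_def)
  moreover have "chkL (map mkpos code33)" by (simp only: crules code33_def)
  moreover have "chkR (map mkpos (dual code33))" by (simp only: crules code33_def)
  ultimately show ?thesis unfolding good_def by (intro conjI)
qed
lemma signature_code33: "signature code33 = [True,False,False,False,True,True,False]"
  by (simp only: crules signature_def patterns_def code33_def)

lemma good_code34: "good code34"
proof -
  have "square8 code34" "list_all (unit_ok code34) units" "shows_pattern (2, 0, 6, 0) code34" by (simp_all only: crules code34_def)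
  moreover have "chkL (map mkpos code34)" by (simp only: crules code34_def)
  moreover have "chkR (map mkpos (dual code34))" by (simp only: crules code34_def)
  ultimately show ?thesis unfolding good_def by (intro conjI)
qed
lemma signature_code34: "signature code34 = [True,False,False,False,True,True,True]"
  by (simp only: crules signature_def patterns_def code34_def)

lemma good_code35: "good code35"
proof -
  have "square8 code35" "list_all (unit_ok code35) units" "shows_pattern (2, 0, 6, 0) code35" by (simp_all only: crules code35_def)
  moreover have "chkL (map mkpos code35)" by (simp only: crules code35_def)
  moreover have "chkR (map mkpos (dual code35))" by (simp only: crules code35_def)
  ultimately show ?thesis unfolding good_def by (intro conjI)
qed
lemma signature_code35: "signature code35 = [True,False,False,True,False,False,True]"
  by (simp only: crules signature_def patterns_def code35_def)

lemma good_code36: "good code36"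
proof -
  have "square8 code36" "list_all (unit_ok code36) units" "shows_pattern (2, 0, 6, 0) code36" by (simp_all only: crules code36_def)
  moreover have "chkL (map mkpos code36)" by (simp only: crules code36_def)
  moreover have "chkR (map mkpos (dual code36))" by (simp only: crules code36_def)
  ultimately show ?thesis unfolding good_def by (intro conjI)
qed
lemma signature_code36: "signature code36 = [True,False,True,False,False,False,False]"
  by (simp only: crules signature_def patterns_def code36_def)

lemma good_code37: "good code37"
proof -
  have "square8 code37" "list_all (unit_ok code37) units" "shows_pattern (2, 0, 6, 0) code37" by (simp_all only: crules code37_def)
  moreover have "chkL (map mkpos code37)" by (simp only: crules code37_def)
  moreover have "chkR (map mkpos (dual code37))" by (simp only: crules code37_def)
  ultimately show ?thesis unfolding good_def by (intro conjI)
qed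
lemma signature_code37: "signature code37 = [True,False,True,False,False,True,False]"
  by (simp only: crules signature_def patterns_def code37_def)

lemma good_code38: "good code38"
proof -
  have "square8 code38" "list_all (unit_ok code38) units" "shows_pattern (2, 0, 6, 0) code38" by (simp_all only: crules code38_def)
  moreover have "chkL (map mkpos code38)" by (simp only: crules code38_def)
  moreover have "chkR (map mkpos (dual code38))" by (simp only: crules code38_def)
  ultimately show ?thesis unfolding good_def by (intro conjI)
qed
lemma signature_code38: "signature code38 = [True,False,True,False,True,True,True]"
  by (simp only: crules signature_def patterns_def code38_def)

lemma good_code39: "good code39"
proof -
  have "square8 code39" "list_all (unit_ok code39) units" "shows_pattern (2, 0, 6, 0) code39" by (simp_all only: crules code39_def)
  moreover have "chkL (map mkpos code39)" by (simp only: crules code39_def)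
  moreover have "chkR (map mkpos (dual code39))" by (simp only: crules code39_def)
  ultimately show ?thesis unfolding good_def by (intro conjI)
qed
lemma signature_code39: "signature code39 = [True,True,False,False,False,True,True]"
  by (simp only: crules signature_def patterns_def code39_def)

lemma good_code40: "good code40"
proof -
  have "square8 code40" "list_all (unit_ok code40) units" "shows_pattern (2, 0, 6, 0) code40" by (simp_all only: crules code40_def)
  moreover have "chkL (map mkpos code40)" by (simp only: crules code40_def)
  moreover have "chkR (map mkpos (dual code40))" by (simp only: crules code40_def)
  ultimately show ?thesis unfolding good_def by (intro conjI)
qed
lemma signature_code40: "signature code40 = [True,True,False,True,False,False,True]"
  by (simp only: crules signature_def patterns_def code40_def)

lemma good_code41: "good code41"
proof -
  have "square8 code41" "list_all (unit_ok code41) units" "shows_pattern (2, 0, 6, 0) code41" by (simp_all only: crules code41_def)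
  moreover have "chkL (map mkpos code41)" by (simp only: crules code41_def)
  moreover have "chkR (map mkpos (dual code41))" by (simp only: crules code41_def)
  ultimately show ?thesis unfolding good_def by (intro conjI)
qed
lemma signature_code41: "signature code41 = [True,True,False,True,True,True,True]"
  by (simp only: crules signature_def patterns_def code41_def)

lemma good_code42: "good code42"
proof -
  have "square8 code42" "list_all (unit_ok code42) units" "shows_pattern (2, 0, 6, 0) code42" by (simp_all only: crules code42_def)
  moreover have "chkL (map mkpos code42)" by (simp only: crules code42_def)
  moreover have "chkR (map mkpos (dual code42))" by (simp only: crules code42_def)
  ultimately show ?thesis unfolding good_def by (intro conjI)
qed
lemma signature_code42: "signature code42 = [True,True,True,False,False,True,False]"
  by (simp only: crules signature_def patterns_def code42_def)

lemma good_code43: "good code43"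
proof -
  have "square8 code43" "list_all (unit_ok code43) units" "shows_pattern (2, 0, 6, 0) code43" by (simp_all only: crules code43_def)
  moreover have "chkL (map mkpos code43)" by (simp only: crules code43_def)
  moreover have "chkR (map mkpos (dual code43))" by (simp only: crules code43_def)
  ultimately show ?thesis unfolding good_def by (intro conjI)
qed
lemma signature_code43: "signature code43 = [True,True,True,False,True,True,True]"
  by (simp only: crules signature_def patterns_def code43_def)

lemma good_code44: "good code44"
proof -
  have "square8 code44" "list_all (unit_ok code44) units" "shows_pattern (2, 0, 6, 0) code44" by (simp_all only: crules code44_def)
  moreover have "chkL (map mkpos code44)" by (simp only: crules code44_def)
  moreover have "chkR (map mkpos (dual code44))" by (simp only: crules code44_def)
  ultimately show ?thesis unfolding good_def by (intro conjI)
qed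
lemma signature_code44: "signature code44 = [True,True,True,True,True,True,False]"
  by (simp only: crules signature_def patterns_def code44_def)

definition codes :: "sym list list list" where "codes = [code1, code2, code3, code4, code5, code6, code7, code8, code9, code10, code11, code12, code13, code14, code15, code16, code17, code18, code19, code20, code21, code22, code23, code24, code25, code26, code27, code28, code29, code30, code31, code32, code33, code34, code35, code36, code37, code38, code39, code40, code41, code42, code43, code44]"

lemma good_codes: "\<forall>A\<in>set codes. good A"
  unfolding codes_def by (simp only: list.set ball_simps simp_thms insert_iff empty_iff good_code1 good_code2 good_code3 good_code4 good_code5 good_code6 good_code7 good_code8 good_code9 good_code10 good_code11 good_code12 good_code13 good_code14 good_code15 good_code16 good_code17 good_code18 good_code19 good_code20 good_code21 good_code22 good_code23 good_code24 good_code25 good_code26 good_code27 good_code28 good_code29 good_code30 good_code31 good_code32 good_code33 good_code34 good_code35 good_code36 good_code37 good_code38 good_code39 good_code40 good_code41 good_code42 good_code43 good_code44)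

lemma distinct_signatures: "distinct (map signature codes)"
  unfolding codes_def by (simp add: signature_code1 signature_code2 signature_code3 signature_code4 signature_code5 signature_code6 signature_code7 signature_code8 signature_code9 signature_code10 signature_code11 signature_code12 signature_code13 signature_code14 signature_code15 signature_code16 signature_code17 signature_code18 signature_code19 signature_code20 signature_code21 signature_code22 signature_code23 signature_code24 signature_code25 signature_code26 signature_code27 signature_code28 signature_code29 signature_code30 signature_code31 signature_code32 signature_code33 signature_code34 signature_code35 signature_code36 signature_code37 signature_code38 signature_code39 signature_code40 signature_code41 signature_code42 signature_code43 signature_code44)

lemma length_codes: "length codes = 44" by (simp add: codes_def)

theorem theorem4p2:
  shows "\<exists>\<C> :: (80 binary_vec) set set.
    finite \<C> \<and> card \<C> \<ge> 44 \<and>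
    (\<forall>C\<in>\<C>. type_II C \<and> extremal C \<and> has_parameters C 80 40 16) \<and>
    pairwise (\<lambda>C D. \<not> equivalent_codes C D) \<C>"
proof -
  obtain \<C> :: "(80 binary_vec) set set" where C: "finite \<C>" "card \<C> = length codes"
    "\<forall>C\<in>\<C>. type_II C \<and> extremal C \<and> has_parameters C 80 40 16" "pairwise (\<lambda>C D. \<not> equivalent_codes C D) \<C>"
    using extremal_codes_from_matrices[OF good_codes distinct_signatures] by blast
  have "card \<C> \<ge> 44" using C(2) length_codes by simp
  then show ?thesis using C by blast
qed

end
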